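(* Let $p$ be a prime and let $G$ be a finite $p$-separable group. Suppose that the graph $\Gamma_p(G)$ is connected. Let $B_0$ be a non-central conjugacy class in $\operatorname{Con}(G_{p'})$ whose cardinality is maximal (among the classes in $\operatorname{Con}(G_{p'})$). Then $d(B_0,D)\leq 2$ for every non-central conjugacy class $D\in\operatorname{Con}(G_{p'})$.
   Context: All groups are finite. A group is $p$-separable if it has a normal series each of whose factors is either a $p$-group or a $p'$-group (a group of order not divisible by $p$). An element of $G$ is $p$-regular if its order is not divisible by $p$; $G_{p'}$ denotes the set of $p$-regular elements of $G$, and $\operatorname{Con}(G_{p'})=\{x^G : x\in G_{p'}\}$ is the set of conjugacy classes of $G$ of $p$-regular elements, where $x^G$ is the conjugacy class of $x$ in $G$. The length of a class is its cardinality. A class $x^G$ is non-central if $x\notin \mathbf{Z}(G)$, i.e. $|x^G|>1$. The common divisor graph $\Gamma_p(G)$ is the simple undirected graph whose vertices are the non-central classes in $\operatorname{Con}(G_{p'})$, with two distinct vertices $B$ and $C$ adjacent if and only if $\gcd(|B|,|C|)>1$. For two vertices $B,C$, $d(B,C)$ denotes their distance in $\Gamma_p(G)$, i.e. the number of edges in a shortest path joining them. *)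

theory Defs
  imports
    "HOL-Algebra.Algebra"
    "HOL-Computational_Algebra.Primes"
    "Graph_Theory.Graph_Theory"
begin

definition p_group :: "nat \<Rightarrow> ('a, 'b) monoid_scheme \<Rightarrow> bool" where
  "p_group p H \<longleftrightarrow> (\<exists>k. order H = p ^ k)"

definition p'_group :: "nat \<Rightarrow> ('a, 'b) monoid_scheme \<Rightarrow> bool" where
  "p'_group p H \<longleftrightarrow> \<not> p dvd order H"

text \<open>A normal series is an ascending chain from the trivial subgroup to the whole group; every
  term is normal in the whole group, not merely in the next term.\<close>

definition normal_series :: "('a, 'b) monoid_scheme \<Rightarrow> 'a set list \<Rightarrow> bool" where
  "normal_series G Ns \<longleftrightarrow>
     Ns \<noteq> [] \<and> hd Ns = {\<one>\<^bsub>G\<^esub>} \<and> last Ns = carrier G \<and>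
     (\<forall>N \<in> set Ns. N \<lhd> G) \<and> (\<forall>i. Suc i < length Ns \<longrightarrow> Ns ! i \<subseteq> Ns ! Suc i)"

definition p_separable :: "nat \<Rightarrow> ('a, 'b) monoid_scheme \<Rightarrow> bool" where
  "p_separable p G \<longleftrightarrow>
     (\<exists>Ns. normal_series G Ns \<and>
        (\<forall>i. Suc i < length Ns \<longrightarrow>
           p_group p (G\<lparr>carrier := Ns ! Suc i\<rparr> Mod Ns ! i) \<or>
           p'_group p (G\<lparr>carrier := Ns ! Suc i\<rparr> Mod Ns ! i)))"

definition center :: "('a, 'b) monoid_scheme \<Rightarrow> 'a set" where
  "center G = {z \<in> carrier G. \<forall>g \<in> carrier G. g \<otimes>\<^bsub>G\<^esub> z = z \<otimes>\<^bsub>G\<^esub> g}"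

definition conj_class :: "('a, 'b) monoid_scheme \<Rightarrow> 'a \<Rightarrow> 'a set" where
  "conj_class G x = {g \<otimes>\<^bsub>G\<^esub> x \<otimes>\<^bsub>G\<^esub> inv\<^bsub>G\<^esub> g | g. g \<in> carrier G}"

definition p_regular :: "nat \<Rightarrow> ('a, 'b) monoid_scheme \<Rightarrow> 'a set" where
  "p_regular p G = {x \<in> carrier G. \<not> p dvd group.ord G x}"

definition p_regular_classes :: "nat \<Rightarrow> ('a, 'b) monoid_scheme \<Rightarrow> 'a set set" where
  "p_regular_classes p G = conj_class G ` p_regular p G"

definition noncentral_p_regular_classes :: "nat \<Rightarrow> ('a, 'b) monoid_scheme \<Rightarrow> 'a set set" where
  "noncentral_p_regular_classes p G = conj_class G ` (p_regular p G - center G)"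

text \<open>An undirected edge is represented by a pair of opposite arcs.\<close>

definition common_divisor_graph ::
  "nat \<Rightarrow> ('a, 'b) monoid_scheme \<Rightarrow> ('a set, 'a set \<times> 'a set) pre_digraph" where
  "common_divisor_graph p G =
     \<lparr>verts = noncentral_p_regular_classes p G,
      arcs = {(B, C). B \<in> noncentral_p_regular_classes p G \<and>
                      C \<in> noncentral_p_regular_classes p G \<and>
                      B \<noteq> C \<and> gcd (card B) (card C) > 1},
      tail = fst, head = snd\<rparr>"

text \<open>The number of arcs in a shortest walk, \<open>\<infinity>\<close> if there is none.\<close>

definition graph_dist :: "('a, 'b) pre_digraph \<Rightarrow> 'a \<Rightarrow> 'a \<Rightarrow> ereal" where
  "graph_dist \<Gamma> u v = wf_digraph.\<mu> \<Gamma> (\<lambda>_. 1) u v"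

lemma (in group) conj_class_eq_orbit:
  assumes "x \<in> carrier G"
  shows "conj_class G x = Group_Action.orbit G (\<lambda>g. \<lambda>h \<in> carrier G. g \<otimes> h \<otimes> inv g) x"
  using assms by (auto simp: conj_class_def Group_Action.orbit_def)

lemma (in group) card_conj_class_gt_1_iff:
  assumes "finite (carrier G)" "x \<in> carrier G"
  shows "card (conj_class G x) > 1 \<longleftrightarrow> x \<notin> center G"
proof -
  have fin: "finite (conj_class G x)"
    using assms(1) by (simp add: conj_class_def)
  have x: "x \<in> conj_class G x"
    unfolding conj_class_def using assms(2) by (intro CollectI exI[of _ \<one>]) simp
  have "x \<in> center G \<longleftrightarrow> conj_class G x = {x}"
  proof
    assume "x \<in> center G"
    then have "g \<otimes> x \<otimes> inv g = x" if "g \<in> carrier G" for g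
      using that assms(2) by (simp add: center_def m_assoc)
    then show "conj_class G x = {x}"
      using x by (auto simp: conj_class_def)
  next
    assume *: "conj_class G x = {x}"
    have "g \<otimes> x = x \<otimes> g" if "g \<in> carrier G" for g
    proof -
      have "g \<otimes> x \<otimes> inv g = x" using * that by (auto simp: conj_class_def)
      then show ?thesis using that assms(2) by (metis inv_solve_right' m_closed)
    qed
    then show "x \<in> center G" using assms(2) by (simp add: center_def)
  qed
  moreover have "card (conj_class G x) > 1 \<longleftrightarrow> conj_class G x \<noteq> {x}"
    using fin x by (metis One_nat_def card_1_singletonE card_gt_0_iff empty_iff is_singletonI
        is_singleton_altdef less_irrefl nat_neq_iff less_one singletonD)
  ultimately show ?thesis by simp
qed

lemma graph_common_divisor_graph:
  assumes "finite (carrier G)"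
  shows "graph (common_divisor_graph p G)"
proof -
  have "finite (noncentral_p_regular_classes p G)"
    using assms by (auto simp: noncentral_p_regular_classes_def p_regular_def)
  then have "finite (arcs (common_divisor_graph p G))"
    by (auto simp: common_divisor_graph_def
        intro: finite_subset[of _ "noncentral_p_regular_classes p G \<times> noncentral_p_regular_classes p G"])
  with \<open>finite (noncentral_p_regular_classes p G)\<close> show ?thesis
    by unfold_locales
      (auto simp: common_divisor_graph_def arc_to_ends_def arcs_ends_def symmetric_def gcd.commute image_iff
        intro!: symI)
qed

end

theory Submission
  imports Defs
begin

text \<open>Let \<open>b \<in> B\<^sub>0\<close> and suppose that some class has distance at least three from \<open>B\<^sub>0\<close>. By connectedness
  there are a class of this kind, represented without loss of generality by a \<open>q\<close>-element \<open>d\<close>, a prime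
  \<open>s\<close> and a class \<open>b\<^sub>1\<^sup>G\<close> such that \<open>s\<close> divides \<open>|b\<^sub>1\<^sup>G|\<close> but neither \<open>|B\<^sub>0|\<close> nor \<open>|d\<^sup>G|\<close>, and \<open>|b\<^sub>1\<^sup>G|\<close>
  is not coprime to \<open>|B\<^sub>0|\<close>. Every \<open>p\<close>-regular class has length coprime to \<open>|B\<^sub>0|\<close> or to \<open>|d\<^sup>G|\<close>.

  In a \<open>p\<close>-separable group two \<open>p\<close>-regular elements with coprime class lengths generate a \<open>p'\<close>-group.
  So if \<open>|x\<^sup>G|\<close> is coprime to \<open>|B\<^sub>0|\<close>, then \<open>B\<^sub>0 x\<^sup>G\<close> is a \<open>p\<close>-regular class; by maximality it equals
  \<open>B\<^sub>0 x\<close>, and hence \<open>[x, G]\<close> lies in the normal subgroup \<open>S = {k. B\<^sub>0 k = B\<^sub>0}\<close>, whose order divides \<open>|B\<^sub>0|\<close>.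
  It follows that \<open>S\<close> centralizes \<open>x\<close>, and that \<open>l\<close> divides \<open>|B\<^sub>0|\<close> if \<open>x\<close> is a noncentral \<open>l\<close>-element. If a prime
  \<open>l \<noteq> p\<close> divides neither \<open>|B\<^sub>0|\<close> nor \<open>|d\<^sup>G|\<close>, then all \<open>l\<close>-elements are central; therefore \<open>s = p\<close>.

  For primes \<open>l\<close> not dividing \<open>|d\<^sup>G|\<close> the \<open>l\<close>-part of \<open>b\<close> is central; this is delicate for \<open>l = q\<close> only.
  For primes \<open>r\<close> dividing \<open>|d\<^sup>G|\<close> the noncentral \<open>r\<close>-elements act without fixed points on \<open>[d, G]\<close>, so
  that, as in a Frobenius complement, commuting \<open>r\<close>-elements are powers of each other modulo the centre.
  This allows one to modify \<open>b\<^sub>1\<close>, one prime at a time, until \<open>C(b\<^sub>1) \<subseteq> C(b)\<close> while \<open>p\<close> still divides its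
  class length. Then maximality yields \<open>C(b\<^sub>1) = C(b)\<close>, although \<open>p\<close> does not divide \<open>|B\<^sub>0|\<close>.\<close>

section \<open>Centralizers and class lengths\<close>

lemma card_image_times_fibre:
  assumes "finite A" "\<And>a. a \<in> A \<Longrightarrow> card {a' \<in> A. f a' = f a} = k"
  shows "card (f ` A) * k = card A"
proof -
  have "card A = (\<Sum>b\<in>f ` A. card {a \<in> A. f a = b})"
    using assms(1) by (subst card_eq_sum, subst sum.image_gen[of A _ f]) simp_all
  also have "\<dots> = (\<Sum>b\<in>f ` A. k)"
    using assms(2) by (intro sum.cong) auto
  finally show ?thesis by simp
qed

text \<open>Used for the double product over powers of \<open>e\<close> and \<open>f\<close> in
  \<open>exists_central_mult\<close>. Taking \<open>f\<close> total into the carrier spares range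
  conditions in the induction.\<close>

lemma (in comm_group) finprod_atMost_swap:
  assumes f: "\<And>i j. f i j \<in> carrier G"
  shows "finprod G (\<lambda>i. finprod G (f i) {..m::nat}) {..n::nat} = finprod G (\<lambda>j. finprod G (\<lambda>i. f i j) {..n}) {..m}"
proof (induction n)
  case 0
  have "finprod G (f 0) {..m} \<in> carrier G" using f by simp
  then show ?case using f by simp
next
  case (Suc n)
  have "finprod G (\<lambda>i. finprod G (f i) {..m}) {..Suc n}
      = finprod G (f (Suc n)) {..m} \<otimes> finprod G (\<lambda>i. finprod G (f i) {..m}) {..n}"
    using f by (subst finprod_Suc) auto
  also have "\<dots> = finprod G (\<lambda>j. f (Suc n) j \<otimes> finprod G (\<lambda>i. f i j) {..n}) {..m}"
    unfolding Suc using f by (subst finprod_multf) auto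
  also have "\<dots> = finprod G (\<lambda>j. finprod G (\<lambda>i. f i j) {..Suc n}) {..m}"
    using f by (intro finprod_cong') (auto simp: finprod_Suc)
  finally show ?case .
qed

definition centralizer :: "('a, 'b) monoid_scheme \<Rightarrow> 'a \<Rightarrow> 'a set" where
  "centralizer G x = {g \<in> carrier G. g \<otimes>\<^bsub>G\<^esub> x = x \<otimes>\<^bsub>G\<^esub> g}"

definition class_size :: "('a, 'b) monoid_scheme \<Rightarrow> 'a \<Rightarrow> nat" where
  "class_size G x = card (conj_class G x)"

definition primary :: "('a, 'b) monoid_scheme \<Rightarrow> nat \<Rightarrow> 'a \<Rightarrow> bool" where
  "primary G l x \<longleftrightarrow> x \<in> carrier G \<and> (\<exists>k. group.ord G x = l ^ k)"

locale finite_group = group G for G (structure) +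
  assumes finite_carrier [simp, intro]: "finite (carrier G)"
begin

lemma inv_mult_cancel [simp]:
  "g \<in> carrier G \<Longrightarrow> x \<in> carrier G \<Longrightarrow> inv g \<otimes> (g \<otimes> x) = x"
  "g \<in> carrier G \<Longrightarrow> x \<in> carrier G \<Longrightarrow> g \<otimes> (inv g \<otimes> x) = x"
  by (simp_all flip: m_assoc)

lemma subgroup_mem: "subgroup H G \<Longrightarrow> h \<in> H \<Longrightarrow> h \<in> carrier G"
  by (rule subgroup.mem_carrier)

lemma subgroup_mult: "subgroup H G \<Longrightarrow> h \<in> H \<Longrightarrow> k \<in> H \<Longrightarrow> h \<otimes> k \<in> H"
  by (rule subgroup.m_closed)

lemma subgroup_inv: "subgroup H G \<Longrightarrow> h \<in> H \<Longrightarrow> inv h \<in> H"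
  by (rule subgroup.m_inv_closed)

lemma subgroup_one: "subgroup H G \<Longrightarrow> \<one> \<in> H"
  by (rule subgroup.one_closed)

lemma centralizerD: "g \<in> centralizer G x \<Longrightarrow> g \<in> carrier G" "g \<in> centralizer G x \<Longrightarrow> g \<otimes> x = x \<otimes> g"
  by (simp_all add: centralizer_def)

lemma centralizer_subset [simp]: "centralizer G x \<subseteq> carrier G"
  by (auto simp: centralizer_def)

lemma centralizer_sym: "x \<in> carrier G \<Longrightarrow> g \<in> centralizer G x \<Longrightarrow> x \<in> centralizer G g"
  by (simp add: centralizer_def)

lemma centralizer_self [simp]: "x \<in> carrier G \<Longrightarrow> x \<in> centralizer G x"
  by (simp add: centralizer_def)

lemma finite_subset_carrier: "H \<subseteq> carrier G \<Longrightarrow> finite H"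
  using finite_subset by blast

lemma subgroup_finite: "subgroup H G \<Longrightarrow> finite H"
  using finite_subset_carrier subgroup.subset by blast

lemma card_subgroup_pos: "subgroup H G \<Longrightarrow> card H > 0"
  using subgroup_finite subgroup.one_closed by (metis card_gt_0_iff empty_iff)

lemma subgroup_centralizer:
  assumes x: "x \<in> carrier G" shows "subgroup (centralizer G x) G"
proof (rule subgroupI)
  show "centralizer G x \<subseteq> carrier G" by simp
  show "centralizer G x \<noteq> {}" using x by (metis centralizer_self empty_iff)
next
  fix a assume "a \<in> centralizer G x"
  then have a: "a \<in> carrier G" "a \<otimes> x = x \<otimes> a" by (auto dest: centralizerD)
  have "inv a \<otimes> x = inv a \<otimes> (x \<otimes> a) \<otimes> inv a" using a(1) x by (simp add: m_assoc)
  also have "\<dots> = inv a \<otimes> (a \<otimes> x) \<otimes> inv a" using a by simp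
  also have "\<dots> = x \<otimes> inv a" using a(1) x by simp
  finally show "inv a \<in> centralizer G x" using a by (simp add: centralizer_def)
next
  fix a b assume "a \<in> centralizer G x" "b \<in> centralizer G x"
  then have a: "a \<in> carrier G" "a \<otimes> x = x \<otimes> a" "b \<in> carrier G" "b \<otimes> x = x \<otimes> b"
    by (auto dest: centralizerD)
  have "a \<otimes> b \<otimes> x = x \<otimes> (a \<otimes> b)" using a x by (metis m_assoc)
  then show "a \<otimes> b \<in> centralizer G x" using a by (simp add: centralizer_def)
qed

lemma centralizer_mult:
  "x \<in> carrier G \<Longrightarrow> g \<in> centralizer G x \<Longrightarrow> h \<in> centralizer G x \<Longrightarrow> g \<otimes> h \<in> centralizer G x"
  by (rule subgroup_mult[OF subgroup_centralizer])

lemma centralizer_inv: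
  "x \<in> carrier G \<Longrightarrow> g \<in> centralizer G x \<Longrightarrow> inv g \<in> centralizer G x"
  by (rule subgroup_inv[OF subgroup_centralizer])

lemma subgroup_pow: "subgroup H G \<Longrightarrow> h \<in> H \<Longrightarrow> h [^] (n::nat) \<in> H"
  by (induction n) (auto intro: subgroup.one_closed subgroup.m_closed)

lemma centralizer_pow:
  "x \<in> carrier G \<Longrightarrow> g \<in> centralizer G x \<Longrightarrow> g [^] (n::nat) \<in> centralizer G x"
  using subgroup_centralizer subgroup_pow by blast

lemma centralizer_le_pow:
  assumes "x \<in> carrier G" shows "centralizer G x \<subseteq> centralizer G (x [^] (n::nat))"
  using assms by (metis centralizer_pow centralizer_sym centralizerD(1) nat_pow_closed subsetI)

lemma centralizer_conj:
  assumes "x \<in> carrier G" "g \<in> carrier G" "h \<in> carrier G"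
  shows "h \<in> centralizer G (g \<otimes> x \<otimes> inv g) \<longleftrightarrow> inv g \<otimes> h \<otimes> g \<in> centralizer G x"
proof -
  have "h \<otimes> (g \<otimes> x \<otimes> inv g) = (g \<otimes> x \<otimes> inv g) \<otimes> h \<longleftrightarrow>
      inv g \<otimes> (h \<otimes> (g \<otimes> x \<otimes> inv g)) \<otimes> g = inv g \<otimes> ((g \<otimes> x \<otimes> inv g) \<otimes> h) \<otimes> g"
    using assms by simp
  also have "inv g \<otimes> (h \<otimes> (g \<otimes> x \<otimes> inv g)) \<otimes> g = (inv g \<otimes> h \<otimes> g) \<otimes> x"
    using assms by (simp add: m_assoc)
  also have "inv g \<otimes> ((g \<otimes> x \<otimes> inv g) \<otimes> h) \<otimes> g = x \<otimes> (inv g \<otimes> h \<otimes> g)"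
    using assms by (simp add: m_assoc)
  finally show ?thesis using assms by (simp add: centralizer_def)
qed

lemma card_subgroup_dvd:
  assumes "subgroup H G" "subgroup K G" "H \<subseteq> K" shows "card H dvd card K"
proof -
  interpret K: group "G\<lparr>carrier := K\<rparr>" using assms(2) by (rule subgroup_imp_group)
  have "subgroup H (G\<lparr>carrier := K\<rparr>)"
    using assms subgroup_incl by blast
  from K.lagrange[OF this] have "card (rcosets\<^bsub>G\<lparr>carrier := K\<rparr>\<^esub> H) * card H = card K"
    by (simp add: order_def)
  then show ?thesis by (rule dvdI[OF sym, OF trans[OF mult.commute]])
qed

text \<open>Orbit-stabilizer for conjugation by \<open>Y\<close>: the fibre through \<open>h\<close>
  is the coset \<open>h (Y \<inter> C(x))\<close>.\<close>

lemma card_orbit_times_stabilizer: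
  assumes Y: "subgroup Y G" and x: "x \<in> carrier G"
  shows "card ((\<lambda>h. h \<otimes> x \<otimes> inv h) ` Y) * card (Y \<inter> centralizer G x) = card Y"
proof (rule card_image_times_fibre)
  show "finite Y" using Y by (rule subgroup_finite)
  fix h assume h: "h \<in> Y"
  then have hc: "h \<in> carrier G" using Y subgroup_mem by blast
  have "bij_betw (\<lambda>c. h \<otimes> c) (Y \<inter> centralizer G x) {h' \<in> Y. h' \<otimes> x \<otimes> inv h' = h \<otimes> x \<otimes> inv h}"
    unfolding bij_betw_def
  proof (intro conjI equalityI subsetI)
    show "inj_on (\<lambda>c. h \<otimes> c) (Y \<inter> centralizer G x)"
      using hc subgroup_mem[OF Y] by (intro inj_onI) auto
  next
    fix z assume "z \<in> (\<lambda>c. h \<otimes> c) ` (Y \<inter> centralizer G x)"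
    then obtain c where c: "c \<in> Y" "c \<in> carrier G" "c \<otimes> x = x \<otimes> c" "z = h \<otimes> c"
      by (auto simp: centralizer_def)
    have "z \<otimes> x \<otimes> inv z = h \<otimes> (c \<otimes> x) \<otimes> inv c \<otimes> inv h"
      using c hc x by (simp add: inv_mult_group m_assoc)
    also have "\<dots> = h \<otimes> (x \<otimes> c) \<otimes> inv c \<otimes> inv h" using c by simp
    also have "\<dots> = h \<otimes> x \<otimes> inv h" using c(2) hc x by (simp add: m_assoc)
    finally show "z \<in> {h' \<in> Y. h' \<otimes> x \<otimes> inv h' = h \<otimes> x \<otimes> inv h}"
      using c h Y by (simp add: subgroup.m_closed)
  next
    fix z assume "z \<in> {h' \<in> Y. h' \<otimes> x \<otimes> inv h' = h \<otimes> x \<otimes> inv h}"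
    then have z: "z \<in> Y" "z \<otimes> x \<otimes> inv z = h \<otimes> x \<otimes> inv h" by auto
    have zc: "z \<in> carrier G" using z Y subgroup_mem by blast
    have "inv h \<otimes> z \<otimes> x = inv h \<otimes> (z \<otimes> x \<otimes> inv z) \<otimes> z"
      using zc hc x by (simp add: m_assoc)
    also have "\<dots> = x \<otimes> (inv h \<otimes> z)" using zc hc x z(2) by (simp add: m_assoc)
    finally have "inv h \<otimes> z \<in> Y \<inter> centralizer G x"
      using zc hc z(1) h Y by (auto simp: centralizer_def subgroup.m_closed subgroup.m_inv_closed)
    moreover have "z = h \<otimes> (inv h \<otimes> z)" using zc hc by (simp flip: m_assoc)
    ultimately show "z \<in> (\<lambda>c. h \<otimes> c) ` (Y \<inter> centralizer G x)" by blast
  qed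
  then show "card {h' \<in> Y. h' \<otimes> x \<otimes> inv h' = h \<otimes> x \<otimes> inv h} = card (Y \<inter> centralizer G x)"
    by (simp add: bij_betw_same_card)
qed

text \<open>The pairs with the same product as \<open>(h, k)\<close> are exactly
  \<open>(h i, inv i k)\<close> with \<open>i\<close> in the intersection.\<close>

lemma card_set_mult_times_Int:
  assumes H: "subgroup H G" and K: "subgroup K G"
  shows "card (H <#> K) * card (H \<inter> K) = card H * card K"
proof -
  have "H <#> K = (\<lambda>(h, k). h \<otimes> k) ` (H \<times> K)" by (auto simp: set_mult_def)
  moreover have "card ((\<lambda>(h, k). h \<otimes> k) ` (H \<times> K)) * card (H \<inter> K) = card (H \<times> K)"
  proof (rule card_image_times_fibre)
    show "finite (H \<times> K)" using assms subgroup_finite by blast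
    fix a assume "a \<in> H \<times> K"
    then obtain h k where a: "a = (h, k)" "h \<in> H" "k \<in> K" by blast
    then have hk: "h \<in> carrier G" "k \<in> carrier G" using subgroup_mem[OF H] subgroup_mem[OF K] by blast+
    have "bij_betw (\<lambda>i. (h \<otimes> i, inv i \<otimes> k)) (H \<inter> K) {a' \<in> H \<times> K. (case a' of (h, k) \<Rightarrow> h \<otimes> k) = (case a of (h, k) \<Rightarrow> h \<otimes> k)}"
      unfolding bij_betw_def
    proof (intro conjI equalityI subsetI)
      show "inj_on (\<lambda>i. (h \<otimes> i, inv i \<otimes> k)) (H \<inter> K)"
        using hk subgroup.mem_carrier[OF H] by (intro inj_onI) auto
    next
      fix z assume "z \<in> (\<lambda>i. (h \<otimes> i, inv i \<otimes> k)) ` (H \<inter> K)"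
      then obtain i where i: "i \<in> H" "i \<in> K" "z = (h \<otimes> i, inv i \<otimes> k)" by blast
      have "i \<in> carrier G" using i subgroup_mem[OF H] by blast
      then have "h \<otimes> i \<otimes> (inv i \<otimes> k) = h \<otimes> k" using hk by (simp add: m_assoc)
      then show "z \<in> {a' \<in> H \<times> K. (case a' of (h, k) \<Rightarrow> h \<otimes> k) = (case a of (h, k) \<Rightarrow> h \<otimes> k)}"
        using i a assms by (simp add: subgroup.m_closed subgroup.m_inv_closed)
    next
      fix z assume z: "z \<in> {a' \<in> H \<times> K. (case a' of (h, k) \<Rightarrow> h \<otimes> k) = (case a of (h, k) \<Rightarrow> h \<otimes> k)}"
      then obtain h' k' where z': "z = (h', k')" "h' \<in> H" "k' \<in> K" "h' \<otimes> k' = h \<otimes> k"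
        using a by auto
      then have hk': "h' \<in> carrier G" "k' \<in> carrier G" using subgroup_mem[OF H] subgroup_mem[OF K] by blast+
      have eq: "inv h \<otimes> h' = k \<otimes> inv k'"
        using z'(4) hk hk' by (metis inv_closed inv_solve_left inv_solve_right m_assoc m_closed)
      let ?i = "inv h \<otimes> h'"
      have "?i \<in> H" using a z' H by (simp add: subgroup.m_closed subgroup.m_inv_closed)
      moreover have "?i \<in> K" using a z' K eq by (simp add: subgroup.m_closed subgroup.m_inv_closed)
      moreover have "h \<otimes> ?i = h'" using hk hk' by (simp flip: m_assoc)
      moreover have "inv ?i \<otimes> k = k'" using hk hk' unfolding eq by (simp add: inv_mult_group m_assoc)
      ultimately show "z \<in> (\<lambda>i. (h \<otimes> i, inv i \<otimes> k)) ` (H \<inter> K)"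
        using z'(1) by (intro image_eqI[where x = ?i]) simp_all
    qed
    then show "card {a' \<in> H \<times> K. (case a' of (h, k) \<Rightarrow> h \<otimes> k) = (case a of (h, k) \<Rightarrow> h \<otimes> k)} = card (H \<inter> K)"
      by (simp add: bij_betw_same_card)
  qed
  ultimately show ?thesis by (simp add: card_cartesian_product)
qed

lemma conj_class_image: "conj_class G x = (\<lambda>h. h \<otimes> x \<otimes> inv h) ` carrier G"
  by (auto simp: conj_class_def)

lemma conj_class_subset: "x \<in> carrier G \<Longrightarrow> conj_class G x \<subseteq> carrier G"
  by (auto simp: conj_class_def)

lemma class_size_times_centralizer:
  assumes "x \<in> carrier G" shows "class_size G x * card (centralizer G x) = order G"
proof -
  have "carrier G \<inter> centralizer G x = centralizer G x" by (auto simp: centralizer_def)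
  then show ?thesis
    using card_orbit_times_stabilizer[OF subgroup_self assms]
    by (simp add: class_size_def conj_class_image order_def)
qed

lemma class_size_pos: "x \<in> carrier G \<Longrightarrow> class_size G x > 0"
  using class_size_times_centralizer[of x] order_gt_0_iff_finite finite_carrier
  by (metis gr0I mult_is_0 less_not_refl)

lemma class_size_dvd:
  assumes x: "x \<in> carrier G" and y: "y \<in> carrier G" and sub: "centralizer G y \<subseteq> centralizer G x"
  shows "class_size G x dvd class_size G y"
proof -
  have "card (centralizer G y) dvd card (centralizer G x)"
    using card_subgroup_dvd subgroup_centralizer x y sub by blast
  then obtain m where m: "card (centralizer G x) = card (centralizer G y) * m" by auto
  have "class_size G y * card (centralizer G y) = class_size G x * (card (centralizer G y) * m)"
    using class_size_times_centralizer x y m by metis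
  then have "class_size G y = class_size G x * m"
    using card_subgroup_pos[OF subgroup_centralizer[OF y]] by simp
  then show ?thesis by simp
qed

text \<open>Inclusion of centralizers makes class sizes divide, so the size bound forces equal
  orders. Maximality of a class is exploited in this form.\<close>

lemma centralizer_eq_if_class_size_le:
  assumes x: "x \<in> carrier G" and y: "y \<in> carrier G" and sub: "centralizer G y \<subseteq> centralizer G x"
    and le: "class_size G y \<le> class_size G x"
  shows "centralizer G y = centralizer G x"
proof -
  have "class_size G x = class_size G y"
    using class_size_dvd[OF x y sub] le class_size_pos[OF y] by (meson dvd_imp_le le_antisym)
  then have "card (centralizer G x) = card (centralizer G y)"
    using class_size_times_centralizer[OF x] class_size_times_centralizer[OF y] class_size_pos[OF y]
    by (metis mult_cancel1 less_not_refl)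
  then show ?thesis
    using sub finite_subset_carrier[OF centralizer_subset] by (metis card_subset_eq)
qed

lemma class_size_eq_1_iff:
  assumes x: "x \<in> carrier G" shows "class_size G x = 1 \<longleftrightarrow> centralizer G x = carrier G"
proof
  assume "class_size G x = 1"
  then have "card (centralizer G x) = card (carrier G)"
    using class_size_times_centralizer[OF x] by (simp add: order_def)
  then show "centralizer G x = carrier G" by (simp add: card_subset_eq)
next
  assume "centralizer G x = carrier G"
  then show "class_size G x = 1"
    using class_size_times_centralizer[OF x] order_gt_0_iff_finite finite_carrier
    by (simp add: order_def card_gt_0_iff)
qed

lemma center_iff: "x \<in> center G \<longleftrightarrow> x \<in> carrier G \<and> centralizer G x = carrier G"
  by (auto simp: center_def centralizer_def)

lemma center_iff_class_size: "x \<in> carrier G \<Longrightarrow> x \<in> center G \<longleftrightarrow> class_size G x = 1"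
  unfolding center_iff by (simp only: class_size_eq_1_iff simp_thms)

text \<open>With \<open>|H| = |I| u\<close> and \<open>|K| = |I| v\<close> the indices satisfy
  \<open>a u = b v\<close>, so coprimality gives \<open>b dvd u\<close>; hence
  \<open>|H K| = u |K|\<close> is at least \<open>b |K| = |G|\<close>.\<close>

lemma set_mult_eq_carrier_if_coprime_index:
  assumes H: "subgroup H G" and K: "subgroup K G"
    and ab: "a * card H = order G" "b * card K = order G" "coprime a b"
  shows "H <#> K = carrier G"
proof -
  let ?I = "H \<inter> K"
  have I: "subgroup ?I G" using H K subgroups_Inter_pair by blast
  have pos: "card ?I > 0" using I by (rule card_subgroup_pos)
  obtain u where u: "card H = card ?I * u" using card_subgroup_dvd[OF I H] by (auto elim: dvdE)
  obtain v where v: "card K = card ?I * v" using card_subgroup_dvd[OF I K] by (auto elim: dvdE)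
  have "card ?I * (a * u) = card ?I * (b * v)" using ab(1,2) u v by (simp only: mult_ac)
  then have "a * u = b * v" using pos by simp
  then have "b dvd u" using ab(3) by (metis coprime_commute coprime_dvd_mult_right_iff dvd_triv_left)
  then have "u \<ge> b" using u card_subgroup_pos[OF H] by (metis dvd_imp_le gr0I mult_0_right less_not_refl)
  have "card (H <#> K) * card ?I = u * card K * card ?I"
    using card_set_mult_times_Int[OF H K] u by (simp only: mult_ac)
  then have "card (H <#> K) = u * card K" using pos by simp
  also have "\<dots> \<ge> card (carrier G)" using ab(2) \<open>u \<ge> b\<close> by (metis order_def mult_le_mono1)
  finally show ?thesis
    using card_seteq[of "carrier G" "H <#> K"] set_mult_closed[OF subgroup.subset[OF H] subgroup.subset[OF K]] by simp
qed

lemma factorize_coprime_class_sizes: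
  assumes "x \<in> carrier G" "y \<in> carrier G" "coprime (class_size G x) (class_size G y)" "g \<in> carrier G"
  obtains h k where "h \<in> centralizer G x" "k \<in> centralizer G y" "g = h \<otimes> k"
proof -
  have "centralizer G x <#> centralizer G y = carrier G"
    using set_mult_eq_carrier_if_coprime_index[OF subgroup_centralizer[OF assms(1)] subgroup_centralizer[OF assms(2)]
      class_size_times_centralizer[OF assms(1)] class_size_times_centralizer[OF assms(2)] assms(3)] .
  then show ?thesis using assms(4) that by (auto simp: set_mult_def)
qed

text \<open>The index \<open>u\<close> of \<open>C(x)\<close> in the subgroup \<open>S C(x)\<close>
  divides the class size of \<open>x\<close>; it equals the index of \<open>S \<inter> C(x)\<close>
  in \<open>S\<close>, so it divides \<open>|S|\<close> as well.\<close>

lemma normal_subset_centralizer_if_coprime: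
  assumes S: "S \<lhd> G" and x: "x \<in> carrier G" and cop: "coprime (card S) (class_size G x)"
  shows "S \<subseteq> centralizer G x"
proof -
  let ?C = "centralizer G x"
  have S': "subgroup S G" using S by (rule normal_imp_subgroup)
  have C: "subgroup ?C G" using x by (rule subgroup_centralizer)
  have SC: "subgroup (S <#> ?C) G" using mult_norm_subgroup[OF S C] .
  have I: "subgroup (S \<inter> ?C) G" using S' C subgroups_Inter_pair by blast
  have sub: "?C \<subseteq> S <#> ?C"
    using subgroup.one_closed[OF S'] by (force simp: set_mult_def centralizer_def)
  obtain u where u: "card (S <#> ?C) = card ?C * u" using card_subgroup_dvd[OF C SC sub] by (auto elim: dvdE)
  obtain v where v: "order G = card (S <#> ?C) * v"
    using card_subgroup_dvd[OF SC subgroup_self] subgroup.subset[OF SC] by (auto simp: order_def elim: dvdE)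
  have posC: "card ?C > 0" using C by (rule card_subgroup_pos)
  have "class_size G x * card ?C = (u * v) * card ?C" using class_size_times_centralizer[OF x] u v by (simp only: mult_ac)
  then have "u dvd class_size G x" using posC by simp
  have "card ?C * (u * card (S \<inter> ?C)) = card ?C * card S"
    using card_set_mult_times_Int[OF S' C] u by (simp add: mult.assoc mult.commute)
  then have uS: "u * card (S \<inter> ?C) = card S" using posC by simp
  then have "u dvd card S" by (metis dvd_triv_left)
  then have "u = 1" using \<open>u dvd class_size G x\<close> cop by (metis coprime_common_divisor_nat)
  then have "card (S \<inter> ?C) = card S" using uS by simp
  then have "S \<inter> ?C = S" using subgroup_finite[OF S'] by (simp add: card_subset_eq)
  then show ?thesis by blast
qed

section \<open>Cyclic subgroups and fixed points of elements of prime power order\<close>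

lemma generate_singleton:
  assumes "y \<in> carrier G" shows "generate G {y} = range (\<lambda>i::nat. y [^] i)"
proof -
  have pos: "ord y > 0" using ord_ge_1[OF finite_carrier assms] by simp
  have "generate G {y} = {y [^] k |k. k \<in> (UNIV :: int set)}" using generate_pow[OF assms] .
  also have "\<dots> = range (\<lambda>i::nat. y [^] i)"
  proof (intro equalityI subsetI)
    fix z assume "z \<in> {y [^] k |k. k \<in> (UNIV :: int set)}"
    then obtain k :: int where "z = y [^] k" by blast
    also have "\<dots> = y [^] (k mod int (ord y))"
      using assms by (simp add: int_pow_eq mod_eq_dvd_iff[symmetric])
    also have "\<dots> = y [^] nat (k mod int (ord y))"
      using pos by (metis int_pow_int nat_0_le of_nat_0_less_iff pos_mod_sign)
    finally show "z \<in> range (\<lambda>i::nat. y [^] i)" by blast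
  next
    fix z assume "z \<in> range (\<lambda>i::nat. y [^] i)"
    then show "z \<in> {y [^] k |k. k \<in> (UNIV :: int set)}" by (auto simp flip: int_pow_int)
  qed
  finally show ?thesis .
qed

lemma card_generate_singleton: "y \<in> carrier G \<Longrightarrow> card (generate G {y}) = ord y"
  using generate_pow_card by simp

lemma subgroup_generate_singleton: "y \<in> carrier G \<Longrightarrow> subgroup (generate G {y}) G"
  by (simp add: generate_is_subgroup)

lemma generate_singleton_le:
  assumes "subgroup H G" "y \<in> H" shows "generate G {y} \<subseteq> H"
  using assms generate_subgroup_incl by blast

text \<open>Conjugation by the powers of an \<open>l\<close>-element \<open>y\<close> has orbits of \<open>l\<close>-power length.\<close>

lemma dvd_card_not_fixed_by_primary:
  assumes l: "Factorial_Ring.prime l" and y: "primary G l y" and E: "E \<subseteq> carrier G"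
    and closed: "\<And>e. e \<in> E \<Longrightarrow> y \<otimes> e \<otimes> inv y \<in> E"
  shows "l dvd card {e \<in> E. e \<notin> centralizer G y}"
proof -
  have yc: "y \<in> carrier G" using y by (simp add: primary_def)
  obtain k where k: "ord y = l ^ k" using y by (auto simp: primary_def)
  define P where "P = generate G {y}"
  define Orb where "Orb e = (\<lambda>h. h \<otimes> e \<otimes> inv h) ` P" for e
  let ?E = "{e \<in> E. e \<notin> centralizer G y}"
  have P: "subgroup P G" unfolding P_def using yc by (rule subgroup_generate_singleton)
  have yP: "y \<in> P" unfolding P_def by (simp add: generate.incl)
  have cardP: "card P = l ^ k" unfolding P_def using card_generate_singleton[OF yc] k by simp
  have closedP: "h \<otimes> e \<otimes> inv h \<in> E" if hP: "h \<in> P" and eE: "e \<in> E" for h e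
  proof -
    obtain n :: nat where n: "h = y [^] n" using hP unfolding P_def generate_singleton[OF yc] by blast
    have "y [^] n \<otimes> e \<otimes> inv (y [^] n) \<in> E" using eE
    proof (induction n)
      case 0
      have "e \<in> carrier G" using 0 E by blast
      then show ?case using 0 by simp
    next
      case (Suc n)
      have e: "e \<in> carrier G" using Suc.prems E by blast
      have "y [^] Suc n \<otimes> e \<otimes> inv (y [^] Suc n) = y \<otimes> (y [^] n \<otimes> e \<otimes> inv (y [^] n)) \<otimes> inv y"
        using e yc by (subst (1 2) nat_pow_Suc2) (simp_all add: inv_mult_group m_assoc)
      then show ?case using closed[OF Suc.IH[OF Suc.prems]] by simp
    qed
    then show ?thesis using n by simp
  qed
  have commP: "P \<subseteq> centralizer G y"
    unfolding P_def using generate_singleton_le[OF subgroup_centralizer[OF yc]] yc by simp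
  have closedE: "h \<otimes> e \<otimes> inv h \<in> ?E" if h: "h \<in> P" and e: "e \<in> ?E" for h e
  proof -
    have hc: "h \<in> carrier G" using subgroup_mem[OF P h] .
    have ec: "e \<in> carrier G" using e E by blast
    have "inv h \<otimes> y \<otimes> h = y"
    proof -
      have "y \<otimes> h = h \<otimes> y" using h commP yc by (auto simp: centralizer_def)
      then show ?thesis using hc yc by (simp add: m_assoc)
    qed
    then have "y \<in> centralizer G (h \<otimes> e \<otimes> inv h) \<longleftrightarrow> y \<in> centralizer G e"
      using centralizer_conj[OF ec hc yc] by simp
    then have "h \<otimes> e \<otimes> inv h \<notin> centralizer G y"
      using e ec hc yc centralizer_sym by (metis (no_types, lifting) inv_closed m_closed mem_Collect_eq)
    then show ?thesis using closedP[OF h] e by blast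
  qed
  define r where "r = {(e, e'). e \<in> ?E \<and> e' \<in> Orb e}"
  have "equiv ?E r"
  proof (rule equivI)
    show "r \<subseteq> ?E \<times> ?E" using closedE by (auto simp: r_def Orb_def)
    show "refl_on ?E r"
      unfolding refl_on_def r_def Orb_def using subgroup_one[OF P] E by (auto simp: image_iff intro!: bexI[of _ "\<one>"])
    show "sym r"
    proof (rule symI)
      fix a b assume "(a, b) \<in> r"
      then obtain h where h: "a \<in> ?E" "h \<in> P" "b = h \<otimes> a \<otimes> inv h" by (auto simp: r_def Orb_def)
      have hc: "h \<in> carrier G" "a \<in> carrier G" using subgroup_mem[OF P h(2)] h(1) E by auto
      have "a = inv h \<otimes> b \<otimes> inv (inv h)" using h(3) hc by (simp add: m_assoc)
      then show "(b, a) \<in> r"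
        using h closedE subgroup_inv[OF P h(2)] by (auto simp: r_def Orb_def)
    qed
    show "trans r"
    proof (rule transI)
      fix a b c assume "(a, b) \<in> r" "(b, c) \<in> r"
      then obtain h g where h: "a \<in> ?E" "h \<in> P" "b = h \<otimes> a \<otimes> inv h" "g \<in> P" "c = g \<otimes> b \<otimes> inv g"
        by (auto simp: r_def Orb_def)
      have hc: "h \<in> carrier G" "a \<in> carrier G" "g \<in> carrier G"
        using subgroup_mem[OF P h(2)] subgroup_mem[OF P h(4)] h(1) E by auto
      have "c = (g \<otimes> h) \<otimes> a \<otimes> inv (g \<otimes> h)" using h(3,5) hc by (simp add: m_assoc inv_mult_group)
      then show "(a, c) \<in> r"
        using h(1) subgroup_mult[OF P h(4,2)] by (auto simp: r_def Orb_def)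
    qed
  qed
  moreover have "l dvd card T" if T: "T \<in> ?E // r" for T
  proof -
    obtain e where e: "e \<in> ?E" "T = r `` {e}" using T by (auto elim: quotientE)
    then have TO: "T = Orb e" by (auto simp: r_def)
    have ec: "e \<in> carrier G" using e E by blast
    have eq: "card T * card (P \<inter> centralizer G e) = l ^ k"
      using card_orbit_times_stabilizer[OF P ec] cardP by (simp add: TO Orb_def)
    then have "card T dvd l ^ k" by (metis dvd_triv_left)
    then obtain i where i: "card T = l ^ i" using l by (auto simp: divides_primepow_nat)
    \<comment> \<open>An orbit of length one would be a point commuting with \<open>y\<close>, and
      such points were removed from \<open>E\<close>.\<close>
    have "card T \<noteq> 1"
    proof
      assume "card T = 1"
      then have "card (P \<inter> centralizer G e) = card P" using eq cardP by simp
      then have "P \<inter> centralizer G e = P" using subgroup_finite[OF P] by (simp add: card_subset_eq)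
      then have "y \<in> centralizer G e" using yP by blast
      then show False using e(1) ec centralizer_sym by blast
    qed
    then show ?thesis using i by (cases i) auto
  qed
  moreover have "finite ?E" using E by (simp add: finite_subset_carrier)
  ultimately show ?thesis using equiv_imp_dvd_card[of ?E r l] by blast
qed

text \<open>By the preceding congruence the conjugates of \<open>x\<close> under \<open>Y\<close>
  that fail to commute with \<open>y\<close> cannot fill the orbit; a conjugate by \<open>h\<close>
  that does commute is moved back by \<open>h\<close>.\<close>

lemma orbit_fixed_by_primary:
  assumes l: "Factorial_Ring.prime l" and y: "primary G l y" and Y: "subgroup Y G" "y \<in> Y"
    and x: "x \<in> carrier G" and ndvd: "\<not> l dvd card ((\<lambda>h. h \<otimes> x \<otimes> inv h) ` Y)"
  obtains h where "h \<in> Y" "inv h \<otimes> y \<otimes> h \<in> centralizer G x"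
proof -
  let ?E = "(\<lambda>h. h \<otimes> x \<otimes> inv h) ` Y"
  have yc: "y \<in> carrier G" using y by (simp add: primary_def)
  have "l dvd card {e \<in> ?E. e \<notin> centralizer G y}"
  proof (rule dvd_card_not_fixed_by_primary[OF l y])
    show "?E \<subseteq> carrier G" using subgroup_mem[OF Y(1)] x by auto
    fix e assume "e \<in> ?E"
    then obtain h where h: "h \<in> Y" "e = h \<otimes> x \<otimes> inv h" by blast
    have "y \<otimes> e \<otimes> inv y = (y \<otimes> h) \<otimes> x \<otimes> inv (y \<otimes> h)"
      using h yc x subgroup_mem[OF Y(1) h(1)] by (simp add: m_assoc inv_mult_group)
    then show "y \<otimes> e \<otimes> inv y \<in> ?E" using subgroup_mult[OF Y h(1)] by blast
  qed
  then have "{e \<in> ?E. e \<notin> centralizer G y} \<noteq> ?E" using ndvd by metis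
  then obtain h where h: "h \<in> Y" "h \<otimes> x \<otimes> inv h \<in> centralizer G y" by auto
  have hc: "h \<in> carrier G" using subgroup_mem[OF Y(1) h(1)] .
  have "y \<in> centralizer G (h \<otimes> x \<otimes> inv h)" using centralizer_sym[OF yc h(2)] .
  then have "inv h \<otimes> y \<otimes> h \<in> centralizer G x" using centralizer_conj[OF x hc yc] by simp
  then show ?thesis using h(1) that by blast
qed

lemma primary_conj_into_centralizer:
  assumes "Factorial_Ring.prime l" "primary G l y" "x \<in> carrier G" "\<not> l dvd class_size G x"
  obtains h where "h \<in> carrier G" "inv h \<otimes> y \<otimes> h \<in> centralizer G x"
proof -
  have "y \<in> carrier G" using assms(2) by (simp add: primary_def)
  then show ?thesis
    using orbit_fixed_by_primary[OF assms(1,2) subgroup_self _ assms(3)] assms(4) that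
    by (auto simp: class_size_def conj_class_image)
qed

section \<open>Conjugation, the centre, and recovering elements from their powers\<close>

lemma ord_conj:
  assumes "x \<in> carrier G" "g \<in> carrier G" shows "ord (g \<otimes> x \<otimes> inv g) = ord x"
proof -
  have "(g \<otimes> x \<otimes> inv g) [^] n = g \<otimes> x [^] n \<otimes> inv g" for n :: nat
    using assms by (induction n) (simp_all add: m_assoc)
  moreover have "g \<otimes> x [^] n \<otimes> inv g = \<one> \<longleftrightarrow> x [^] n = \<one>" for n :: nat
  proof
    assume "g \<otimes> x [^] n \<otimes> inv g = \<one>"
    then have "inv g \<otimes> (g \<otimes> x [^] n \<otimes> inv g) \<otimes> g = inv g \<otimes> \<one> \<otimes> g" by simp
    then show "x [^] n = \<one>" using assms by (simp add: m_assoc)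
  qed (use assms in simp)
  ultimately have "\<forall>n::nat. (g \<otimes> x \<otimes> inv g) [^] n = \<one> \<longleftrightarrow> ord x dvd n"
    using assms pow_eq_id by simp
  then show ?thesis using ord_unique[of "g \<otimes> x \<otimes> inv g" "ord x"] assms by simp
qed

lemma ord_conj': "x \<in> carrier G \<Longrightarrow> g \<in> carrier G \<Longrightarrow> ord (inv g \<otimes> x \<otimes> g) = ord x"
  using ord_conj[of x "inv g"] by simp

lemma primary_conj': "primary G l x \<Longrightarrow> g \<in> carrier G \<Longrightarrow> primary G l (inv g \<otimes> x \<otimes> g)"
  by (auto simp: primary_def ord_conj')

lemma centralizer_center_mult:
  "z \<in> center G \<Longrightarrow> x \<in> carrier G \<Longrightarrow> centralizer G (x \<otimes> z) = centralizer G x"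
proof -
  assume z: "z \<in> center G" and x: "x \<in> carrier G"
  have zc: "z \<in> carrier G" "\<And>g. g \<in> carrier G \<Longrightarrow> g \<otimes> z = z \<otimes> g" using z by (auto simp: center_def)
  have "g \<otimes> (x \<otimes> z) = (x \<otimes> z) \<otimes> g \<longleftrightarrow> g \<otimes> x = x \<otimes> g" if g: "g \<in> carrier G" for g
  proof -
    have "(x \<otimes> z) \<otimes> g = x \<otimes> g \<otimes> z" using g x zc(1) by (simp add: m_assoc zc(2)[OF g])
    moreover have "g \<otimes> (x \<otimes> z) = g \<otimes> x \<otimes> z" using g x zc(1) by (simp add: m_assoc)
    ultimately show ?thesis using g x zc(1) by simp
  qed
  then show ?thesis by (auto simp: centralizer_def)
qed

lemma class_size_conj:
  assumes x: "x \<in> carrier G" and g: "g \<in> carrier G"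
  shows "class_size G (g \<otimes> x \<otimes> inv g) = class_size G x"
proof -
  have "conj_class G (g \<otimes> x \<otimes> inv g) = conj_class G x"
  proof (intro equalityI subsetI)
    fix z assume "z \<in> conj_class G (g \<otimes> x \<otimes> inv g)"
    then obtain h where h: "h \<in> carrier G" "z = h \<otimes> (g \<otimes> x \<otimes> inv g) \<otimes> inv h" by (auto simp: conj_class_def)
    then have "z = (h \<otimes> g) \<otimes> x \<otimes> inv (h \<otimes> g)" using x g by (simp add: m_assoc inv_mult_group)
    then show "z \<in> conj_class G x" using h(1) g by (auto simp: conj_class_def)
  next
    fix z assume "z \<in> conj_class G x"
    then obtain h where h: "h \<in> carrier G" "z = h \<otimes> x \<otimes> inv h" by (auto simp: conj_class_def)
    then have "z = (h \<otimes> inv g) \<otimes> (g \<otimes> x \<otimes> inv g) \<otimes> inv (h \<otimes> inv g)"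
      using x g by (simp add: m_assoc inv_mult_group)
    then show "z \<in> conj_class G (g \<otimes> x \<otimes> inv g)" using h(1) g by (auto simp: conj_class_def)
  qed
  then show ?thesis by (simp add: class_size_def)
qed

lemma center_conj_iff:
  assumes "x \<in> carrier G" "g \<in> carrier G"
  shows "g \<otimes> x \<otimes> inv g \<in> center G \<longleftrightarrow> x \<in> center G"
  using assms by (simp add: center_iff_class_size class_size_conj)

lemma center_conj_iff':
  assumes "x \<in> carrier G" "g \<in> carrier G"
  shows "inv g \<otimes> x \<otimes> g \<in> center G \<longleftrightarrow> x \<in> center G"
  using center_conj_iff[of x "inv g"] assms by simp

text \<open>A Sylow \<open>l\<close>-subgroup consists of \<open>l\<close>-elements, so it is
  central and lies in \<open>C(x)\<close>; the index of \<open>C(x)\<close> is then prime to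
  \<open>l\<close>.\<close>

lemma not_dvd_class_size_if_primary_central:
  assumes l: "Factorial_Ring.prime l" and x: "x \<in> carrier G"
    and comm: "\<And>y. primary G l y \<Longrightarrow> y \<in> center G"
  shows "\<not> l dvd class_size G x"
proof
  assume dvd: "l dvd class_size G x"
  have G0: "order G \<noteq> 0" using order_gt_0_iff_finite finite_carrier by simp
  define a where "a = multiplicity l (order G)"
  obtain m where m: "order G = l ^ a * m" by (metis a_def multiplicity_dvd dvdE)
  obtain P where P: "subgroup P G" "card P = l ^ a"
    using sylow_thm[OF l is_group m finite_carrier] by blast
  have "P \<subseteq> centralizer G x"
  proof
    fix y assume y: "y \<in> P"
    then have yc: "y \<in> carrier G" using subgroup_mem[OF P(1)] by blast
    have "ord y dvd l ^ a"
      using card_subgroup_dvd[OF subgroup_generate_singleton[OF yc] P(1) generate_singleton_le[OF P(1) y]]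
        card_generate_singleton[OF yc] P(2) by simp
    then have "primary G l y" using l yc by (auto simp: primary_def divides_primepow_nat)
    then have "y \<in> center G" by (rule comm)
    then show "y \<in> centralizer G x" using x yc by (auto simp: center_def centralizer_def)
  qed
  then have "l ^ a dvd card (centralizer G x)"
    using card_subgroup_dvd[OF P(1) subgroup_centralizer[OF x]] P(2) by simp
  then have "l ^ a * l dvd order G"
    using dvd class_size_times_centralizer[OF x] by (metis mult.commute mult_dvd_mono)
  then have "l ^ Suc a dvd order G" by (simp add: mult.commute)
  then show False
    using G0 l by (metis a_def multiplicity_geI not_less_eq_eq not_prime_unit order_refl)
qed

text \<open>Bezout: \<open>gcd m n\<close> is an integer combination of the exponents. In the
  coprime case this recovers \<open>x\<close> itself.\<close>

lemma pow_mem_subgroup_if_coprime: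
  assumes H: "subgroup H G" and x: "x \<in> carrier G" and m: "x [^] (m::nat) \<in> H" and n: "x [^] (n::nat) \<in> H"
  shows "x [^] gcd m n \<in> H"
proof -
  obtain u v where uv: "u * int m + v * int n = gcd (int m) (int n)" using bezout_int by blast
  have "x [^] int (gcd m n) = x [^] (int m * u + int n * v)"
    using uv by (simp add: mult.commute)
  also have "\<dots> = (x [^] m) [^] u \<otimes> (x [^] n) [^] v"
    using x by (simp add: int_pow_mult int_pow_pow int_pow_int flip: int_pow_pow)
  finally have "x [^] gcd m n = (x [^] m) [^] u \<otimes> (x [^] n) [^] v" by (simp add: int_pow_int)
  then show ?thesis
    using subgroup_mult[OF H subgroup_int_pow_closed[OF H m] subgroup_int_pow_closed[OF H n]] by simp
qed

lemma centralizer_Int_pow: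
  assumes x: "x \<in> carrier G" and cop: "coprime m n"
  shows "centralizer G (x [^] (m::nat)) \<inter> centralizer G (x [^] (n::nat)) = centralizer G x"
proof (intro equalityI subsetI)
  fix g assume g: "g \<in> centralizer G (x [^] m) \<inter> centralizer G (x [^] n)"
  then have gc: "g \<in> carrier G" by (auto dest: centralizerD)
  have "x [^] m \<in> centralizer G g" "x [^] n \<in> centralizer G g"
    using g x by (auto intro: centralizer_sym)
  then have "x [^] gcd m n \<in> centralizer G g"
    using pow_mem_subgroup_if_coprime[OF subgroup_centralizer[OF gc] x] by blast
  then have "x \<in> centralizer G g" using cop x by (simp add: coprime_iff_gcd_eq_1)
  then show "g \<in> centralizer G x" using gc centralizer_sym by blast
next
  fix g assume "g \<in> centralizer G x"
  then show "g \<in> centralizer G (x [^] m) \<inter> centralizer G (x [^] n)"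
    using centralizer_le_pow[OF x] by blast
qed

text \<open>A subgroup containing \<open>x y\<close> contains
  \<open>(x y)^(ord y) = x^(ord y)\<close>, hence \<open>x\<close> by Bezout, since
  \<open>x^(ord x) = 1\<close>; here the subgroup is \<open>C(g)\<close>.\<close>

lemma centralizer_mult_coprime:
  assumes x: "x \<in> carrier G" and y: "y \<in> carrier G" and comm: "y \<in> centralizer G x"
    and cop: "coprime (ord x) (ord y)"
  shows "centralizer G (x \<otimes> y) = centralizer G x \<inter> centralizer G y"
proof (intro equalityI subsetI)
  fix g assume g: "g \<in> centralizer G x \<inter> centralizer G y"
  then have gc: "g \<in> carrier G" by (auto dest: centralizerD)
  then have "x \<in> centralizer G g" "y \<in> centralizer G g" using g x y centralizer_sym by blast+
  then have "x \<otimes> y \<in> centralizer G g" using centralizer_mult gc by blast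
  then show "g \<in> centralizer G (x \<otimes> y)" using gc centralizer_sym by blast
next
  fix g assume g: "g \<in> centralizer G (x \<otimes> y)"
  then have gc: "g \<in> carrier G" by (auto dest: centralizerD)
  have xy: "x \<otimes> y \<in> centralizer G g" using g gc x y centralizer_sym by (metis m_closed)
  have eq: "x \<otimes> y = y \<otimes> x" using comm by (auto simp: centralizer_def)
  have pw: "(x \<otimes> y) [^] n \<in> centralizer G g" for n :: nat using xy gc centralizer_pow by blast
  have "x [^] ord y = (x \<otimes> y) [^] ord y"
    using x y eq by (simp add: pow_mult_distrib)
  then have "x [^] ord y \<in> centralizer G g" using pw by simp
  moreover have "x [^] ord x \<in> centralizer G g"
    using x subgroup_one[OF subgroup_centralizer[OF gc]] by simp
  ultimately have xg: "x \<in> centralizer G g"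
    using pow_mem_subgroup_if_coprime[OF subgroup_centralizer[OF gc] x, of "ord x" "ord y"] cop x
    by (simp add: coprime_iff_gcd_eq_1)
  have "y = inv x \<otimes> (x \<otimes> y)" using x y by simp
  then have "y \<in> centralizer G g" using centralizer_mult[OF gc centralizer_inv[OF gc xg] xy] by simp
  then show "g \<in> centralizer G x \<inter> centralizer G y" using xg gc centralizer_sym by blast
qed

section \<open>Primary parts\<close>

text \<open>A generator of the \<open>l\<close>-part of the cyclic group generated by \<open>x\<close>, and one of its \<open>l'\<close>-part.\<close>

definition "part l x = x [^] (ord x div l ^ multiplicity l (ord x))"

definition "copart l x = x [^] (l ^ multiplicity l (ord x))"

lemma ord_pos: "x \<in> carrier G \<Longrightarrow> ord x > 0"
  using ord_ge_1[OF finite_carrier] by fastforce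

lemma part_closed [simp]: "x \<in> carrier G \<Longrightarrow> part l x \<in> carrier G"
  by (simp add: part_def)

lemma copart_closed [simp]: "x \<in> carrier G \<Longrightarrow> copart l x \<in> carrier G"
  by (simp add: copart_def)

lemma ord_part:
  assumes "x \<in> carrier G" shows "ord (part l x) = l ^ multiplicity l (ord x)"
proof -
  have "l ^ multiplicity l (ord x) dvd ord x" by (rule multiplicity_dvd)
  then obtain m where m: "ord x = l ^ multiplicity l (ord x) * m" by (auto elim: dvdE)
  then have "m > 0" "l ^ multiplicity l (ord x) > 0" using ord_pos[OF assms] by (metis gr0I mult_0_right less_not_refl, metis gr0I mult_0 less_not_refl)
  moreover have "ord x div l ^ multiplicity l (ord x) = m" using m \<open>l ^ multiplicity l (ord x) > 0\<close>
    by (metis nonzero_mult_div_cancel_left less_not_refl)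
  ultimately show ?thesis
    using m assms ord_pow[of x m] by (simp add: part_def) (metis dvd_triv_right nonzero_mult_div_cancel_right less_not_refl)
qed

lemma primary_part: "x \<in> carrier G \<Longrightarrow> primary G l (part l x)"
  using ord_part by (auto simp: primary_def)

lemma ord_copart:
  assumes "x \<in> carrier G" "Factorial_Ring.prime l" shows "ord (copart l x) = ord x div l ^ multiplicity l (ord x)"
proof -
  have "l ^ multiplicity l (ord x) \<noteq> 0" using assms(2) by (auto simp: prime_gt_0_nat)
  then show ?thesis unfolding copart_def using assms(1) by (intro ord_pow multiplicity_dvd)
qed

lemma not_dvd_ord_copart:
  assumes x: "x \<in> carrier G" and l: "Factorial_Ring.prime l" shows "\<not> l dvd ord (copart l x)"
proof -
  have "ord x \<noteq> 0" using ord_pos[OF x] by simp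
  then show ?thesis
    unfolding ord_copart[OF assms] using l multiplicity_decompose[of "ord x" l] not_prime_unit by blast
qed

lemma ord_copart_dvd: "x \<in> carrier G \<Longrightarrow> ord (copart l x) dvd ord x"
  by (simp add: copart_def pow_eq_id[symmetric] nat_pow_pow) (metis mult.commute nat_pow_one nat_pow_pow pow_ord_eq_1)

lemma ord_part_dvd: "x \<in> carrier G \<Longrightarrow> ord (part l x) dvd ord x"
  by (simp add: ord_part multiplicity_dvd)

lemma coprime_part_exponents:
  assumes x: "x \<in> carrier G" and l: "Factorial_Ring.prime l"
  shows "coprime (ord x div l ^ multiplicity l (ord x)) (l ^ multiplicity l (ord x))"
proof -
  have "\<not> l dvd ord x div l ^ multiplicity l (ord x)"
    using not_dvd_ord_copart[OF assms] ord_copart[OF assms] by simp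
  then have "coprime l (ord x div l ^ multiplicity l (ord x))" using l by (simp add: prime_imp_coprime)
  then show ?thesis by (simp add: coprime_commute coprime_power_left_iff)
qed

lemma centralizer_part_copart:
  assumes "x \<in> carrier G" "Factorial_Ring.prime l"
  shows "centralizer G (part l x) \<inter> centralizer G (copart l x) = centralizer G x"
  unfolding part_def copart_def using centralizer_Int_pow[OF assms(1) coprime_part_exponents[OF assms]] .

lemma centralizer_le_part: "x \<in> carrier G \<Longrightarrow> centralizer G x \<subseteq> centralizer G (part l x)"
  unfolding part_def by (rule centralizer_le_pow)

lemma centralizer_le_copart: "x \<in> carrier G \<Longrightarrow> centralizer G x \<subseteq> centralizer G (copart l x)"
  unfolding copart_def by (rule centralizer_le_pow)

lemma pow_mem_subgroup_Gcd:
  assumes H: "subgroup H G" and x: "x \<in> carrier G" and fin: "finite A" and mem: "\<And>m. m \<in> A \<Longrightarrow> x [^] (m::nat) \<in> H"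
  shows "x [^] Gcd A \<in> H"
  using fin mem
proof (induction A)
  case empty
  then show ?case using subgroup_one[OF H] by simp
next
  case (insert m A)
  then show ?case using pow_mem_subgroup_if_coprime[OF H x, of m "Gcd A"] by simp
qed

text \<open>The exponents cutting out the primary parts have no common prime factor, so
  \<open>x\<close> is a product of powers of its parts and lies in \<open>C(g)\<close> as soon as
  they do.\<close>

lemma centralizer_eq_Int_parts:
  assumes x: "x \<in> carrier G" and g: "g \<in> carrier G"
    and parts: "\<And>l. Factorial_Ring.prime l \<Longrightarrow> l dvd ord x \<Longrightarrow> g \<in> centralizer G (part l x)"
  shows "g \<in> centralizer G x"
proof -
  \<comment> \<open>\<open>ord x\<close> is included because for \<open>x = 1\<close> there are no
    prime divisors and \<open>Gcd {}\<close> would be \<open>0\<close>.\<close>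
  define A where "A = insert (ord x) ((\<lambda>l. ord x div l ^ multiplicity l (ord x)) ` {l. Factorial_Ring.prime l \<and> l dvd ord x})"
  have o: "ord x > 0" using x by (rule ord_pos)
  have fin: "finite A" unfolding A_def using o finite_prime_divisors[of "ord x"] by simp
  have "x [^] Gcd A \<in> centralizer G g"
  proof (rule pow_mem_subgroup_Gcd[OF subgroup_centralizer[OF g] x fin])
    fix m assume "m \<in> A"
    then consider "m = ord x" | l where "Factorial_Ring.prime l" "l dvd ord x" "m = ord x div l ^ multiplicity l (ord x)"
      by (auto simp: A_def)
    then show "x [^] m \<in> centralizer G g"
    proof cases
      case 1
      then show ?thesis using x subgroup_one[OF subgroup_centralizer[OF g]] by simp
    next
      case 2
      then have "part l x \<in> centralizer G g" using parts[of l] x part_closed centralizer_sym by blast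
      then show ?thesis using 2 by (simp add: part_def)
    qed
  qed
  moreover have "Gcd A = 1"
  proof (rule ccontr)
    assume "Gcd A \<noteq> 1"
    then obtain l where l: "Factorial_Ring.prime l" "l dvd Gcd A" using prime_factor_nat by blast
    have "l dvd ord x" using l(2) by (rule dvd_trans) (simp add: A_def)
    then have "ord x div l ^ multiplicity l (ord x) \<in> A" using l(1) by (simp add: A_def)
    then have "l dvd ord x div l ^ multiplicity l (ord x)" using l(2) by (meson Gcd_dvd dvd_trans)
    then show False using not_dvd_ord_copart[OF x l(1)] ord_copart[OF x l(1)] by simp
  qed
  ultimately have "x \<in> centralizer G g" using x by simp
  then show ?thesis using g centralizer_sym by blast
qed

lemma center_if_parts:
  assumes "x \<in> carrier G" "\<And>l. Factorial_Ring.prime l \<Longrightarrow> l dvd ord x \<Longrightarrow> part l x \<in> center G"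
  shows "x \<in> center G"
  using assms centralizer_eq_Int_parts[OF assms(1)] unfolding center_iff
  by (metis centralizer_subset subset_antisym subsetI)

section \<open>Pairs of elements in \<open>p\<close>-separable groups\<close>

lemma finite_group_subgroup: "subgroup H G \<Longrightarrow> finite_group (G\<lparr>carrier := H\<rparr>)"
  by (simp add: finite_group_def finite_group_axioms_def subgroup_imp_group subgroup_finite)

lemma ord_subgroup:
  assumes "subgroup H G" "h \<in> H" shows "group.ord (G\<lparr>carrier := H\<rparr>) h = ord h"
proof -
  interpret H: group "G\<lparr>carrier := H\<rparr>" using assms(1) by (rule subgroup_imp_group)
  have "h \<in> carrier G" using assms subgroup_mem by blast
  moreover have "h [^]\<^bsub>G\<lparr>carrier := H\<rparr>\<^esub> n = h [^] n" for n :: nat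
    by (simp add: nat_pow_consistent[symmetric])
  ultimately show ?thesis
    using H.ord_unique[of h "ord h"] assms(2) pow_eq_id by simp
qed

lemma eq_one_if_coprime_pows:
  assumes x: "x \<in> carrier G" and m: "x [^] (m::nat) = \<one>" and n: "x [^] (n::nat) = \<one>" and "coprime m n"
  shows "x = \<one>"
proof -
  have "ord x dvd m" "ord x dvd n" using x m n pow_eq_id by auto
  then have "ord x = 1" using \<open>coprime m n\<close> by (metis coprime_common_divisor_nat)
  then show ?thesis using x ord_eq_1 by simp
qed

text \<open>The transfer into a central subgroup \<open>Z\<close> of index \<open>m\<close> is the homomorphism \<open>z \<mapsto> z\<^sup>m\<close> on \<open>Z\<close>,
  and it kills all \<open>p\<close>-regular elements.\<close>

lemma central_p_subgroup_trivial:
  assumes p: "Factorial_Ring.prime p" and Z: "subgroup Z G" and central: "Z \<subseteq> center G"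
    and cardZ: "card Z = p ^ k" and ordG: "order G = card Z * m" and m: "\<not> p dvd m"
    and E: "E \<subseteq> carrier G" and gen: "generate G E = carrier G" and reg: "\<And>e. e \<in> E \<Longrightarrow> \<not> p dvd ord e"
  shows "Z = {\<one>}"
proof -
  let ?Z = "G\<lparr>carrier := Z\<rparr>"
  have Zc: "z \<otimes> g = g \<otimes> z" if "z \<in> Z" "g \<in> carrier G" for z g
    using central that by (auto simp: center_def)
  interpret Z: finite_group ?Z using Z by (rule finite_group_subgroup)
  interpret Z: comm_group ?Z
    using Zc subgroup_mem[OF Z] by (intro Z.group_comm_groupI) simp
  \<comment> \<open>\<open>t\<close> is a transversal of the right cosets, \<open>v y c\<close> is
    determined by \<open>t c y = v y c t(c y)\<close>, and \<open>V\<close> is the transfer.\<close>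
  define t where "t c = (SOME g. g \<in> c)" for c :: "'a set"
  define v where "v y c = t c \<otimes> y \<otimes> inv (t (c #> y))" for y c
  let ?R = "rcosets Z"
  define V where "V y = finprod ?Z (v y) ?R" for y
  have finR: "finite ?R" using finite_carrier by (simp add: RCOSETS_def)
  have cardR: "card ?R = m"
    using lagrange[OF Z] ordG card_subgroup_pos[OF Z] by (simp add: mult.commute)
  have t: "t c \<in> c" "t c \<in> carrier G" "c = Z #> t c" if c: "c \<in> ?R" for c
  proof -
    have "c \<noteq> {}" using subgroup.rcosets_non_empty[OF Z c] .
    then show tc: "t c \<in> c" unfolding t_def by (simp add: some_in_eq)
    obtain g where g: "g \<in> carrier G" "c = Z #> g" using c by (auto simp: RCOSETS_def)
    then show "t c \<in> carrier G" using tc r_coset_subset_G[OF subgroup.subset[OF Z] g(1)] by blast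
    show "c = Z #> t c" using repr_independence[OF _ g(1) Z] tc g(2) by simp
  qed
  have shift: "c #> y \<in> ?R" if c: "c \<in> ?R" and y: "y \<in> carrier G" for c y
  proof -
    obtain g where g: "g \<in> carrier G" "c = Z #> g" using c by (auto simp: RCOSETS_def)
    then have "c #> y = Z #> (g \<otimes> y)" using coset_mult_assoc[OF subgroup.subset[OF Z] g(1) y] by simp
    then show ?thesis using g y by (auto simp: RCOSETS_def)
  qed
  have cosub: "c \<subseteq> carrier G" if "c \<in> ?R" for c
    using that subgroup.rcosets_carrier[OF Z is_group] by blast
  have vZ: "v y c \<in> Z" if c: "c \<in> ?R" and y: "y \<in> carrier G" for y c
  proof -
    have "t c \<otimes> y \<in> c #> y" using t(1)[OF c] by (auto simp: r_coset_def)
    then have "t c \<otimes> y \<in> Z #> t (c #> y)" using t(3)[OF shift[OF c y]] by simp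
    then obtain z where z: "z \<in> Z" "t c \<otimes> y = z \<otimes> t (c #> y)" by (auto simp: r_coset_def)
    have "v y c = z \<otimes> t (c #> y) \<otimes> inv (t (c #> y))" by (simp add: v_def z(2))
    also have "\<dots> = z" using subgroup_mem[OF Z z(1)] t(2)[OF shift[OF c y]] by (simp add: m_assoc)
    finally show ?thesis using z(1) by simp
  qed
  \<comment> \<open>The factors telescope: \<open>v (y y') c = v y c v y' (c y)\<close>. Since
    \<open>c \<mapsto> c y\<close> permutes the cosets, the second factors multiply to
    \<open>V y'\<close>.\<close>
  have Vmult: "V (y \<otimes> y') = V y \<otimes> V y'" if y: "y \<in> carrier G" and y': "y' \<in> carrier G" for y y'
  proof -
    have "V (y \<otimes> y') = finprod ?Z (\<lambda>c. v y c \<otimes>\<^bsub>?Z\<^esub> v y' (c #> y)) ?R"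
      unfolding V_def
    proof (rule Z.finprod_cong')
      show "(\<lambda>c. v y c \<otimes>\<^bsub>?Z\<^esub> v y' (c #> y)) \<in> ?R \<rightarrow> carrier ?Z"
        using vZ y y' shift subgroup_mult[OF Z] by simp
      fix c assume c: "c \<in> ?R"
      have "(c #> y) #> y' = c #> (y \<otimes> y')" using coset_mult_assoc[OF cosub[OF c] y y'] .
      then have "v y c \<otimes> v y' (c #> y) = t c \<otimes> y \<otimes> (inv (t (c #> y)) \<otimes> (t (c #> y) \<otimes> (y' \<otimes> inv (t (c #> (y \<otimes> y'))))))"
        using t(2)[OF c] t(2)[OF shift[OF c y]] t(2)[OF shift[OF shift[OF c y] y']] y y'
        by (simp add: v_def m_assoc)
      also have "\<dots> = v (y \<otimes> y') c"
        using t(2)[OF c] t(2)[OF shift[OF c y]] t(2)[OF shift[OF c m_closed[OF y y']]] y y'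
        by (simp add: v_def m_assoc)
      finally show "v (y \<otimes> y') c = v y c \<otimes>\<^bsub>?Z\<^esub> v y' (c #> y)" by simp
    qed simp
    also have "\<dots> = V y \<otimes>\<^bsub>?Z\<^esub> finprod ?Z (\<lambda>c. v y' (c #> y)) ?R"
      unfolding V_def using vZ y y' shift by (subst Z.finprod_multf) auto
    also have "finprod ?Z (\<lambda>c. v y' (c #> y)) ?R = finprod ?Z (v y') ((\<lambda>c. c #> y) ` ?R)"
    proof (rule Z.finprod_reindex[symmetric])
      show "inj_on (\<lambda>c. c #> y) ?R"
      proof (rule inj_on_inverseI)
        fix c assume c: "c \<in> ?R"
        show "c #> y #> inv y = c" using coset_mult_assoc[OF cosub[OF c] y, of "inv y"] y cosub[OF c] by simp
      qed
      show "v y' \<in> (\<lambda>c. c #> y) ` ?R \<rightarrow> carrier ?Z" using vZ y y' shift by auto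
    qed
    also have "(\<lambda>c. c #> y) ` ?R = ?R"
    proof (intro equalityI subsetI)
      fix c assume c: "c \<in> ?R"
      have "c = (c #> inv y) #> y" using coset_mult_assoc[OF cosub[OF c], of "inv y" y] y cosub[OF c] by simp
      then show "c \<in> (\<lambda>c. c #> y) ` ?R" using shift[OF c, of "inv y"] y by blast
    qed (use shift y in auto)
    finally show ?thesis by (simp add: V_def)
  qed
  have VZ: "V y \<in> Z" if "y \<in> carrier G" for y
    using Z.finprod_closed[of "v y" ?R] vZ that unfolding V_def by auto
  interpret V: group_hom G ?Z V
    by unfold_locales (auto simp: hom_def VZ Vmult)
  have "E \<subseteq> kernel G ?Z V"
  proof
    fix e assume e: "e \<in> E"
    have ec: "e \<in> carrier G" using e E by blast
    have "V e [^]\<^bsub>?Z\<^esub> ord e = \<one>\<^bsub>?Z\<^esub>" using V.hom_nat_pow[OF ec, of "ord e"] ec V.hom_one by simp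
    moreover have "V e [^]\<^bsub>?Z\<^esub> p ^ k = \<one>\<^bsub>?Z\<^esub>"
      using Z.pow_order_eq_1[of "V e"] VZ[OF ec] cardZ by (simp add: order_def)
    moreover have "coprime (ord e) (p ^ k)"
      using reg[OF e] p by (metis coprime_commute coprime_power_right_iff prime_imp_coprime)
    ultimately have "V e = \<one>\<^bsub>?Z\<^esub>" using Z.eq_one_if_coprime_pows[of "V e"] VZ[OF ec] by simp
    then show "e \<in> kernel G ?Z V" using ec by (simp add: kernel_def)
  qed
  then have ker: "carrier G \<subseteq> kernel G ?Z V"
    using gen generate_subgroup_incl[OF _ V.subgroup_kernel] by blast
  \<comment> \<open>A central \<open>z\<close> in \<open>Z\<close> fixes every coset, so each
    transfer factor is \<open>z\<close> and \<open>V z = z^m\<close>. As \<open>V\<close> is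
    trivial, both \<open>m\<close> and \<open>p^k\<close> kill \<open>z\<close>, and they are
    coprime.\<close>
  have "z = \<one>" if z: "z \<in> Z" for z
  proof -
    have zc: "z \<in> carrier G" using subgroup_mem[OF Z z] .
    have "V z = finprod ?Z (\<lambda>c. z) ?R"
      unfolding V_def
    proof (rule Z.finprod_cong')
      show "(\<lambda>c. z) \<in> ?R \<rightarrow> carrier ?Z" using z by simp
      fix c assume c: "c \<in> ?R"
      have "c #> z = Z #> (t c \<otimes> z)"
        using coset_mult_assoc[OF subgroup.subset[OF Z] t(2)[OF c] zc] t(3)[OF c] by simp
      also have "\<dots> = Z #> (z \<otimes> t c)" using Zc[OF z t(2)[OF c]] by simp
      also have "\<dots> = (Z #> z) #> t c" using coset_mult_assoc[OF subgroup.subset[OF Z] zc t(2)[OF c]] by simp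
      also have "\<dots> = c" using coset_join2[OF zc Z z] t(3)[OF c] by simp
      finally have "v z c = t c \<otimes> z \<otimes> inv (t c)" by (simp add: v_def)
      also have "\<dots> = z \<otimes> t c \<otimes> inv (t c)" using Zc[OF z t(2)[OF c]] by simp
      also have "\<dots> = z" using zc t(2)[OF c] by (simp add: m_assoc)
      finally show "v z c = z" .
    qed simp
    also have "\<dots> = z [^]\<^bsub>?Z\<^esub> m" using Z.finprod_const[of z ?R] z cardR by simp
    finally have Vz: "V z = z [^]\<^bsub>?Z\<^esub> m" .
    have "V z = \<one>\<^bsub>?Z\<^esub>" using ker zc unfolding kernel_def by blast
    then have "z [^]\<^bsub>?Z\<^esub> m = \<one>\<^bsub>?Z\<^esub>" using Vz by simp
    moreover have "z [^]\<^bsub>?Z\<^esub> p ^ k = \<one>\<^bsub>?Z\<^esub>"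
      using Z.pow_order_eq_1[of z] z cardZ by (simp add: order_def)
    moreover have "coprime m (p ^ k)"
      using m p by (metis coprime_commute coprime_power_right_iff prime_imp_coprime)
    ultimately show ?thesis using Z.eq_one_if_coprime_pows[of z] z by simp
  qed
  then show ?thesis using subgroup_one[OF Z] by blast
qed

text \<open>Let \<open>M\<close> be the normal closure of \<open>x\<close>. The normal subgroup
  \<open>N\<close> centralizes \<open>x\<close>, hence its conjugates, hence \<open>M\<close>; so
  \<open>N \<inter> M\<close> is a central \<open>p\<close>-subgroup of \<open>M\<close> of index
  prime to \<open>p\<close>. As \<open>M\<close> is generated by \<open>p\<close>-regular elements,
  the transfer shows \<open>N \<inter> M = 1\<close>. Thus \<open>M\<close> is a
  \<open>p'\<close>-group, and \<open>G\<close> is the product of \<open>M\<close> and the cyclic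
  group of \<open>b\<close>.\<close>

lemma not_dvd_order_if_generated_by_two:
  assumes p: "Factorial_Ring.prime p" and N: "N \<lhd> G" "card N = p ^ k" and ordG: "order G = card N * m" "\<not> p dvd m"
    and bx: "b \<in> carrier G" "x \<in> carrier G" "\<not> p dvd ord b" "\<not> p dvd ord x"
    and gen: "generate G {b, x} = carrier G" and NC: "N \<subseteq> centralizer G x"
  shows "\<not> p dvd order G"
proof -
  define M where "M = generate G (conj_class G x)"
  let ?M = "G\<lparr>carrier := M\<rparr>"
  have cs: "conj_class G x \<subseteq> carrier G" using conj_class_subset[OF bx(2)] .
  have NG: "subgroup N G" using N(1) by (rule normal_imp_subgroup)
  have Mn: "M \<lhd> G" unfolding M_def
  proof (rule normal_generateI[OF cs])
    fix h g assume "h \<in> conj_class G x" and g: "g \<in> carrier G"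
    then obtain u where u: "u \<in> carrier G" "h = u \<otimes> x \<otimes> inv u" by (auto simp: conj_class_def)
    then have "g \<otimes> h \<otimes> inv g = (g \<otimes> u) \<otimes> x \<otimes> inv (g \<otimes> u)" using g bx by (simp add: m_assoc inv_mult_group)
    then show "g \<otimes> h \<otimes> inv g \<in> conj_class G x" using g u by (auto simp: conj_class_def)
  qed
  have M: "subgroup M G" using Mn by (rule normal_imp_subgroup)
  have NM: "N \<inter> M \<subseteq> center ?M"
  proof
    fix n assume n: "n \<in> N \<inter> M"
    have nc: "n \<in> carrier G" using subgroup_mem[OF M] n by blast
    have "conj_class G x \<subseteq> centralizer G n"
    proof
      fix h assume "h \<in> conj_class G x"
      then obtain u where u: "u \<in> carrier G" "h = u \<otimes> x \<otimes> inv u" by (auto simp: conj_class_def)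
      have "inv u \<otimes> n \<otimes> u \<in> N" using normal.inv_op_closed1[OF N(1) u(1)] n by blast
      then have "n \<in> centralizer G h" using centralizer_conj[OF bx(2) u(1) nc] NC u(2) by blast
      then show "h \<in> centralizer G n" using centralizer_sym u bx by (metis inv_closed m_closed)
    qed
    then have "M \<subseteq> centralizer G n"
      unfolding M_def using generate_subgroup_incl[OF _ subgroup_centralizer[OF nc]] by blast
    then show "n \<in> center ?M" using n by (auto simp: center_def centralizer_def)
  qed
  interpret M: finite_group ?M using M by (rule finite_group_subgroup)
  have I: "subgroup (N \<inter> M) G" using NG M subgroups_Inter_pair by blast
  have IM: "subgroup (N \<inter> M) ?M" using I M subgroup_incl by blast
  have "card (N \<inter> M) dvd p ^ k" using card_subgroup_dvd[OF I NG] N(2) by simp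
  then obtain j where j: "card (N \<inter> M) = p ^ j" using p by (auto simp: divides_primepow_nat)
  have NMs: "subgroup (N <#> M) G" using mult_norm_subgroup[OF N(1) M] .
  have "N \<subseteq> N <#> M"
  proof
    fix z assume "z \<in> N"
    moreover from this have "z = z \<otimes> \<one>" using subgroup_mem[OF NG] by simp
    ultimately show "z \<in> N <#> M" using subgroup_one[OF M] unfolding set_mult_def by blast
  qed
  \<comment> \<open>\<open>m'\<close> is the index of \<open>N\<close> in \<open>N M\<close>, which
    equals that of \<open>N \<inter> M\<close> in \<open>M\<close>; it divides
    \<open>m\<close>.\<close>
  then obtain m' where m': "card (N <#> M) = card N * m'"
    using card_subgroup_dvd[OF NG NMs] by (auto elim: dvdE)
  obtain u where u: "order G = card (N <#> M) * u"
    using card_subgroup_dvd[OF NMs subgroup_self subgroup.subset[OF NMs]] by (auto simp: order_def elim: dvdE)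
  have posN: "card N > 0" using NG by (rule card_subgroup_pos)
  have "card N * m = card N * (m' * u)" using ordG u m' by (simp only: mult_ac)
  then have "m = m' * u" using posN by simp
  then have m'p: "\<not> p dvd m'" using ordG(2) by auto
  have "card N * card M = card N * (card (N \<inter> M) * m')"
    using card_set_mult_times_Int[OF NG M] m' by (simp only: mult_ac)
  then have cardM: "card M = card (N \<inter> M) * m'" using posN by simp
  have csM: "conj_class G x \<subseteq> M" unfolding M_def by (auto intro: generate.incl)
  have "N \<inter> M = {\<one>\<^bsub>?M\<^esub>}"
  proof (rule M.central_p_subgroup_trivial[OF p IM NM j _ m'p, of "conj_class G x"])
    show "order ?M = card (N \<inter> M) * m'" using cardM by (simp add: order_def)
    show "conj_class G x \<subseteq> carrier ?M" using csM by simp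
    show "generate ?M (conj_class G x) = carrier ?M" using generate_consistent[OF csM M] M_def by simp
    fix e assume e: "e \<in> conj_class G x"
    then show "\<not> p dvd M.ord e"
      using ord_subgroup[OF M] csM bx ord_conj by (auto simp: conj_class_def subset_iff)
  qed
  then have pM: "\<not> p dvd card M" using cardM m'p by simp
  let ?B = "generate G {b}"
  have B: "subgroup ?B G" using bx by (intro subgroup_generate_singleton)
  have MB: "subgroup (M <#> ?B) G" using mult_norm_subgroup[OF Mn B] .
  have "x \<in> conj_class G x" using bx(2) by (auto simp: conj_class_def intro!: exI[of _ \<one>])
  then have xM: "x \<in> M" using csM by blast
  have "x \<otimes> \<one> \<in> M <#> ?B" "\<one> \<otimes> b \<in> M <#> ?B"
    using xM subgroup_one[OF B] subgroup_one[OF M] generate.incl[of b "{b}" G] unfolding set_mult_def by blast+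
  then have "{b, x} \<subseteq> M <#> ?B" using bx by simp
  then have "M <#> ?B = carrier G"
    using generate_subgroup_incl[OF _ MB] gen subgroup.subset[OF MB] by blast
  then have "order G dvd card M * ord b"
    using card_set_mult_times_Int[OF M B] card_generate_singleton[OF bx(1)] by (metis dvd_triv_left order_def)
  then show ?thesis using p pM bx(3) by (metis dvd_trans prime_dvd_mult_iff)
qed

lemma card_hom_fibre:
  assumes "group_hom G H f" "subgroup Y G"
  shows "card (f ` Y) * card (kernel G H f \<inter> Y) = card Y"
proof (rule card_image_times_fibre)
  interpret f: group_hom G H f by (rule assms(1))
  show "finite Y" using assms(2) by (rule subgroup_finite)
  fix a assume a: "a \<in> Y"
  have ac: "a \<in> carrier G" using subgroup_mem[OF assms(2) a] .
  have "bij_betw (\<lambda>c. a \<otimes> c) (kernel G H f \<inter> Y) {a' \<in> Y. f a' = f a}"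
    unfolding bij_betw_def
  proof (intro conjI equalityI subsetI)
    show "inj_on (\<lambda>c. a \<otimes> c) (kernel G H f \<inter> Y)"
      using ac by (intro inj_onI) (auto simp: kernel_def)
  next
    fix z assume "z \<in> (\<lambda>c. a \<otimes> c) ` (kernel G H f \<inter> Y)"
    then show "z \<in> {a' \<in> Y. f a' = f a}"
      using a ac subgroup_mult[OF assms(2)] by (auto simp: kernel_def)
  next
    fix z assume z: "z \<in> {a' \<in> Y. f a' = f a}"
    then have zc: "z \<in> carrier G" using subgroup_mem[OF assms(2)] by blast
    have "f (inv a \<otimes> z) = \<one>\<^bsub>H\<^esub>" using z zc ac f.hom_closed[OF ac] by simp
    then have "inv a \<otimes> z \<in> kernel G H f \<inter> Y"
      using z zc ac a subgroup_mult[OF assms(2)] subgroup_inv[OF assms(2)] by (simp add: kernel_def)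
    moreover have "z = a \<otimes> (inv a \<otimes> z)" using zc ac by simp
    ultimately show "z \<in> (\<lambda>c. a \<otimes> c) ` (kernel G H f \<inter> Y)" by blast
  qed
  then show "card {a' \<in> Y. f a' = f a} = card (kernel G H f \<inter> Y)"
    by (simp add: bij_betw_same_card)
qed

text \<open>One step along the normal series. If the kernel \<open>N\<close> is a
  \<open>p'\<close>-group, orders multiply. Otherwise \<open>N\<close> is a \<open>p\<close>-group;
  by coprimality \<open>p\<close> misses one of the two class sizes, so \<open>N\<close> centralizes
  that generator and \<open>not_dvd_order_if_generated_by_two\<close> applies inside
  \<open>Y\<close>.\<close>

lemma not_dvd_card_generate_if_image:
  assumes p: "Factorial_Ring.prime p" and f: "group_hom G H f"
    and ker: "(\<exists>k. card (kernel G H f) = p ^ k) \<or> \<not> p dvd card (kernel G H f)"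
    and bx: "b \<in> carrier G" "x \<in> carrier G" "\<not> p dvd ord b" "\<not> p dvd ord x"
    and cop: "coprime (class_size G b) (class_size G x)"
    and img: "\<not> p dvd card (generate H {f b, f x})"
  shows "\<not> p dvd card (generate G {b, x})"
proof -
  interpret f: group_hom G H f by (rule f)
  define Y where "Y = generate G {b, x}"
  let ?Y = "G\<lparr>carrier := Y\<rparr>"
  define N where "N = kernel G H f"
  have bxc: "{b, x} \<subseteq> carrier G" using bx by simp
  have Y: "subgroup Y G" unfolding Y_def using bxc by (rule generate_is_subgroup)
  have bxY: "b \<in> Y" "x \<in> Y" unfolding Y_def by (auto intro: generate.incl)
  have fY: "\<not> p dvd card (f ` Y)" using img f.generate_img[OF bxc] by (simp add: Y_def)
  have Nn: "N \<lhd> G" unfolding N_def by (rule f.normal_kernel)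
  have NG: "subgroup N G" using Nn by (rule normal_imp_subgroup)
  have I: "subgroup (N \<inter> Y) G" using NG Y subgroups_Inter_pair by blast
  have cardY: "card Y = card (N \<inter> Y) * card (f ` Y)"
    using card_hom_fibre[OF f Y] by (simp add: N_def mult.commute)
  have dvd: "card (N \<inter> Y) dvd card N" using card_subgroup_dvd[OF I NG] by simp
  show ?thesis
  proof (cases "p dvd card N")
    case False
    then show ?thesis using cardY dvd fY p unfolding Y_def[symmetric] by (metis dvd_trans prime_dvd_mult_iff)
  next
    case True
    then obtain k where k: "card N = p ^ k" using ker unfolding N_def by blast
    then obtain j where j: "card (N \<inter> Y) = p ^ j" using dvd p by (auto simp: divides_primepow_nat)
    interpret Y: finite_group ?Y using Y by (rule finite_group_subgroup)
    have NY: "N \<inter> Y \<lhd> ?Y" using normal_Int_subgroup[OF Y Nn] by (simp add: Int_commute)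
    have gen: "generate ?Y {b, x} = carrier ?Y" using generate_consistent[OF _ Y, of "{b, x}"] bxY by (simp add: Y_def)
    have copk: "coprime (card N) (class_size G y)" if "\<not> p dvd class_size G y" for y
      using that p k by (simp add: prime_imp_coprime)
    have "\<not> p dvd order ?Y"
    proof (cases "p dvd class_size G x")
      case False
      then have "N \<subseteq> centralizer G x" using normal_subset_centralizer_if_coprime[OF Nn bx(2)] copk by blast
      then have "N \<inter> Y \<subseteq> centralizer ?Y x" by (auto simp: centralizer_def)
      then show ?thesis
        using Y.not_dvd_order_if_generated_by_two[OF p NY j _ fY _ _ _ _ gen] cardY bxY bx ord_subgroup[OF Y]
        by (simp add: order_def)
    next
      case True
      then have "\<not> p dvd class_size G b" using cop p by (metis coprime_common_divisor_nat not_prime_1)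
      then have "N \<subseteq> centralizer G b" using normal_subset_centralizer_if_coprime[OF Nn bx(1)] copk by blast
      then have "N \<inter> Y \<subseteq> centralizer ?Y b" by (auto simp: centralizer_def)
      moreover have "generate ?Y {x, b} = carrier ?Y" using gen by (simp add: insert_commute)
      ultimately show ?thesis
        using Y.not_dvd_order_if_generated_by_two[OF p NY j _ fY, of x b] cardY bxY bx ord_subgroup[OF Y]
        by (simp add: order_def)
    qed
    then show ?thesis by (simp add: order_def Y_def)
  qed
qed

text \<open>The preimage \<open>U\<close> of the centralizer of \<open>f x\<close> contains
  \<open>C(x)\<close>, and its index in \<open>G\<close> is the class size of
  \<open>f x\<close>.\<close>

lemma class_size_hom_dvd:
  assumes f: "group_hom G H f" and H: "finite_group H" and surj: "f ` carrier G = carrier H" and x: "x \<in> carrier G"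
  shows "class_size H (f x) dvd class_size G x"
proof -
  interpret f: group_hom G H f by (rule f)
  interpret H: finite_group H by (rule H)
  define U where "U = {g \<in> carrier G. f g \<in> centralizer H (f x)}"
  have fx: "f x \<in> carrier H" using x by simp
  have U: "subgroup U G"
  proof (rule subgroupI)
    show "U \<noteq> {}" using x fx by (auto simp: U_def)
  qed (use fx in \<open>auto simp: U_def intro: H.centralizer_inv H.centralizer_mult\<close>)
  have fU: "f ` U = centralizer H (f x)"
  proof (intro equalityI subsetI)
    fix z assume z: "z \<in> centralizer H (f x)"
    then have "z \<in> f ` carrier G" using surj by (auto simp: centralizer_def)
    then show "z \<in> f ` U" using z by (auto simp: U_def)
  qed (auto simp: U_def)
  have "kernel G H f \<subseteq> U" using fx H.subgroup_one[OF H.subgroup_centralizer[OF fx]] by (auto simp: U_def kernel_def)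
  then have "kernel G H f \<inter> U = kernel G H f" by blast
  then have cardU: "card (centralizer H (f x)) * card (kernel G H f) = card U"
    using card_hom_fibre[OF f U] fU by simp
  have "kernel G H f \<inter> carrier G = kernel G H f" by (auto simp: kernel_def)
  then have ordG: "order H * card (kernel G H f) = order G"
    using card_hom_fibre[OF f subgroup_self] surj by (simp add: order_def)
  have "centralizer G x \<subseteq> U"
    using f.hom_mult x by (auto simp: U_def centralizer_def) (metis f.hom_mult)
  then obtain u where u: "card U = card (centralizer G x) * u"
    using card_subgroup_dvd[OF subgroup_centralizer[OF x] U] by (auto elim: dvdE)
  have "class_size G x * card (centralizer G x) = class_size H (f x) * (card (centralizer H (f x)) * card (kernel G H f))"
    using class_size_times_centralizer[OF x] H.class_size_times_centralizer[OF fx] ordG by (metis mult.assoc)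
  also have "\<dots> = (class_size H (f x) * u) * card (centralizer G x)" unfolding cardU u by (simp only: mult_ac)
  finally have "class_size G x = class_size H (f x) * u"
    using card_subgroup_pos[OF subgroup_centralizer[OF x]] by simp
  then show ?thesis by simp
qed

lemma finite_group_Mod: "N \<lhd> G \<Longrightarrow> finite_group (G Mod N)"
  using normal.factorgroup_is_group[of N G]
  by (simp add: finite_group_def finite_group_axioms_def carrier_FactGroup)

lemma ord_hom_dvd:
  assumes "group_hom G H f" "x \<in> carrier G" shows "group.ord H (f x) dvd ord x"
proof -
  interpret f: group_hom G H f by (rule assms(1))
  have "f x [^]\<^bsub>H\<^esub> ord x = \<one>\<^bsub>H\<^esub>" using f.hom_nat_pow[OF assms(2), of "ord x"] assms(2) f.hom_one by simp
  then show ?thesis using f.H.pow_eq_id[of "f x"] assms(2) by simp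
qed

lemma Mod_hom:
  assumes "N \<lhd> G" shows "group_hom G (G Mod N) (\<lambda>g. N #> g)" "(\<lambda>g. N #> g) ` carrier G = carrier (G Mod N)"
proof -
  interpret N: normal N G by (rule assms)
  show "group_hom G (G Mod N) (\<lambda>g. N #> g)"
    using N.r_coset_hom_Mod N.factorgroup_is_group
    by (simp add: group_hom_def group_hom_axioms_def)
  show "(\<lambda>g. N #> g) ` carrier G = carrier (G Mod N)" by (simp add: carrier_FactGroup)
qed

text \<open>The natural map from \<open>G/N\<close> to \<open>G/N'\<close>; its kernel is the factor
  \<open>N'/N\<close> in exactly the form used by \<open>p_separable\<close>.\<close>

lemma Mod_Mod_hom:
  assumes N: "N \<lhd> G" and N': "N' \<lhd> G" and sub: "N \<subseteq> N'"
  shows "\<And>g. g \<in> carrier G \<Longrightarrow> N' <#> (N #> g) = N' #> g"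
    "group_hom (G Mod N) (G Mod N') (\<lambda>c. N' <#> c)"
    "kernel (G Mod N) (G Mod N') (\<lambda>c. N' <#> c) = carrier (G\<lparr>carrier := N'\<rparr> Mod N)"
proof -
  have NG: "subgroup N G" "subgroup N' G" using N N' normal_imp_subgroup by blast+
  have "N' <#> N = N'"
  proof (intro equalityI subsetI)
    fix z assume "z \<in> N'"
    moreover from this have "z = z \<otimes> \<one>" using subgroup_mem[OF NG(2)] by simp
    ultimately show "z \<in> N' <#> N" using subgroup_one[OF NG(1)] unfolding set_mult_def by blast
  next
    fix z assume "z \<in> N' <#> N"
    then show "z \<in> N'" using sub subgroup_mult[OF NG(2)] unfolding set_mult_def by blast
  qed
  then show *: "N' <#> (N #> g) = N' #> g" if "g \<in> carrier G" for g
    using setmult_rcos_assoc[OF subgroup.subset[OF NG(2)] subgroup.subset[OF NG(1)] that] by simp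
  interpret N: normal N G by (rule N)
  interpret N': normal N' G by (rule N')
  show "group_hom (G Mod N) (G Mod N') (\<lambda>c. N' <#> c)"
    unfolding group_hom_def group_hom_axioms_def
  proof (intro conjI N.factorgroup_is_group N'.factorgroup_is_group homI)
    fix c assume "c \<in> carrier (G Mod N)"
    then show "N' <#> c \<in> carrier (G Mod N')" using * by (auto simp: carrier_FactGroup)
  next
    fix c d assume "c \<in> carrier (G Mod N)" "d \<in> carrier (G Mod N)"
    then obtain g h where gh: "g \<in> carrier G" "c = N #> g" "h \<in> carrier G" "d = N #> h"
      by (auto simp: carrier_FactGroup)
    then show "N' <#> (c \<otimes>\<^bsub>G Mod N\<^esub> d) = (N' <#> c) \<otimes>\<^bsub>G Mod N'\<^esub> (N' <#> d)"
      using * by (simp add: N.rcos_sum N'.rcos_sum)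
  qed
  show "kernel (G Mod N) (G Mod N') (\<lambda>c. N' <#> c) = carrier (G\<lparr>carrier := N'\<rparr> Mod N)"
  proof (intro equalityI subsetI)
    fix c assume "c \<in> kernel (G Mod N) (G Mod N') (\<lambda>c. N' <#> c)"
    then obtain g where g: "g \<in> carrier G" "c = N #> g" "N' #> g = N'"
      using * by (auto simp: kernel_def carrier_FactGroup)
    then have "g \<in> N'" using coset_join1[OF _ g(1) NG(2)] by simp
    then show "c \<in> carrier (G\<lparr>carrier := N'\<rparr> Mod N)" using g by (auto simp: carrier_FactGroup)
  next
    fix c assume "c \<in> carrier (G\<lparr>carrier := N'\<rparr> Mod N)"
    then obtain g where g: "g \<in> N'" "c = N #> g" by (auto simp: carrier_FactGroup)
    have gc: "g \<in> carrier G" using subgroup_mem[OF NG(2) g(1)] .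
    show "c \<in> kernel (G Mod N) (G Mod N') (\<lambda>c. N' <#> c)"
      using g gc * coset_join2[OF gc NG(2) g(1)] by (auto simp: kernel_def carrier_FactGroup)
  qed
qed

text \<open>Downward induction along the series: the images of \<open>b\<close> and \<open>x\<close>
  generate a \<open>p'\<close>-group in each quotient. It starts at the trivial quotient
  \<open>G/G\<close>; class sizes and element orders in quotients divide those in \<open>G\<close>,
  so the hypotheses persist.\<close>

theorem p_separable_generate_two:
  assumes p: "Factorial_Ring.prime p" and sep: "p_separable p G"
    and bx: "b \<in> carrier G" "x \<in> carrier G" "\<not> p dvd ord b" "\<not> p dvd ord x"
    and cop: "coprime (class_size G b) (class_size G x)"
  shows "\<not> p dvd card (generate G {b, x})"
proof -
  obtain Ns where ns: "normal_series G Ns"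
    and fac: "\<And>i. Suc i < length Ns \<Longrightarrow>
      p_group p (G\<lparr>carrier := Ns ! Suc i\<rparr> Mod Ns ! i) \<or> p'_group p (G\<lparr>carrier := Ns ! Suc i\<rparr> Mod Ns ! i)"
    using sep unfolding p_separable_def by blast
  have ne: "Ns \<noteq> []" and hd: "Ns ! 0 = {\<one>}" and last: "Ns ! (length Ns - 1) = carrier G"
    and nrm: "\<And>i. i < length Ns \<Longrightarrow> Ns ! i \<lhd> G" and sub: "\<And>i. Suc i < length Ns \<Longrightarrow> Ns ! i \<subseteq> Ns ! Suc i"
    using ns unfolding normal_series_def by (auto simp: hd_conv_nth last_conv_nth)
  define Q where "Q i \<longleftrightarrow> \<not> p dvd card (generate (G Mod Ns ! i) {Ns ! i #> b, Ns ! i #> x})" for i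
  have "Q i" if "i \<le> length Ns - 1" for i
    using that
  proof (induction rule: inc_induct)
    case base
    have top: "carrier G \<lhd> G" by (rule normal_self)
    interpret T: finite_group "G Mod carrier G" using top by (rule finite_group_Mod)
    have "carrier (G Mod carrier G) = {carrier G}"
      using coset_join2[OF _ subgroup_self] by (auto simp: carrier_FactGroup)
    moreover have "{carrier G #> b, carrier G #> x} \<subseteq> carrier (G Mod carrier G)"
      using bx by (auto simp: carrier_FactGroup)
    ultimately have "generate (G Mod carrier G) {carrier G #> b, carrier G #> x} = {carrier G}"
      using T.generate_incl T.subgroup_one[OF T.generate_is_subgroup] by (metis empty_iff subset_singletonD)
    then show ?case using prime_gt_1_nat[OF p] last by (simp add: Q_def)
  next
    case (step i)
    let ?N = "Ns ! i" and ?N' = "Ns ! Suc i"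
    have lt: "Suc i < length Ns" "i < length Ns" using step(2) by linarith+
    interpret N: finite_group "G Mod ?N" using nrm[OF lt(2)] by (rule finite_group_Mod)
    note m = Mod_Mod_hom[OF nrm[OF lt(2)] nrm[OF lt(1)] sub[OF lt(1)]]
    note h = Mod_hom[OF nrm[OF lt(2)]]
    have "\<not> p dvd card (generate (G Mod ?N) {?N #> b, ?N #> x})"
    proof (rule N.not_dvd_card_generate_if_image[OF p m(2)])
      show "(\<exists>k. card (kernel (G Mod ?N) (G Mod ?N') (\<lambda>c. ?N' <#> c)) = p ^ k) \<or>
          \<not> p dvd card (kernel (G Mod ?N) (G Mod ?N') (\<lambda>c. ?N' <#> c))"
        using fac[OF lt(1)] unfolding m(3) p_group_def p'_group_def order_def .
      show "?N #> b \<in> carrier (G Mod ?N)" "?N #> x \<in> carrier (G Mod ?N)"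
        using bx by (auto simp: carrier_FactGroup)
      show "\<not> p dvd N.ord (?N #> b)" "\<not> p dvd N.ord (?N #> x)"
        using bx ord_hom_dvd[OF h(1)] by (meson dvd_trans)+
      show "coprime (class_size (G Mod ?N) (?N #> b)) (class_size (G Mod ?N) (?N #> x))"
        using cop class_size_hom_dvd[OF h(1) N.finite_group_axioms h(2)] bx by (meson coprime_divisors)
      show "\<not> p dvd card (generate (G Mod ?N') {?N' <#> (?N #> b), ?N' <#> (?N #> x)})"
        using step(3) m(1) bx by (simp add: Q_def)
    qed
    then show ?case by (simp add: Q_def)
  qed
  then have "Q 0" by simp
  \<comment> \<open>\<open>Q 0\<close> concerns the quotient by the trivial subgroup; one more
    application to the projection, whose kernel has order one, returns to \<open>G\<close>.\<close>
  have "{\<one>} \<lhd> G" using nrm[of 0] ne hd by simp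
  note h = Mod_hom[OF this]
  have "kernel G (G Mod {\<one>}) (\<lambda>g. {\<one>} #> g) = {\<one>}"
    by (auto simp: kernel_def r_coset_def)
  then have "\<not> p dvd card (kernel G (G Mod {\<one>}) (\<lambda>g. {\<one>} #> g))" using prime_gt_1_nat[OF p] by simp
  then show ?thesis
    using not_dvd_card_generate_if_image[OF p h(1) _ bx cop] \<open>Q 0\<close> hd by (simp add: Q_def)
qed

section \<open>Translations of a conjugacy class\<close>

text \<open>Inclusion of the translate suffices: for \<open>B\<close> inside the finite carrier,
  injectivity of translation turns it into equality.\<close>

definition "right_stabilizer B = {k \<in> carrier G. \<forall>e \<in> B. e \<otimes> k \<in> B}"

lemma right_stabilizer_bij:
  assumes B: "B \<subseteq> carrier G" and k: "k \<in> right_stabilizer B"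
  shows "(\<lambda>e. e \<otimes> k) ` B = B"
proof (rule card_subset_eq)
  show "finite B" using B by (rule finite_subset_carrier)
  show "(\<lambda>e. e \<otimes> k) ` B \<subseteq> B" using k by (auto simp: right_stabilizer_def)
  show "card ((\<lambda>e. e \<otimes> k) ` B) = card B"
    using k B by (intro card_image inj_onI) (auto simp: right_stabilizer_def subset_iff)
qed

lemma right_stabilizerI:
  assumes B: "B \<subseteq> carrier G" and k: "k \<in> carrier G" and eq: "(\<lambda>e. e \<otimes> k) ` B = B"
  shows "k \<in> right_stabilizer B"
  unfolding right_stabilizer_def using k eq by blast

lemma subgroup_right_stabilizer:
  assumes B: "B \<subseteq> carrier G" shows "subgroup (right_stabilizer B) G"
proof (rule subgroupI)
  show "right_stabilizer B \<subseteq> carrier G" by (auto simp: right_stabilizer_def)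
  have "\<one> \<in> right_stabilizer B" using B by (auto simp: right_stabilizer_def subset_iff)
  then show "right_stabilizer B \<noteq> {}" by blast
next
  fix k assume k: "k \<in> right_stabilizer B"
  then have kc: "k \<in> carrier G" by (simp add: right_stabilizer_def)
  have "e \<otimes> inv k \<in> B" if e: "e \<in> B" for e
  proof -
    obtain e' where e': "e' \<in> B" "e = e' \<otimes> k" using e right_stabilizer_bij[OF B k] by blast
    have "e' \<in> carrier G" using e' B by blast
    then have "e \<otimes> inv k = e'" using e'(2) kc by (simp add: m_assoc)
    then show ?thesis using e' by simp
  qed
  then show "inv k \<in> right_stabilizer B" using kc by (simp add: right_stabilizer_def)
next
  fix k l assume k: "k \<in> right_stabilizer B" and l: "l \<in> right_stabilizer B"
  then have c: "k \<in> carrier G" "l \<in> carrier G" by (simp_all add: right_stabilizer_def)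
  have "e \<otimes> (k \<otimes> l) \<in> B" if e: "e \<in> B" for e
  proof -
    have "e \<in> carrier G" using e B by blast
    moreover have "(e \<otimes> k) \<otimes> l \<in> B" using e k l by (simp add: right_stabilizer_def)
    ultimately show ?thesis using c by (simp add: m_assoc)
  qed
  then show "k \<otimes> l \<in> right_stabilizer B" using c by (simp add: right_stabilizer_def)
qed

text \<open>\<open>B\<close> is a union of left cosets of its right stabilizer, and these are the
  fibres of \<open>e \<mapsto> e S\<close>.\<close>

lemma card_right_stabilizer_dvd:
  assumes B: "B \<subseteq> carrier G" shows "card (right_stabilizer B) dvd card B"
proof -
  let ?S = "right_stabilizer B"
  note S = subgroup_right_stabilizer[OF B]
  have "card ((\<lambda>e. e <# ?S) ` B) * card ?S = card B"
  proof (rule card_image_times_fibre)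
    show "finite B" using B by (rule finite_subset_carrier)
    fix a assume a: "a \<in> B"
    then have ac: "a \<in> carrier G" using B by blast
    have "{a' \<in> B. a' <# ?S = a <# ?S} = (\<lambda>k. a \<otimes> k) ` ?S"
    proof (intro equalityI subsetI)
      fix z assume "z \<in> {a' \<in> B. a' <# ?S = a <# ?S}"
      then have z: "z \<in> B" "z <# ?S = a <# ?S" by auto
      then have "z \<otimes> \<one> \<in> a <# ?S" using subgroup_one[OF S] unfolding l_coset_def by blast
      then have "z \<in> a <# ?S" using z(1) B by (simp add: subset_iff)
      then show "z \<in> (\<lambda>k. a \<otimes> k) ` ?S" by (auto simp: l_coset_def)
    next
      fix z assume "z \<in> (\<lambda>k. a \<otimes> k) ` ?S"
      then obtain k where k: "k \<in> ?S" "z = a \<otimes> k" by blast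
      have "z \<in> B" using k a by (simp add: right_stabilizer_def)
      moreover have "z \<in> a <# ?S" using k by (auto simp: l_coset_def)
      then have "a <# ?S = z <# ?S" using l_repr_independence[OF _ ac S] by simp
      ultimately show "z \<in> {a' \<in> B. a' <# ?S = a <# ?S}" by simp
    qed
    moreover have "card ((\<lambda>k. a \<otimes> k) ` ?S) = card ?S"
      using ac subgroup_mem[OF S] by (intro card_image inj_onI) auto
    ultimately show "card {a' \<in> B. a' <# ?S = a <# ?S} = card ?S" by simp
  qed
  then show ?thesis by (metis dvd_triv_right)
qed

text \<open>\<open>e (g k inv g)\<close> is the conjugate by \<open>g\<close> of
  \<open>(inv g e g) k\<close>, and the class is closed under conjugation.\<close>

lemma normal_right_stabilizer:
  assumes b: "b \<in> carrier G" shows "right_stabilizer (conj_class G b) \<lhd> G"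
proof -
  let ?B = "conj_class G b"
  have B: "?B \<subseteq> carrier G" using conj_class_subset[OF b] .
  have conjB: "g \<otimes> e \<otimes> inv g \<in> ?B" if e: "e \<in> ?B" and g: "g \<in> carrier G" for e g
  proof -
    obtain u where u: "u \<in> carrier G" "e = u \<otimes> b \<otimes> inv u" using e by (auto simp: conj_class_def)
    then have "g \<otimes> e \<otimes> inv g = (g \<otimes> u) \<otimes> b \<otimes> inv (g \<otimes> u)" using g b by (simp add: m_assoc inv_mult_group)
    then show ?thesis using g u by (auto simp: conj_class_def)
  qed
  show ?thesis
  proof (rule normal_invI[OF subgroup_right_stabilizer[OF B]])
    fix g k assume g: "g \<in> carrier G" and k: "k \<in> right_stabilizer ?B"
    then have kc: "k \<in> carrier G" by (simp add: right_stabilizer_def)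
    have "e \<otimes> (g \<otimes> k \<otimes> inv g) \<in> ?B" if e: "e \<in> ?B" for e
    proof -
      have ec: "e \<in> carrier G" using e B by blast
      have "inv g \<otimes> e \<otimes> g \<in> ?B" using conjB[OF e, of "inv g"] g by simp
      then have "(inv g \<otimes> e \<otimes> g) \<otimes> k \<in> ?B" using k by (simp add: right_stabilizer_def)
      from conjB[OF this g] show ?thesis using ec g kc by (simp add: m_assoc)
    qed
    then show "g \<otimes> k \<otimes> inv g \<in> right_stabilizer ?B" using g kc by (simp add: right_stabilizer_def)
  qed
qed

text \<open>Since \<open>G = C(b) C(x)\<close>, all products of a conjugate of \<open>b\<close> with a conjugate of \<open>x\<close> are conjugate to \<open>b x\<close>.\<close>

lemma class_translate_if_coprime:
  assumes b: "b \<in> carrier G" and x: "x \<in> carrier G" and g: "g \<in> carrier G"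
    and cop: "coprime (class_size G b) (class_size G x)"
    and le: "class_size G (b \<otimes> x) \<le> class_size G b"
  shows "(\<lambda>e. e \<otimes> (g \<otimes> x \<otimes> inv g)) ` conj_class G b = conj_class G (b \<otimes> x)"
proof (rule card_seteq)
  show "finite (conj_class G (b \<otimes> x))" using finite_subset_carrier[OF conj_class_subset[OF m_closed[OF b x]]] .
  show "(\<lambda>e. e \<otimes> (g \<otimes> x \<otimes> inv g)) ` conj_class G b \<subseteq> conj_class G (b \<otimes> x)"
  proof
    fix z assume "z \<in> (\<lambda>e. e \<otimes> (g \<otimes> x \<otimes> inv g)) ` conj_class G b"
    then obtain u where u: "u \<in> carrier G" "z = (u \<otimes> b \<otimes> inv u) \<otimes> (g \<otimes> x \<otimes> inv g)"
      by (auto simp: conj_class_def)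
    obtain h k where hk: "h \<in> centralizer G b" "k \<in> centralizer G x" "inv u \<otimes> g = h \<otimes> k"
      using factorize_coprime_class_sizes[OF b x cop, of "inv u \<otimes> g"] u g by auto
    have c: "h \<in> carrier G" "k \<in> carrier G" using hk by (auto dest: centralizerD)
    have hb: "h \<otimes> b = b \<otimes> h" and kx: "k \<otimes> x = x \<otimes> k" using hk by (auto dest: centralizerD)
    have geq: "g = u \<otimes> h \<otimes> k"
      using hk(3) u(1) g c by (simp add: m_assoc flip: hk(3))
    have "g \<otimes> x \<otimes> inv g = u \<otimes> h \<otimes> (k \<otimes> x) \<otimes> inv k \<otimes> inv h \<otimes> inv u"
      unfolding geq using u c x by (simp add: m_assoc inv_mult_group)
    also have "\<dots> = u \<otimes> h \<otimes> x \<otimes> inv h \<otimes> inv u"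
      unfolding kx using u c x by (simp add: m_assoc)
    finally have "z = u \<otimes> (b \<otimes> h) \<otimes> x \<otimes> inv h \<otimes> inv u"
      using u c x b by (simp add: m_assoc)
    also have "\<dots> = (u \<otimes> h) \<otimes> (b \<otimes> x) \<otimes> inv (u \<otimes> h)"
      unfolding hb[symmetric] using u c x b by (simp add: m_assoc inv_mult_group)
    finally show "z \<in> conj_class G (b \<otimes> x)" using u c by (auto simp: conj_class_def)
  qed
  \<comment> \<open>Translation is injective, so the image is as large as the class of
    \<open>b\<close>; by \<open>le\<close> the inclusion just shown is an equality.\<close>
  have "card ((\<lambda>e. e \<otimes> (g \<otimes> x \<otimes> inv g)) ` conj_class G b) = card (conj_class G b)"
    using conj_class_subset[OF b] g x by (intro card_image inj_onI) (auto simp: subset_iff)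
  then show "card (conj_class G (b \<otimes> x)) \<le> card ((\<lambda>e. e \<otimes> (g \<otimes> x \<otimes> inv g)) ` conj_class G b)"
    using le by (simp add: class_size_def)
qed

text \<open>Translating the class of \<open>b\<close> by \<open>x\<close> or by a conjugate of
  \<open>x\<close> gives the same set, the class of \<open>b x\<close>; the translation by
  \<open>x\<close> is then undone.\<close>

lemma commutator_in_right_stabilizer:
  assumes b: "b \<in> carrier G" and x: "x \<in> carrier G" and g: "g \<in> carrier G"
    and cop: "coprime (class_size G b) (class_size G x)"
    and le: "class_size G (b \<otimes> x) \<le> class_size G b"
  shows "(g \<otimes> x \<otimes> inv g) \<otimes> inv x \<in> right_stabilizer (conj_class G b)"
proof (rule right_stabilizerI)
  let ?B = "conj_class G b"
  show B: "?B \<subseteq> carrier G" using conj_class_subset[OF b] .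
  show "g \<otimes> x \<otimes> inv g \<otimes> inv x \<in> carrier G" using g x by simp
  have "(\<lambda>e. e \<otimes> (g \<otimes> x \<otimes> inv g)) ` ?B = (\<lambda>e. e \<otimes> (\<one> \<otimes> x \<otimes> inv \<one>)) ` ?B"
    
    by (simp only: class_translate_if_coprime[OF b x g cop le] class_translate_if_coprime[OF b x one_closed cop le])
  then have eq: "(\<lambda>e. e \<otimes> (g \<otimes> x \<otimes> inv g)) ` ?B = (\<lambda>e. e \<otimes> x) ` ?B" using x by simp
  have "(\<lambda>e. e \<otimes> (g \<otimes> x \<otimes> inv g \<otimes> inv x)) ` ?B = (\<lambda>e. e \<otimes> inv x) ` (\<lambda>e. e \<otimes> (g \<otimes> x \<otimes> inv g)) ` ?B"
    unfolding image_image using B g x by (intro image_cong refl) (simp add: subset_iff m_assoc)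
  also have "\<dots> = (\<lambda>e. e \<otimes> inv x) ` (\<lambda>e. e \<otimes> x) ` ?B" unfolding eq ..
  also have "\<dots> = (\<lambda>e. e) ` ?B"
    unfolding image_image using B x by (intro image_cong refl) (simp add: subset_iff m_assoc)
  finally show "(\<lambda>e. e \<otimes> (g \<otimes> x \<otimes> inv g \<otimes> inv x)) ` ?B = ?B" by simp
qed

section \<open>Sylow subgroups and coverings by centralizers\<close>

lemma not_dvd_class_size_if_sylow_le:
  assumes P: "subgroup P G" "card P = l ^ a" and ord: "order G = l ^ a * m" "\<not> l dvd m"
    and x: "x \<in> carrier G" and sub: "P \<subseteq> centralizer G x"
  shows "\<not> l dvd class_size G x"
proof
  assume dvd: "l dvd class_size G x"
  have pos: "l ^ a > 0" using P card_subgroup_pos by metis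
  have "l ^ a dvd card (centralizer G x)"
    using card_subgroup_dvd[OF P(1) subgroup_centralizer[OF x] sub] P(2) by simp
  then have "l * l ^ a dvd l ^ a * m"
    using dvd class_size_times_centralizer[OF x] ord(1) by (metis mult_dvd_mono)
  then have "l ^ a * l dvd l ^ a * m" by (simp only: mult.commute)
  then have "l dvd m" using pos by (simp only: nat_mult_dvd_cancel1)
  then show False using ord(2) by simp
qed

lemma primary_if_mem_q_subgroup:
  assumes q: "Factorial_Ring.prime q" and P: "subgroup P G" "card P = q ^ a" and x: "x \<in> P"
  shows "primary G q x"
proof -
  have xc: "x \<in> carrier G" using subgroup_mem[OF P(1) x] .
  have "ord x dvd q ^ a"
    using card_subgroup_dvd[OF subgroup_generate_singleton[OF xc] P(1) generate_singleton_le[OF P(1) x]]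
      card_generate_singleton[OF xc] P(2) by simp
  then show ?thesis using q xc by (auto simp: primary_def divides_primepow_nat)
qed

text \<open>Count the pairs \<open>(x, w)\<close> with \<open>x\<close> in a Sylow subgroup \<open>Q\<close>, \<open>w\<close> conjugate to \<open>y\<close> and \<open>x w = w x\<close>.
  As \<open>Q\<close> is transitive on the class of \<open>y\<close>, there are \<open>|Q|\<close> of them, whereas every
  \<open>x\<close> not commuting with \<open>c\<close> contributes a positive multiple of \<open>q\<close>.\<close>

lemma not_dvd_class_size_if_covered:
  assumes q: "Factorial_Ring.prime q" and c: "c \<in> carrier G" and y: "y \<in> carrier G"
    and cy: "class_size G y = q ^ f" "class_size G y \<noteq> 1"
    and cover: "\<And>x. primary G q x \<Longrightarrow> x \<in> centralizer G c \<or> (\<exists>g \<in> carrier G. x \<in> centralizer G (g \<otimes> y \<otimes> inv g))"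
  shows "\<not> q dvd class_size G c"
proof -
  have G0: "order G \<noteq> 0" using order_gt_0_iff_finite finite_carrier by simp
  define a where "a = multiplicity q (order G)"
  obtain m where m: "order G = q ^ a * m" by (metis a_def multiplicity_dvd dvdE)
  have mq: "\<not> q dvd m"
  proof
    assume "q dvd m"
    then have "q ^ Suc a dvd order G" using m by (auto elim!: dvdE)
    then show False using G0 q by (metis a_def multiplicity_geI not_less_eq_eq not_prime_unit order_refl)
  qed
  obtain Q where Q: "subgroup Q G" "card Q = q ^ a"
    using sylow_thm[OF q is_group m finite_carrier] by blast
  define W where "W = Q \<inter> centralizer G c"
  have W: "subgroup W G" unfolding W_def using Q(1) subgroup_centralizer[OF c] subgroups_Inter_pair by blast
  have finQ: "finite Q" using Q(1) by (rule subgroup_finite)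
  define Om where "Om = conj_class G y"
  have Omc: "Om \<subseteq> carrier G" unfolding Om_def using y by (rule conj_class_subset)
  have finOm: "finite Om" using Omc by (rule finite_subset_carrier)
  define n where "n = q ^ f"
  have cardOm: "card Om = n" using cy(1) by (simp add: Om_def class_size_def n_def)
  have csOm: "class_size G w = n" if "w \<in> Om" for w
    using that y cy(1) by (auto simp: n_def Om_def conj_class_def class_size_conj)
  have qf: "n > 0" using q by (simp add: n_def prime_gt_0_nat)
  have "f \<noteq> 0" using cy by (intro notI) simp
  then have "q dvd card Om" by (simp add: cardOm n_def)
  define fixed where "fixed x = card {w \<in> Om. w \<in> centralizer G x}" for x
  have count: "(\<Sum>x\<in>H. fixed x) = (\<Sum>w\<in>Om. card (H \<inter> centralizer G w))" if H: "H \<subseteq> carrier G" for H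
  proof -
    have finH: "finite H" using H by (rule finite_subset_carrier)
    have "(\<Sum>x\<in>H. fixed x) = (\<Sum>x\<in>H. \<Sum>w\<in>Om. if w \<in> centralizer G x then 1 else 0)"
      unfolding fixed_def using finOm by (simp add: sum.If_cases Int_def)
    also have "\<dots> = (\<Sum>w\<in>Om. \<Sum>x\<in>H. if w \<in> centralizer G x then 1 else 0)" by (rule sum.swap)
    also have "\<dots> = (\<Sum>w\<in>Om. card (H \<inter> centralizer G w))"
    proof (rule sum.cong[OF refl])
      fix w assume "w \<in> Om"
      then have "w \<in> carrier G" using Omc by blast
      then have "{x \<in> H. w \<in> centralizer G x} = H \<inter> centralizer G w"
        using H centralizer_sym by blast
      then show "(\<Sum>x\<in>H. if w \<in> centralizer G x then 1 else 0) = card (H \<inter> centralizer G w)"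
        using finH by (simp add: sum.If_cases Int_def)
    qed
    finally show ?thesis .
  qed
  \<comment> \<open>\<open>C(w)\<close> has index \<open>n = q^f\<close> and \<open>Q\<close> has
    index \<open>m\<close> prime to \<open>q\<close>, so \<open>G = Q C(w)\<close>, that is,
    \<open>Q\<close> is transitive on the class.\<close>
  have "card (Q \<inter> centralizer G w) * n = card Q" if w: "w \<in> Om" for w
  proof -
    have wc: "w \<in> carrier G" using w Omc by blast
    note C = subgroup_centralizer[OF wc]
    have ordC: "n * card (centralizer G w) = order G"
      using class_size_times_centralizer[OF wc] csOm[OF w] by simp
    have "Q <#> centralizer G w = carrier G"
    proof (rule set_mult_eq_carrier_if_coprime_index[OF Q(1) C _ ordC])
      show "m * card Q = order G" using m Q(2) by (simp add: mult.commute)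
      show "coprime m n" unfolding n_def using mq q by (metis coprime_commute coprime_power_right_iff prime_imp_coprime)
    qed
    then have "order G * card (Q \<inter> centralizer G w) = card Q * card (centralizer G w)"
      using card_set_mult_times_Int[OF Q(1) C] by (simp add: order_def)
    then have "card (centralizer G w) * (card (Q \<inter> centralizer G w) * n) = card (centralizer G w) * card Q"
      using ordC by (metis mult.assoc mult.commute)
    then show ?thesis using card_subgroup_pos[OF C] by simp
  qed
  then have "(\<Sum>w\<in>Om. card (Q \<inter> centralizer G w) * n) = card Om * card Q" by simp
  then have "(\<Sum>w\<in>Om. card (Q \<inter> centralizer G w)) * n = n * card Q"
    using cardOm by (simp add: sum_distrib_right)
  then have sumQ: "(\<Sum>x\<in>Q. fixed x) = card Q"
    using count[OF subgroup.subset[OF Q(1)]] qf by simp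
  \<comment> \<open>The orbit of \<open>w\<close> under \<open>W\<close> has at most
    \<open>n\<close> elements; summing over the class, the average of \<open>fixed\<close> on
    \<open>W\<close> is at least one.\<close>
  have "card W \<le> card (W \<inter> centralizer G w) * n" if w: "w \<in> Om" for w
  proof -
    have wc: "w \<in> carrier G" using w Omc by blast
    have "(\<lambda>h. h \<otimes> w \<otimes> inv h) ` W \<subseteq> conj_class G w"
      using subgroup_mem[OF W] by (auto simp: conj_class_def)
    then have "card ((\<lambda>h. h \<otimes> w \<otimes> inv h) ` W) \<le> class_size G w"
      unfolding class_size_def using conj_class_subset[OF wc] finite_subset_carrier by (intro card_mono)
    then have "card ((\<lambda>h. h \<otimes> w \<otimes> inv h) ` W) \<le> n" using csOm[OF w] by simp
    from mult_le_mono1[OF this, of "card (W \<inter> centralizer G w)"] show ?thesis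
      unfolding card_orbit_times_stabilizer[OF W wc] by (simp only: mult.commute)
  qed
  then have "(\<Sum>w\<in>Om. card W) \<le> (\<Sum>w\<in>Om. card (W \<inter> centralizer G w) * n)" by (rule sum_mono)
  then have "card Om * card W \<le> (\<Sum>w\<in>Om. card (W \<inter> centralizer G w)) * n"
    by (simp only: sum_constant sum_distrib_right of_nat_id)
  then have sumW: "card W \<le> (\<Sum>x\<in>W. fixed x)" using count[OF subgroup.subset[OF W]] qf cardOm by (simp add: mult.commute)
  have two: "2 \<le> fixed x" if x: "x \<in> Q - W" for x
  proof -
    have xc: "x \<in> carrier G" using x subgroup_mem[OF Q(1)] by blast
    have pr: "primary G q x" using primary_if_mem_q_subgroup[OF q Q] x by blast
    then obtain g where g: "g \<in> carrier G" "x \<in> centralizer G (g \<otimes> y \<otimes> inv g)"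
      using cover x by (auto simp: W_def)
    have "g \<otimes> y \<otimes> inv g \<in> Om" using g(1) by (auto simp: Om_def conj_class_def)
    moreover have "g \<otimes> y \<otimes> inv g \<in> centralizer G x" using g y centralizer_sym by simp
    ultimately have "{w \<in> Om. w \<in> centralizer G x} \<noteq> {}" by blast
    then have pos: "fixed x > 0" using finOm by (simp add: fixed_def card_gt_0_iff)
    have "q dvd card {w \<in> Om. w \<notin> centralizer G x}"
    proof (rule dvd_card_not_fixed_by_primary[OF q pr Omc])
      fix e assume "e \<in> Om"
      then obtain u where u: "u \<in> carrier G" "e = u \<otimes> y \<otimes> inv u" by (auto simp: Om_def conj_class_def)
      then have "x \<otimes> e \<otimes> inv x = (x \<otimes> u) \<otimes> y \<otimes> inv (x \<otimes> u)" using xc y by (simp add: m_assoc inv_mult_group)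
      then show "x \<otimes> e \<otimes> inv x \<in> Om" using xc u by (auto simp: Om_def conj_class_def)
    qed
    moreover have "card Om = fixed x + card {w \<in> Om. w \<notin> centralizer G x}"
      unfolding fixed_def using finOm by (subst card_Un_disjoint[symmetric]) (auto intro!: arg_cong[where f = card])
    ultimately have "q dvd fixed x" using \<open>q dvd card Om\<close> by (metis dvd_add_left_iff)
    then have "q \<le> fixed x" using pos by (rule dvd_imp_le)
    then show ?thesis using prime_ge_2_nat[OF q] by linarith
  qed
  have WQ: "W \<subseteq> Q" by (simp add: W_def)
  have "(\<Sum>x\<in>Q. fixed x) = (\<Sum>x\<in>W. fixed x) + (\<Sum>x\<in>Q - W. fixed x)"
    using sum.subset_diff[OF WQ finQ] by (simp add: add.commute)
  moreover have "(\<Sum>x\<in>Q - W. 2) \<le> (\<Sum>x\<in>Q - W. fixed x)" using two by (rule sum_mono)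
  \<comment> \<open>The total \<open>|Q|\<close> is at least \<open>|W| + 2 |Q - W|\<close>, which
    leaves no room outside \<open>W\<close>.\<close>
  ultimately have "card W + 2 * card (Q - W) \<le> card Q" using sumQ sumW by simp
  moreover have "card (Q - W) = card Q - card W" using WQ finQ by (simp add: card_Diff_subset finite_subset)
  moreover have "card W \<le> card Q" using WQ finQ by (simp add: card_mono)
  ultimately have "card Q = card W" by linarith
  then have "W = Q" using WQ finQ by (simp add: card_subset_eq)
  then have "Q \<subseteq> centralizer G c" by (auto simp: W_def)
  then show ?thesis using not_dvd_class_size_if_sylow_le[OF Q m mq c] by simp
qed

section \<open>The centre and primary elements\<close>

lemma subgroup_center: "subgroup (center G) G"
proof (rule subgroupI)
  show "center G \<subseteq> carrier G" by (auto simp: center_def)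
  show "center G \<noteq> {}" by (auto simp: center_def intro!: exI[of _ \<one>])
  have *: "x \<in> center G \<longleftrightarrow> x \<in> carrier G \<and> (\<forall>g \<in> carrier G. x \<in> centralizer G g)" for x
    by (auto simp: center_def centralizer_def)
  show "inv a \<in> center G" if "a \<in> center G" for a
    using that centralizer_inv unfolding * by simp
  show "a \<otimes> b \<in> center G" if "a \<in> center G" "b \<in> center G" for a b
    using that centralizer_mult unfolding * by simp
qed

lemma primaryD: "primary G l x \<Longrightarrow> x \<in> carrier G"
  by (simp add: primary_def)

lemma primary_if_pow_eq_one:
  assumes "Factorial_Ring.prime l" "x \<in> carrier G" "x [^] (l ^ k) = \<one>" shows "primary G l x"
  using assms by (auto simp: primary_def pow_eq_id divides_primepow_nat)

lemma primary_mult: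
  assumes l: "Factorial_Ring.prime l" and x: "primary G l x" and y: "primary G l y" and comm: "y \<in> centralizer G x"
  shows "primary G l (x \<otimes> y)"
proof -
  obtain i j where ij: "ord x = l ^ i" "ord y = l ^ j" using x y by (auto simp: primary_def)
  have c: "x \<in> carrier G" "y \<in> carrier G" using x y by (auto simp: primary_def)
  have "ord (x \<otimes> y) dvd l ^ (i + j)"
    using ord_mul_divides[OF _ c] comm ij by (simp add: centralizer_def power_add)
  then show ?thesis using c l by (auto simp: primary_def divides_primepow_nat)
qed

lemma primary_pow:
  assumes l: "Factorial_Ring.prime l" and x: "primary G l x" shows "primary G l (x [^] (n::nat))"
proof -
  obtain i where i: "ord x = l ^ i" using x by (auto simp: primary_def)
  have c: "x \<in> carrier G" using x by (auto simp: primary_def)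
  have "(x [^] n) [^] (l ^ i) = (x [^] (l ^ i)) [^] n" using c by (simp add: nat_pow_pow mult.commute)
  also have "\<dots> = \<one>" using c i by (metis nat_pow_one pow_ord_eq_1)
  finally show ?thesis using primary_if_pow_eq_one[OF l] c by simp
qed

lemma inv_eq_pow: "x \<in> carrier G \<Longrightarrow> inv x = x [^] (ord x - 1)"
proof -
  assume x: "x \<in> carrier G"
  have "x [^] (ord x - 1) \<otimes> x = x [^] ord x" using ord_pos[OF x] by (metis Suc_diff_1 nat_pow_Suc)
  then have "x [^] (ord x - 1) \<otimes> x = \<one>" using x by simp
  then show ?thesis using x inv_equality by simp
qed

definition "conj_pow e x i = e [^] (i::nat) \<otimes> x \<otimes> inv (e [^] i)"

end

section \<open>A class far away from a maximal class\<close>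

text \<open>\<open>b\<close> represents a class of maximal size, and \<open>d\<close> a class at distance at least three from it
  (this is \<open>dichotomy\<close>). That \<open>d\<close> is a \<open>q\<close>-element is no restriction, as the class size of a power
  of \<open>d\<close> divides that of \<open>d\<close>.\<close>

locale maximal_class = finite_group +
  fixes p q :: nat and b d :: 'a
  assumes p: "Factorial_Ring.prime p" and q: "Factorial_Ring.prime q" and sep: "p_separable p G"
    and b: "b \<in> carrier G" and b_reg: "\<not> p dvd ord b"
    and max: "\<And>x. x \<in> carrier G \<Longrightarrow> \<not> p dvd ord x \<Longrightarrow> class_size G x \<le> class_size G b"
    and d_primary: "primary G q d" and d_reg: "\<not> p dvd ord d" and d_noncentral: "d \<notin> center G"
    and dichotomy: "\<And>x. x \<in> carrier G \<Longrightarrow> \<not> p dvd ord x \<Longrightarrow>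
      coprime (class_size G x) (class_size G b) \<or> coprime (class_size G x) (class_size G d)"
begin

abbreviation "C \<equiv> centralizer G"
abbreviation "cs \<equiv> class_size G"
definition "reg x \<longleftrightarrow> x \<in> carrier G \<and> \<not> p dvd ord x"
definition "S = right_stabilizer (conj_class G b)"
definition "coprime_to_max x \<longleftrightarrow> reg x \<and> coprime (cs x) (cs b)"

lemma regD [dest]: "reg x \<Longrightarrow> x \<in> carrier G" "reg x \<Longrightarrow> \<not> p dvd ord x"
  by (simp_all add: reg_def)

lemma reg_b: "reg b" using b b_reg by (simp add: reg_def)

lemma d: "d \<in> carrier G" using d_primary by (rule primaryD)

lemma reg_d: "reg d" using d d_reg by (simp add: reg_def)

lemma reg_primary: "Factorial_Ring.prime l \<Longrightarrow> l \<noteq> p \<Longrightarrow> primary G l x \<Longrightarrow> reg x"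
  using p by (auto simp: reg_def primary_def) (metis prime_dvd_power primes_dvd_imp_eq)

lemma reg_conj: "reg x \<Longrightarrow> g \<in> carrier G \<Longrightarrow> reg (g \<otimes> x \<otimes> inv g)"
  by (auto simp: reg_def ord_conj)

lemma reg_part: "reg x \<Longrightarrow> reg (part l x)"
  unfolding reg_def using ord_part_dvd part_closed by (meson dvd_trans)

lemma reg_copart: "reg x \<Longrightarrow> reg (copart l x)"
  unfolding reg_def using ord_copart_dvd copart_closed by (meson dvd_trans)

text \<open>Such products are the test elements fed to \<open>dichotomy\<close>: their class size is
  a common multiple of those of the factors.\<close>

lemma coprime_mult:
  assumes x: "reg x" and y: "reg y" and comm: "y \<in> C x" and cop: "coprime (ord x) (ord y)"
  shows "reg (x \<otimes> y)" "C (x \<otimes> y) = C x \<inter> C y" "cs x dvd cs (x \<otimes> y)" "cs y dvd cs (x \<otimes> y)"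
proof -
  have c: "x \<in> carrier G" "y \<in> carrier G" using x y by auto
  have "ord (x \<otimes> y) dvd ord x * ord y"
    using ord_mul_divides[OF _ c] comm by (simp add: centralizer_def)
  moreover have "\<not> p dvd ord x * ord y" using x y prime_dvd_mult_iff[OF p] by (simp add: reg_def)
  ultimately have "\<not> p dvd ord (x \<otimes> y)" by (meson dvd_trans)
  then show "reg (x \<otimes> y)" using c by (simp add: reg_def)
  show eq: "C (x \<otimes> y) = C x \<inter> C y" using centralizer_mult_coprime[OF c comm cop] .
  show "cs x dvd cs (x \<otimes> y)" "cs y dvd cs (x \<otimes> y)"
    using c eq by (intro class_size_dvd; simp)+
qed

lemma max_eq:
  assumes y: "reg y" and sub: "C y \<subseteq> C b" shows "C y = C b"
  using centralizer_eq_if_class_size_le[OF b _ sub] y max by (auto simp: reg_def)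

text \<open>\<open>b x\<close> lies in the \<open>p'\<close>-group generated by \<open>b\<close> and
  \<open>x\<close>, so it is \<open>p\<close>-regular and maximality applies.\<close>

lemma class_size_le_max_if_coprime:
  assumes "coprime_to_max x" shows "cs (b \<otimes> x) \<le> cs b"
proof -
  have x: "x \<in> carrier G" "\<not> p dvd ord x" and cop: "coprime (cs b) (cs x)"
    using assms by (auto simp: coprime_to_max_def coprime_commute)
  have "\<not> p dvd card (generate G {b, x})"
    using p_separable_generate_two[OF p sep b x(1) b_reg x(2) cop] .
  moreover have Y: "subgroup (generate G {b, x}) G" using b x by (intro generate_is_subgroup) simp
  moreover have bx: "b \<otimes> x \<in> generate G {b, x}"
    using subgroup_mult[OF Y] generate.incl[of b "{b, x}" G] generate.incl[of x "{b, x}" G] by simp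
  then have "ord (b \<otimes> x) dvd card (generate G {b, x})"
    using card_subgroup_dvd[OF subgroup_generate_singleton Y generate_singleton_le[OF Y bx]]
      card_generate_singleton[of "b \<otimes> x"] b x by simp
  ultimately show ?thesis using max[of "b \<otimes> x"] b x by (meson dvd_trans m_closed)
qed

lemma normal_S: "S \<lhd> G"
  unfolding S_def using b by (rule normal_right_stabilizer)

lemma subgroup_S: "subgroup S G"
  using normal_S by (rule normal_imp_subgroup)

lemma card_S_dvd: "card S dvd cs b"
  unfolding S_def class_size_def by (rule card_right_stabilizer_dvd[OF conj_class_subset[OF b]])

text \<open>\<open>|S|\<close> divides \<open>cs b\<close> and is therefore coprime to
  \<open>cs x\<close>.\<close>

lemma S_le_centralizer:
  assumes "coprime_to_max x" shows "S \<subseteq> C x"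
proof (rule normal_subset_centralizer_if_coprime[OF normal_S])
  show "x \<in> carrier G" using assms by (auto simp: coprime_to_max_def)
  have "coprime (cs b) (cs x)" using assms by (simp add: coprime_to_max_def coprime_commute)
  then show "coprime (card S) (cs x)" using card_S_dvd coprime_divisors dvd_refl by blast
qed

lemma commutator_in_S:
  assumes "coprime_to_max x" "g \<in> carrier G" shows "(g \<otimes> x \<otimes> inv g) \<otimes> inv x \<in> S"
  unfolding S_def using assms class_size_le_max_if_coprime[OF assms(1)] b
  by (intro commutator_in_right_stabilizer) (auto simp: coprime_to_max_def coprime_commute)

lemma noncentralE:
  assumes x: "x \<in> carrier G" "x \<notin> center G"
  obtains g where "g \<in> carrier G" "g \<otimes> x \<otimes> inv g \<noteq> x"
proof -
  obtain g where g: "g \<in> carrier G" "g \<otimes> x \<noteq> x \<otimes> g" using x by (auto simp: center_def)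
  have "g \<otimes> x \<otimes> inv g \<noteq> x"
  proof
    assume "g \<otimes> x \<otimes> inv g = x"
    then have "g \<otimes> x = x \<otimes> g" using g x by (metis inv_solve_right' m_closed)
    then show False using g by simp
  qed
  then show ?thesis using g that by blast
qed

text \<open>A nontrivial commutator \<open>s\<close> of \<open>x\<close> lies in \<open>S\<close>
  and so commutes with \<open>x\<close>. From \<open>g x inv g = s x\<close> its order is a power of
  \<open>l\<close>, so \<open>l\<close> divides \<open>|S|\<close>, which divides
  \<open>cs b\<close>.\<close>

lemma dvd_max_if_primary_noncentral:
  assumes l: "Factorial_Ring.prime l" and x: "coprime_to_max x" "primary G l x" "x \<notin> center G"
  shows "l dvd cs b"
proof -
  have xc: "x \<in> carrier G" using x(2) by (rule primaryD)
  obtain k where k: "ord x = l ^ k" using x(2) by (auto simp: primary_def)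
  obtain g where g: "g \<in> carrier G" "g \<otimes> x \<otimes> inv g \<noteq> x" using noncentralE[OF xc x(3)] .
  define s where "s = (g \<otimes> x \<otimes> inv g) \<otimes> inv x"
  have sS: "s \<in> S" unfolding s_def using commutator_in_S[OF x(1) g(1)] .
  have sc: "s \<in> carrier G" using subgroup_mem[OF subgroup_S sS] .
  have sx: "s \<otimes> x = x \<otimes> s" using S_le_centralizer[OF x(1)] sS by (auto dest: centralizerD)
  have eq: "g \<otimes> x \<otimes> inv g = s \<otimes> x" unfolding s_def using g xc by (simp add: m_assoc)
  have "s \<noteq> \<one>" using eq g xc by auto
  have "\<one> = (s \<otimes> x) [^] (l ^ k)"
    using ord_conj[OF xc g(1)] k xc g(1) unfolding eq[symmetric] by (metis inv_closed m_closed pow_ord_eq_1)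
  also have "\<dots> = s [^] (l ^ k) \<otimes> x [^] (l ^ k)" using pow_mult_distrib[OF sx sc xc] .
  also have "\<dots> = s [^] (l ^ k)" using k xc sc by (metis nat_pow_closed pow_ord_eq_1 r_one)
  finally have "ord s dvd l ^ k" using sc pow_eq_id by metis
  moreover have "ord s \<noteq> 1" using \<open>s \<noteq> \<one>\<close> sc ord_eq_1 by blast
  ultimately have "l dvd ord s" using l by (auto simp: divides_primepow_nat)
  also have "ord s dvd card S"
    using card_subgroup_dvd[OF subgroup_generate_singleton[OF sc] subgroup_S generate_singleton_le[OF subgroup_S sS]]
      card_generate_singleton[OF sc] by simp
  also note card_S_dvd
  finally show ?thesis .
qed

lemma class_size_d: "cs d > 1"
  using class_size_pos[OF d] center_iff_class_size[OF d] d_noncentral by linarith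

text \<open>\<open>dichotomy\<close> is applied to \<open>d\<close> itself: \<open>cs d > 1\<close>
  is not coprime to itself.\<close>

lemma coprime_to_max_d: "coprime_to_max d"
  using dichotomy[OF d d_reg] class_size_d reg_d by (auto simp: coprime_to_max_def)

lemma q_dvd_max: "q dvd cs b"
  using dvd_max_if_primary_noncentral[OF q coprime_to_max_d d_primary d_noncentral] .

text \<open>\<open>cs (y d)\<close> is a multiple of \<open>cs d > 1\<close>, so
  \<open>dichotomy\<close> leaves only coprimality to \<open>cs b\<close>, which passes to its
  divisor \<open>cs y\<close>.\<close>

lemma coprime_to_max_if_commutes:
  assumes y: "reg y" "\<not> q dvd ord y" and comm: "y \<in> C d"
  shows "coprime_to_max y"
proof -
  obtain k where k: "ord d = q ^ k" using d_primary by (auto simp: primary_def)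
  have "coprime (ord y) (ord d)"
    unfolding k using y(2) q by (metis coprime_commute coprime_power_right_iff prime_imp_coprime)
  moreover have "d \<in> C y" using comm d centralizer_sym by blast
  ultimately have yd: "reg (y \<otimes> d)" "cs y dvd cs (y \<otimes> d)" "cs d dvd cs (y \<otimes> d)"
    using coprime_mult[OF y(1) reg_d] by blast+
  have "\<not> coprime (cs (y \<otimes> d)) (cs d)" using yd(3) class_size_d by (metis coprime_common_divisor_nat dvd_refl less_irrefl)
  then have "coprime (cs (y \<otimes> d)) (cs b)" using dichotomy[of "y \<otimes> d"] yd(1) by blast
  then show ?thesis using y(1) yd(2) by (meson coprime_divisors coprime_to_max_def dvd_refl)
qed

text \<open>Since \<open>q\<close> divides \<open>cs b\<close>, \<open>l \<noteq> q\<close> and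
  \<open>cs y\<close> is coprime to \<open>cs b\<close>; a noncentral \<open>y\<close> would make
  \<open>l\<close> divide \<open>cs b\<close>.\<close>

lemma central_if_commutes:
  assumes l: "Factorial_Ring.prime l" "l \<noteq> p" "\<not> l dvd cs b" and y: "primary G l y" "y \<in> C d"
  shows "y \<in> center G"
proof -
  obtain k where k: "ord y = l ^ k" using y by (auto simp: primary_def)
  have "l \<noteq> q" using l(3) q_dvd_max by blast
  then have "\<not> q dvd ord y" unfolding k using l(1) q by (metis prime_dvd_power primes_dvd_imp_eq)
  then have "coprime_to_max y" using coprime_to_max_if_commutes y reg_primary l by blast
  then show ?thesis using dvd_max_if_primary_noncentral l y by blast
qed

text \<open>As \<open>l\<close> does not divide \<open>cs d\<close>, every \<open>l\<close>-element
  has a conjugate in \<open>C(d)\<close>, where it is central.\<close>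

lemma not_dvd_class_size:
  assumes l: "Factorial_Ring.prime l" "l \<noteq> p" "\<not> l dvd cs b" "\<not> l dvd cs d" and x: "x \<in> carrier G"
  shows "\<not> l dvd cs x"
proof (rule not_dvd_class_size_if_primary_central[OF l(1) x])
  fix y assume y: "primary G l y"
  have yc: "y \<in> carrier G" using y by (rule primaryD)
  obtain h where h: "h \<in> carrier G" "inv h \<otimes> y \<otimes> h \<in> C d"
    using primary_conj_into_centralizer[OF l(1) y d l(4)] .
  have "inv h \<otimes> y \<otimes> h \<in> center G"
    using central_if_commutes[OF l(1-3) primary_conj'[OF y h(1)] h(2)] .
  then show "y \<in> center G" using center_conj_iff'[OF yc h(1)] by simp
qed

text \<open>Some conjugate of \<open>a\<close> by \<open>g\<close> lies in \<open>C(x)\<close>.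
  Writing \<open>g = h k\<close> with \<open>h\<close> in \<open>C(b)\<close> and \<open>k\<close>
  in \<open>C(x)\<close>, the factor \<open>h\<close> commutes with \<open>a\<close> and
  \<open>k\<close> can be undone inside \<open>C(x)\<close>.\<close>

lemma commutes_if_centralized:
  assumes l: "Factorial_Ring.prime l" and a: "primary G l a" "C b \<subseteq> C a" and x: "coprime_to_max x" "\<not> l dvd cs x"
  shows "a \<in> C x"
proof -
  have xc: "x \<in> carrier G" and cop: "coprime (cs b) (cs x)" using x(1) by (auto simp: coprime_to_max_def coprime_commute)
  have ac: "a \<in> carrier G" using a(1) by (rule primaryD)
  obtain g where g: "g \<in> carrier G" "inv g \<otimes> a \<otimes> g \<in> C x"
    using primary_conj_into_centralizer[OF l a(1) xc x(2)] .
  obtain h k where hk: "h \<in> C b" "k \<in> C x" "g = h \<otimes> k"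
    using factorize_coprime_class_sizes[OF b xc cop g(1)] .
  have c: "h \<in> carrier G" "k \<in> carrier G" using hk by (auto dest: centralizerD)
  have "h \<in> C a" using hk a by blast
  then have ha: "a \<otimes> h = h \<otimes> a" by (auto dest: centralizerD)
  have "inv g \<otimes> a \<otimes> g = inv k \<otimes> inv h \<otimes> (a \<otimes> h) \<otimes> k"
    unfolding hk(3) using c ac by (simp add: m_assoc inv_mult_group)
  also have "\<dots> = inv k \<otimes> a \<otimes> k" unfolding ha using c ac by (simp add: m_assoc)
  finally have "inv k \<otimes> a \<otimes> k \<in> C x" using g(2) by simp
  then have "k \<otimes> (inv k \<otimes> a \<otimes> k) \<otimes> inv k \<in> C x"
    using hk(2) centralizer_mult[OF xc] centralizer_inv[OF xc] by blast
  then show ?thesis using c ac by (simp add: m_assoc)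
qed

end

section \<open>The case that \<open>p\<close> divides neither class size: central parts of
  \<open>b\<close>\<close>

locale maximal_class_p = maximal_class +
  assumes p_b: "\<not> p dvd class_size G b" and p_d: "\<not> p dvd class_size G d"
begin

lemma part_p: "reg x \<Longrightarrow> part p x = \<one>"
  using ord_part[of x p] ord_eq_1[of "part p x"] by (auto simp: reg_def not_dvd_imp_multiplicity_0)

lemma one_central: "\<one> \<in> center G"
  using subgroup_one[OF subgroup_center] .

text \<open>The \<open>l\<close>-part commutes with \<open>d\<close>, so its class size is coprime
  to \<open>cs b\<close>; it also divides \<open>cs b\<close>. For \<open>l = p\<close> the part is
  trivial, as \<open>b\<close> is \<open>p\<close>-regular.\<close>

lemma part_central:
  assumes l: "Factorial_Ring.prime l" "l \<noteq> q" "\<not> l dvd cs d"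
  shows "part l b \<in> center G"
proof (cases "l = p")
  case True
  then show ?thesis using part_p[OF reg_b] one_central by simp
next
  case False
  let ?a = "part l b"
  have a: "primary G l ?a" "C b \<subseteq> C ?a" using primary_part centralizer_le_part b by blast+
  have ac: "?a \<in> carrier G" using b by simp
  have "?a \<in> C d" using commutes_if_centralized[OF l(1) a coprime_to_max_d l(3)] .
  moreover have "\<not> q dvd ord ?a" using ord_part[OF b] l q by (metis prime_dvd_power primes_dvd_imp_eq)
  ultimately have "coprime_to_max ?a" using coprime_to_max_if_commutes reg_part[OF reg_b] by blast
  moreover have "cs ?a dvd cs b" using class_size_dvd[OF ac b a(2)] .
  ultimately have "cs ?a = 1" by (metis coprime_common_divisor_nat coprime_to_max_def dvd_refl)
  then show ?thesis using center_iff_class_size[OF ac] by simp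
qed

lemma d_not_dvd_b: "Factorial_Ring.prime l \<Longrightarrow> l dvd cs d \<Longrightarrow> \<not> l dvd cs b"
  using coprime_to_max_d unfolding coprime_to_max_def by (meson coprime_common_divisor not_prime_unit)

lemma q_not_dvd_d: "\<not> q dvd cs d"
  using d_not_dvd_b q q_dvd_max by blast

lemma noncoprime_if_centralized:
  assumes y: "y \<in> carrier G" "C b \<subseteq> C y" "y \<notin> center G" and x: "cs y dvd cs x"
  shows "\<not> coprime (cs x) (cs b)"
  using class_size_dvd[OF y(1) b y(2)] x y center_iff_class_size[OF y(1)] coprime_common_divisor_nat by blast

lemma coprime_ord_primary:
  "Factorial_Ring.prime l \<Longrightarrow> Factorial_Ring.prime r \<Longrightarrow> l \<noteq> r \<Longrightarrow> primary G l x \<Longrightarrow> primary G r y \<Longrightarrow> coprime (ord x) (ord y)"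
  by (auto simp: primary_def primes_coprime)

text \<open>Preparation for refuting \<open>nc\<close>. A noncentral \<open>m\<close> commutes with
  the \<open>q\<close>-part of \<open>b\<close>; the class size of their product shares a factor
  with \<open>cs b\<close>, so \<open>cs m\<close> is coprime to \<open>cs d\<close> too and
  \<open>p\<close> is its only possible prime divisor. Hence \<open>m\<close> commutes with all
  parts of \<open>b\<close>, and maximality applied to \<open>m\<close> times the
  \<open>l'\<close>-part of \<open>b\<close> makes \<open>cs m\<close> divide
  \<open>cs b\<close>.\<close>

lemma primary_central_if_q_part_noncentral:
  assumes nc: "part q b \<notin> center G" and l: "Factorial_Ring.prime l" "l \<noteq> q"
    and m: "coprime_to_max m" "primary G l m"
  shows "m \<in> center G"
proof (rule ccontr)
  assume mnc: "m \<notin> center G"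
  let ?c = "part q b"
  have mc: "m \<in> carrier G" using m(2) by (rule primaryD)
  have mreg: "reg m" using m(1) by (simp add: coprime_to_max_def)
  have lb: "l dvd cs b" using dvd_max_if_primary_noncentral[OF l(1) m mnc] .
  then have lp: "l \<noteq> p" using p_b by blast
  have cop: "coprime (cs m) (cs b)" using m(1) by (simp add: coprime_to_max_def)
  have nd: "\<not> j dvd cs m" if "Factorial_Ring.prime j" "j dvd cs b" for j
    using cop that by (meson coprime_common_divisor not_prime_unit)
  have c: "primary G q ?c" "C b \<subseteq> C ?c" "?c \<in> carrier G" using primary_part centralizer_le_part b by auto
  have comm: "?c \<in> C m" using commutes_if_centralized[OF q c(1,2) m(1) nd[OF q q_dvd_max]] .
  have mcm: "reg (m \<otimes> ?c)" "cs ?c dvd cs (m \<otimes> ?c)" "cs m dvd cs (m \<otimes> ?c)"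
    using coprime_mult[OF mreg reg_part[OF reg_b] comm coprime_ord_primary[OF l(1) q l(2) m(2) c(1)]] by blast+
  have "\<not> coprime (cs (m \<otimes> ?c)) (cs b)" using noncoprime_if_centralized[OF c(3,2) nc mcm(2)] .
  then have "coprime (cs (m \<otimes> ?c)) (cs d)" using dichotomy[of "m \<otimes> ?c"] mcm(1) by blast
  then have copd: "coprime (cs m) (cs d)" using mcm(3) by (meson coprime_divisors dvd_refl)
  \<comment> \<open>A prime other than \<open>p\<close> dividing \<open>cs m\<close> would divide
    \<open>cs b\<close> or \<open>cs d\<close>, and \<open>cs m\<close> is coprime to both.\<close>
  have only_p: "\<not> j dvd cs m" if "Factorial_Ring.prime j" "j \<noteq> p" for j
    using that nd[of j] copd not_dvd_class_size[OF that] mc by (meson coprime_common_divisor not_prime_unit)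
  have "m \<in> C b"
  proof (rule centralizer_eq_Int_parts[OF b mc])
    fix j assume j: "Factorial_Ring.prime j" "j dvd ord b"
    then have "j \<noteq> p" using b_reg by blast
    have "part j b \<in> C m"
      using commutes_if_centralized[OF j(1) primary_part[OF b] centralizer_le_part[OF b] m(1) only_p[OF j(1) \<open>j \<noteq> p\<close>]] .
    then show "m \<in> C (part j b)" using mc centralizer_sym by blast
  qed
  \<comment> \<open>The \<open>l\<close>-part of \<open>b\<close> is central because
    \<open>l\<close> divides \<open>cs b\<close> and so not \<open>cs d\<close>; dropping it makes
    the order coprime to that of \<open>m\<close> and keeps the centralizer.\<close>
  let ?b' = "copart l b"
  have "\<not> l dvd cs d" using d_not_dvd_b l(1) lb by blast
  then have "part l b \<in> center G" using part_central l by blast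
  then have "C (part l b) = carrier G" by (simp add: center_iff)
  then have Cb': "C ?b' = C b" using centralizer_part_copart[OF b l(1)] centralizer_subset by blast
  obtain i where i: "ord m = l ^ i" using m(2) by (auto simp: primary_def)
  have "coprime (ord ?b') (ord m)"
    unfolding i using not_dvd_ord_copart[OF b l(1)] l(1) by (metis coprime_commute coprime_power_right_iff prime_imp_coprime)
  moreover have "m \<in> C ?b'" using \<open>m \<in> C b\<close> Cb' by simp
  ultimately have bm: "reg (?b' \<otimes> m)" "C (?b' \<otimes> m) = C b \<inter> C m"
    using coprime_mult[OF reg_copart[OF reg_b] mreg] Cb' by auto
  then have "C b \<inter> C m = C b" using max_eq[OF bm(1)] by blast
  then have "cs m dvd cs b" using class_size_dvd[OF mc b] by blast
  then have "cs m = 1" using cop by (metis coprime_common_divisor_nat dvd_refl)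
  then show False using mnc center_iff_class_size[OF mc] by simp
qed

text \<open>For \<open>l \<noteq> q\<close> dividing \<open>cs b\<close>, hence not
  \<open>cs d\<close>, every \<open>l\<close>-element is conjugate into \<open>C(d)\<close>. There
  its class size is coprime to \<open>cs b\<close>, so it is central by the preceding lemma, and
  \<open>l\<close> divides no class size.\<close>

lemma only_q_dvd_max_if_q_part_noncentral:
  assumes nc: "part q b \<notin> center G" and l: "Factorial_Ring.prime l" "l dvd cs b"
  shows "l = q"
proof (rule ccontr)
  assume lq: "l \<noteq> q"
  have lp: "l \<noteq> p" using p_b l by blast
  have "\<not> l dvd cs b"
  proof (rule not_dvd_class_size_if_primary_central[OF l(1) b])
    fix y assume y: "primary G l y"
    have yc: "y \<in> carrier G" using y by (rule primaryD)
    have "\<not> l dvd cs d" using d_not_dvd_b l by blast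
    then obtain h where h: "h \<in> carrier G" "inv h \<otimes> y \<otimes> h \<in> C d"
      using primary_conj_into_centralizer[OF l(1) y d] by blast
    let ?y = "inv h \<otimes> y \<otimes> h"
    have pr: "primary G l ?y" using primary_conj'[OF y h(1)] .
    then obtain k where k: "ord ?y = l ^ k" by (auto simp: primary_def)
    have "\<not> q dvd ord ?y" unfolding k using l q lq by (metis prime_dvd_power primes_dvd_imp_eq)
    then have "coprime_to_max ?y" using coprime_to_max_if_commutes[OF reg_primary[OF l(1) lp pr]] h(2) by blast
    then have "?y \<in> center G" using primary_central_if_q_part_noncentral[OF nc l(1) lq _ pr] by blast
    then show "y \<in> center G" using center_conj_iff'[OF yc h(1)] by simp
  qed
  then show False using l by simp
qed

lemma prime_dvd_d:
  assumes r: "Factorial_Ring.prime r" "r dvd cs d"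
  shows "r \<noteq> p" "r \<noteq> q" "\<not> r dvd cs b"
  using assms p_d q_not_dvd_d d_not_dvd_b by blast+

text \<open>Coprimality of \<open>cs e\<close> to \<open>cs b\<close> would force
  \<open>r dvd cs b\<close>, which \<open>r dvd cs d\<close> excludes; \<open>dichotomy\<close>
  gives the rest.\<close>

lemma noncentral_primary_noncoprime:
  assumes r: "Factorial_Ring.prime r" "r dvd cs d" and e: "primary G r e" "e \<notin> center G"
  shows "reg e" "\<not> coprime (cs e) (cs b)" "coprime (cs e) (cs d)"
proof -
  note rr = prime_dvd_d[OF r]
  show reg: "reg e" using reg_primary r rr e by blast
  show "\<not> coprime (cs e) (cs b)"
    using dvd_max_if_primary_noncentral[OF r(1) _ e] reg rr(3) by (auto simp: coprime_to_max_def)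
  then show "coprime (cs e) (cs d)" using dichotomy[of e] reg by blast
qed

text \<open>If a part of \<open>b\<close> at a prime \<open>j \<noteq> q\<close> is noncentral, then
  \<open>j\<close> divides \<open>cs d\<close> and this part serves as \<open>y\<close>. Otherwise
  the \<open>q\<close>-part \<open>c\<close> has the centralizer of \<open>b\<close>; a noncentral
  \<open>r\<close>-element \<open>y\<close> is conjugated into \<open>C(b)\<close>, and maximality
  applied to \<open>C(y c) = C(y) \<inter> C(b)\<close> forces
  \<open>C(b) \<subseteq> C(y)\<close>.\<close>

lemma obtain_central_primary_of_max:
  assumes nc: "part q b \<notin> center G"
  obtains r y where "Factorial_Ring.prime r" "r dvd cs d" "primary G r y" "y \<notin> center G" "C b \<subseteq> C y"
proof (cases "\<exists>j. Factorial_Ring.prime j \<and> j \<noteq> q \<and> part j b \<notin> center G")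
  case True
  then obtain j where j: "Factorial_Ring.prime j" "j \<noteq> q" "part j b \<notin> center G" by blast
  then have "j dvd cs d" using part_central by blast
  then show ?thesis using that[OF j(1) _ primary_part[OF b] j(3) centralizer_le_part[OF b]] by blast
next
  case False
  let ?c = "part q b"
  have cc: "?c \<in> carrier G" using b by simp
  have sub: "C ?c \<subseteq> C b"
  proof
    fix g assume g: "g \<in> C ?c"
    have gc: "g \<in> carrier G" using g by (auto dest: centralizerD)
    show "g \<in> C b"
    proof (rule centralizer_eq_Int_parts[OF b gc])
      fix l assume l: "Factorial_Ring.prime l" "l dvd ord b"
      show "g \<in> C (part l b)"
      proof (cases "l = q")
        case False
        then have "part l b \<in> center G" using \<open>\<not> (\<exists>j. _ j)\<close> l by blast
        then show ?thesis using gc by (simp add: center_iff)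
      qed (use g in simp)
    qed
  qed
  obtain r where r: "Factorial_Ring.prime r" "r dvd cs d"
    using class_size_d prime_factor_nat[of "cs d"] by auto
  note rr = prime_dvd_d[OF r]
  obtain y0 where y0: "primary G r y0" "y0 \<notin> center G"
    using not_dvd_class_size_if_primary_central[OF r(1) d] r(2) by blast
  obtain h where h: "h \<in> carrier G" "inv h \<otimes> y0 \<otimes> h \<in> C b"
    using primary_conj_into_centralizer[OF r(1) y0(1) b rr(3)] .
  let ?y = "inv h \<otimes> y0 \<otimes> h"
  have y: "primary G r ?y" "?y \<notin> center G"
    using primary_conj'[OF y0(1) h(1)] center_conj_iff'[OF primaryD[OF y0(1)] h(1)] y0(2) by auto
  have yc: "?y \<in> carrier G" using y(1) by (rule primaryD)
  have "?y \<in> C ?c" using h(2) centralizer_le_part[OF b] by blast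
  then have "?c \<in> C ?y" using cc centralizer_sym by blast
  then have "reg (?y \<otimes> ?c)" "C (?y \<otimes> ?c) = C ?y \<inter> C ?c"
    using coprime_mult[OF reg_primary[OF r(1) rr(1) y(1)] reg_part[OF reg_b]]
      coprime_ord_primary[OF r(1) q rr(2) y(1) primary_part[OF b]] by blast+
  then have "C ?y \<inter> C ?c = C b" using max_eq[of "?y \<otimes> ?c"] sub by auto
  then show ?thesis using that[OF r y] by blast
qed

text \<open>A noncentral \<open>q\<close>-part \<open>c\<close> makes \<open>cs b\<close> a power of
  \<open>q\<close>, and with it \<open>cs c\<close> and \<open>cs y\<close> for the \<open>y\<close>
  obtained above. A \<open>q\<close>-element \<open>x\<close> commutes with \<open>c\<close> if
  \<open>cs x\<close> is coprime to \<open>cs b\<close>, and otherwise with a conjugate of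
  \<open>y\<close>, since \<open>r\<close> does not divide \<open>cs x\<close>. By
  \<open>not_dvd_class_size_if_covered\<close>, \<open>q\<close> does not divide
  \<open>cs c\<close>, so \<open>c\<close> is central after all.\<close>

lemma q_part_central: "part q b \<in> center G"
proof (rule ccontr)
  assume nc: "part q b \<notin> center G"
  let ?c = "part q b"
  have c: "primary G q ?c" "C b \<subseteq> C ?c" "?c \<in> carrier G" using primary_part centralizer_le_part b by auto
  obtain r y where r: "Factorial_Ring.prime r" "r dvd cs d" and y: "primary G r y" "y \<notin> center G" "C b \<subseteq> C y"
    using obtain_central_primary_of_max[OF nc] .
  have yc: "y \<in> carrier G" using y(1) by (rule primaryD)
  have csb: "cs b > 0" using class_size_pos[OF b] .
  have qpow: "\<exists>f. n = q ^ f" if n: "n dvd cs b" for n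
  proof -
    have "n \<noteq> 0" using n csb by auto
    define m where "m = n div q ^ multiplicity q n"
    have m: "n = q ^ multiplicity q n * m" "\<not> q dvd m"
      using multiplicity_decompose[of n q] \<open>n \<noteq> 0\<close> q not_prime_unit by (auto simp: m_def multiplicity_dvd)
    have "m = 1"
    proof (rule ccontr)
      assume "m \<noteq> 1"
      then obtain l where l: "Factorial_Ring.prime l" "l dvd m" using prime_factor_nat by blast
      then have "l dvd cs b" using m(1) n by (metis dvd_mult dvd_trans)
      then have "l = q" using only_q_dvd_max_if_q_part_noncentral[OF nc l(1)] by simp
      then show False using l m by simp
    qed
    then show ?thesis using m(1) by (metis mult.right_neutral)
  qed
  obtain f where f: "cs y = q ^ f" using qpow class_size_dvd[OF yc b y(3)] by blast
  have "\<not> q dvd cs ?c"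
  proof (rule not_dvd_class_size_if_covered[OF q c(3) yc f])
    show "cs y \<noteq> 1" using y(2) center_iff_class_size[OF yc] by simp
    fix x assume x: "primary G q x"
    have xc: "x \<in> carrier G" using x by (rule primaryD)
    have "q \<noteq> p" using q_dvd_max p_b by blast
    then have xreg: "reg x" using reg_primary q x by blast
    show "x \<in> C ?c \<or> (\<exists>g \<in> carrier G. x \<in> C (g \<otimes> y \<otimes> inv g))"
    proof (cases "coprime_to_max x")
      case True
      then have "\<not> q dvd cs x" using q_dvd_max q unfolding coprime_to_max_def by (meson coprime_common_divisor not_prime_unit)
      then have "?c \<in> C x" using commutes_if_centralized[OF q c(1,2) True] by blast
      then show ?thesis using xc centralizer_sym by blast
    next
      case False
      then have "coprime (cs x) (cs d)" using dichotomy[of x] xreg by (auto simp: coprime_to_max_def)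
      then have "\<not> r dvd cs x" using r by (meson coprime_common_divisor not_prime_unit)
      then obtain h where h: "h \<in> carrier G" "inv h \<otimes> y \<otimes> h \<in> C x"
        using primary_conj_into_centralizer[OF r(1) y(1) xc] by blast
      then have "x \<in> C (inv h \<otimes> y \<otimes> inv (inv h))" using xc centralizer_sym by simp
      then show ?thesis using h(1) by blast
    qed
  qed
  moreover obtain g where "cs ?c = q ^ g" using qpow class_size_dvd[OF c(3) b c(2)] by blast
  ultimately have "cs ?c = 1" by (cases g) auto
  then show False using nc center_iff_class_size[OF c(3)] by simp
qed

end

section \<open>The normal closure \<open>A\<close> of \<open>d\<close>, an abelian
  \<open>q\<close>-group\<close>

context maximal_class begin

definition "D = conj_class G d"
definition "A = generate G D"

lemma D_carrier: "D \<subseteq> carrier G"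
  unfolding D_def using d by (rule conj_class_subset)

lemma D_coprime_to_max: "x \<in> D \<Longrightarrow> coprime_to_max x"
  using coprime_to_max_d d by (auto simp: D_def conj_class_def coprime_to_max_def class_size_conj intro: reg_conj)

text \<open>Conjugates of \<open>d\<close> differ from \<open>d\<close> by elements of
  \<open>S\<close>, and \<open>S\<close> centralizes every conjugate of \<open>d\<close>.\<close>

lemma D_commute:
  assumes x: "x \<in> D" and y: "y \<in> D" shows "x \<in> C y"
proof -
  have c: "x \<in> carrier G" "y \<in> carrier G" using x y D_carrier by auto
  have *: "z \<otimes> inv d \<in> S" if "z \<in> D" for z
    using that commutator_in_S[OF coprime_to_max_d] by (auto simp: D_def conj_class_def)
  have "x \<otimes> inv d \<in> C d" using *[OF x] S_le_centralizer[OF coprime_to_max_d] by blast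
  then have "(x \<otimes> inv d) \<otimes> d \<in> C d" using centralizer_mult d by simp
  then have "x \<in> C d" using c d by (simp add: m_assoc)
  then have xd: "d \<in> C x" using d centralizer_sym by blast
  have "y \<otimes> inv d \<in> C x" using *[OF y] S_le_centralizer[OF D_coprime_to_max[OF x]] by blast
  then have "(y \<otimes> inv d) \<otimes> d \<in> C x" using centralizer_mult c xd by blast
  then have "y \<in> C x" using c d by (simp add: m_assoc)
  then show ?thesis using c centralizer_sym by blast
qed

lemma subgroup_A: "subgroup A G"
  unfolding A_def using D_carrier by (rule generate_is_subgroup)

lemma D_le_A: "D \<subseteq> A"
  unfolding A_def by (auto intro: generate.incl)

lemma A_commute:
  assumes "x \<in> A" "y \<in> A" shows "x \<otimes> y = y \<otimes> x"
proof -
  have 1: "A \<subseteq> C z" if z: "z \<in> D" for z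
    unfolding A_def using D_commute[OF _ z] z D_carrier
    by (intro generate_subgroup_incl subgroup_centralizer) auto
  have yc: "y \<in> carrier G" using subgroup_mem[OF subgroup_A assms(2)] .
  have "D \<subseteq> C y" using 1 assms(2) D_carrier centralizer_sym by blast
  then have "A \<subseteq> C y" unfolding A_def using subgroup_centralizer[OF yc] by (rule generate_subgroup_incl)
  then show ?thesis using assms(1) by (auto dest: centralizerD)
qed

lemma comm_group_A: "comm_group (G\<lparr>carrier := A\<rparr>)"
proof -
  interpret A: group "G\<lparr>carrier := A\<rparr>" using subgroup_A by (rule subgroup_imp_group)
  show ?thesis using A_commute by (intro A.group_comm_groupI) simp
qed

text \<open>In the abelian group \<open>A\<close> the elements killed by \<open>q^k = ord d\<close>
  form a subgroup, and it contains all conjugates of \<open>d\<close>.\<close>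

lemma primary_A:
  assumes "x \<in> A" shows "primary G q x"
proof -
  obtain k where k: "ord d = q ^ k" using d_primary by (auto simp: primary_def)
  have D: "z [^] (q ^ k) = \<one>" if "z \<in> D" for z
    using that d k ord_conj by (auto simp: D_def conj_class_def) (metis inv_closed m_closed pow_ord_eq_1)
  let ?H = "{z \<in> A. z [^] (q ^ k) = \<one>}"
  have "subgroup ?H G"
  proof (rule subgroupI)
    show "?H \<subseteq> carrier G" using subgroup_mem[OF subgroup_A] by blast
    have "\<one> \<in> ?H" using subgroup_one[OF subgroup_A] by simp
    then show "?H \<noteq> {}" by blast
    show "inv z \<in> ?H" if "z \<in> ?H" for z
      using that subgroup_inv[OF subgroup_A] subgroup_mem[OF subgroup_A] by (simp add: nat_pow_inv)
    show "z \<otimes> w \<in> ?H" if "z \<in> ?H" "w \<in> ?H" for z w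
      using that subgroup_mult[OF subgroup_A] subgroup_mem[OF subgroup_A] pow_mult_distrib[OF A_commute] by simp
  qed
  moreover have "D \<subseteq> ?H" using D D_le_A by blast
  ultimately have "A \<subseteq> ?H" unfolding A_def[symmetric] using generate_subgroup_incl A_def by metis
  then show ?thesis using assms primary_if_pow_eq_one[OF q] subgroup_mem[OF subgroup_A] by blast
qed

lemma conj_D:
  assumes "x \<in> D" "g \<in> carrier G" shows "g \<otimes> x \<otimes> inv g \<in> D"
proof -
  obtain u where u: "u \<in> carrier G" "x = u \<otimes> d \<otimes> inv u" using assms(1) by (auto simp: D_def conj_class_def)
  then have "g \<otimes> x \<otimes> inv g = (g \<otimes> u) \<otimes> d \<otimes> inv (g \<otimes> u)" using assms(2) d by (simp add: m_assoc inv_mult_group)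
  then show ?thesis using u assms(2) by (auto simp: D_def conj_class_def)
qed

lemma conj_A:
  assumes "x \<in> A" "g \<in> carrier G" shows "g \<otimes> x \<otimes> inv g \<in> A"
proof -
  have "A \<lhd> G" unfolding A_def using D_carrier conj_D by (rule normal_generateI)
  from normal.inv_op_closed2[OF this assms(2,1)] show ?thesis .
qed

abbreviation "prod_A f n \<equiv> finprod (G\<lparr>carrier := A\<rparr>) f {..n::nat}"

lemma prod_A_closed: "(\<And>i. f i \<in> A) \<Longrightarrow> prod_A f n \<in> A"
  using comm_monoid.finprod_closed[of "G\<lparr>carrier := A\<rparr>" f "{..n}"] comm_group_A
  by (simp add: comm_group_def)

lemma prod_A_Suc: "(\<And>i. f i \<in> A) \<Longrightarrow> prod_A f (Suc n) = f (Suc n) \<otimes> prod_A f n"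
  using comm_monoid.finprod_Suc[of "G\<lparr>carrier := A\<rparr>" f n] comm_group_A
  by (simp add: comm_group_def)

lemma prod_A_Suc2: "(\<And>i. f i \<in> A) \<Longrightarrow> prod_A f (Suc n) = prod_A (\<lambda>i. f (Suc i)) n \<otimes> f 0"
  using comm_monoid.finprod_Suc2[of "G\<lparr>carrier := A\<rparr>" f n] comm_group_A
  by (simp add: comm_group_def)

lemma prod_A_0: "f 0 \<in> A \<Longrightarrow> prod_A f 0 = f 0"
  using comm_monoid.finprod_0[of "G\<lparr>carrier := A\<rparr>" f] comm_group_A
  by (simp add: comm_group_def)

lemma conj_prod_A:
  assumes f: "\<And>i. f i \<in> A" and g: "g \<in> carrier G"
  shows "g \<otimes> prod_A f n \<otimes> inv g = prod_A (\<lambda>i. g \<otimes> f i \<otimes> inv g) n"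
proof (induction n)
  case 0
  then show ?case using prod_A_0[of f] prod_A_0[of "\<lambda>i. g \<otimes> f i \<otimes> inv g"] f conj_A[OF f g] by simp
next
  case (Suc n)
  have c: "f (Suc n) \<in> carrier G" "prod_A f n \<in> carrier G"
    using subgroup_mem[OF subgroup_A] f prod_A_closed[of f] by blast+
  have "g \<otimes> prod_A f (Suc n) \<otimes> inv g = (g \<otimes> f (Suc n) \<otimes> inv g) \<otimes> (g \<otimes> prod_A f n \<otimes> inv g)"
    using c g prod_A_Suc[of f n] f by (simp add: m_assoc)
  then show ?case
    using prod_A_Suc[of "\<lambda>i. g \<otimes> f i \<otimes> inv g" n] conj_A[OF f g] Suc by simp
qed

lemma prod_A_in_centralizer:
  assumes "\<And>i. f i \<in> A" "\<And>i. f i \<in> C h" "h \<in> carrier G" shows "prod_A f n \<in> C h"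
proof (induction n)
  case 0
  then show ?case using prod_A_0[of f] assms by simp
next
  case (Suc n)
  then show ?case using prod_A_Suc[of f n] assms centralizer_mult by simp
qed

lemma conj_pow_in_A:
  assumes "x \<in> A" "e \<in> carrier G" shows "conj_pow e x i \<in> A"
  unfolding conj_pow_def using assms by (intro conj_A) auto

text \<open>The element \<open>x x\<^sup>e \<cdots> x\<^sup>e\<^sup>n\<close>, written with \<open>n = r - 1\<close> for an element \<open>e\<close> of order \<open>r\<close> modulo the centre.\<close>

definition "norm_A n e x = prod_A (conj_pow e x) n"

lemma norm_A_closed: "x \<in> A \<Longrightarrow> e \<in> carrier G \<Longrightarrow> norm_A n e x \<in> A"
  unfolding norm_A_def by (intro prod_A_closed conj_pow_in_A)

text \<open>Conjugation by \<open>e\<close> shifts the factors by one, and since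
  \<open>e^(n+1)\<close> is central the factor entering at the end is \<open>x\<close>
  again.\<close>

lemma norm_A_in_centralizer:
  assumes x: "x \<in> A" and e: "e \<in> carrier G" "e [^] Suc n \<in> center G"
  shows "norm_A n e x \<in> C e"
proof -
  let ?f = "conj_pow e x"
  have xc: "x \<in> carrier G" using subgroup_mem[OF subgroup_A x] .
  have f: "\<And>i. ?f i \<in> A" using conj_pow_in_A[OF x e(1)] .
  have f0: "?f 0 = x" using xc by (simp add: conj_pow_def)
  have "e [^] Suc n \<otimes> x = x \<otimes> e [^] Suc n" using e(2) xc by (auto simp: center_def)
  then have fn: "?f (Suc n) = x" unfolding conj_pow_def using xc e(1) by (simp add: m_assoc del: nat_pow_Suc)
  have shift: "e \<otimes> ?f i \<otimes> inv e = ?f (Suc i)" for i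
    unfolding conj_pow_def using xc e(1) by (subst (1 2) nat_pow_Suc2) (simp_all add: m_assoc inv_mult_group)
  have Nc: "norm_A n e x \<in> carrier G" using subgroup_mem[OF subgroup_A norm_A_closed[OF x e(1)]] .
  have "e \<otimes> norm_A n e x \<otimes> inv e = prod_A (\<lambda>i. ?f (Suc i)) n"
    unfolding norm_A_def conj_prod_A[OF f e(1)] shift ..
  \<comment> \<open>The product of \<open>n + 2\<close> factors is split at its last and at its
    first factor, both of which are \<open>x\<close>.\<close>
  moreover have "x \<otimes> norm_A n e x = prod_A (\<lambda>i. ?f (Suc i)) n \<otimes> x"
    using prod_A_Suc[of ?f n] prod_A_Suc2[of ?f n] f f0 fn by (simp add: norm_A_def)
  moreover have "prod_A (\<lambda>i. ?f (Suc i)) n \<in> A" using f by (intro prod_A_closed)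
  ultimately have "x \<otimes> norm_A n e x = x \<otimes> (e \<otimes> norm_A n e x \<otimes> inv e)"
    using A_commute[OF _ x] by simp
  then have "norm_A n e x = e \<otimes> norm_A n e x \<otimes> inv e" using xc Nc e(1) by simp
  then have "norm_A n e x \<otimes> e = e \<otimes> norm_A n e x" using Nc e(1) by (metis inv_solve_right m_closed)
  then show ?thesis using Nc by (simp add: centralizer_def)
qed

end

section \<open>\<open>r\<close>-elements for primes \<open>r\<close> dividing the class size of
  \<open>d\<close>\<close>

context maximal_class_p begin

text \<open>If \<open>e\<close> is a noncentral \<open>r\<close>-element commuting with a \<open>q\<close>-element \<open>x\<close> such that
  \<open>C(e) \<inter> C(d) \<subseteq> C(x)\<close>, then \<open>|C(e) : C(e) \<inter> C(x)|\<close> divides both \<open>|d\<^sup>G|\<close> and \<open>|(e x)\<^sup>G|\<close>, which are coprime.\<close>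

lemma centralizer_le_if_Int_le:
  assumes r: "Factorial_Ring.prime r" "r dvd cs d" and e: "primary G r e" "e \<notin> center G"
    and x: "primary G q x" "x \<in> C e" and sub: "C e \<inter> C d \<subseteq> C x"
  shows "C e \<subseteq> C x"
proof -
  note rr = prime_dvd_d[OF r]
  note ne = noncentral_primary_noncoprime[OF r e]
  have c: "e \<in> carrier G" "x \<in> carrier G" using e x primaryD by auto
  have "q \<noteq> p" using q_dvd_max p_b by blast
  then have xreg: "reg x" using reg_primary q x by blast
  have ex: "reg (e \<otimes> x)" "C (e \<otimes> x) = C e \<inter> C x" "cs e dvd cs (e \<otimes> x)"
    using coprime_mult[OF ne(1) xreg x(2) coprime_ord_primary[OF r(1) q rr(2) e(1) x(1)]] by blast+
  have "\<not> coprime (cs (e \<otimes> x)) (cs b)" using ne(2) ex(3) by (meson coprime_divisors dvd_refl)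
  then have cop: "coprime (cs (e \<otimes> x)) (cs d)" using dichotomy[of "e \<otimes> x"] ex(1) by blast
  let ?I = "C e \<inter> C x" and ?J = "C e \<inter> C d"
  have Ce: "subgroup (C e) G" and Cd: "subgroup (C d) G" and Cx: "subgroup (C x) G"
    using subgroup_centralizer c d by auto
  have I: "subgroup ?I G" and J: "subgroup ?J G" using Ce Cd Cx subgroups_Inter_pair by blast+
  obtain u where u: "card (C e) = card ?I * u" using card_subgroup_dvd[OF I Ce] by (auto elim: dvdE)
  have "?J \<subseteq> ?I" using sub by blast
  then obtain w where w: "card ?I = card ?J * w" using card_subgroup_dvd[OF J I] by (auto elim: dvdE)
  have posJ: "card ?J > 0" using J by (rule card_subgroup_pos)
  have posI: "card ?I > 0" using I by (rule card_subgroup_pos)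
  have posd: "card (C d) > 0" using Cd by (rule card_subgroup_pos)
  \<comment> \<open>Since \<open>G = C(e) C(d)\<close>, the index of
    \<open>C(e) \<inter> C(d)\<close> in \<open>C(e)\<close> is \<open>cs d\<close>, and
    \<open>u\<close> divides it.\<close>
  have "C e <#> C d = carrier G"
    using set_mult_eq_carrier_if_coprime_index[OF Ce Cd class_size_times_centralizer[OF c(1)]
        class_size_times_centralizer[OF d] ne(3)] .
  then have "order G * card ?J = card (C e) * card (C d)"
    using card_set_mult_times_Int[OF Ce Cd] by (simp add: order_def)
  then have "(cs d * card (C d)) * card ?J = (card ?J * w * u) * card (C d)"
    unfolding class_size_times_centralizer[OF d] using u w by simp
  then have "card (C d) * (card ?J * cs d) = card (C d) * (card ?J * (w * u))" by (simp only: mult_ac)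
  then have "cs d = w * u" using posJ posd by simp
  then have u1: "u dvd cs d" by simp
  have "card ?I * cs (e \<otimes> x) = card ?I * (cs e * u)"
    using class_size_times_centralizer[of "e \<otimes> x"] class_size_times_centralizer[OF c(1)] ex(2) u c
    by (simp only: mult_ac m_closed)
  then have "cs (e \<otimes> x) = cs e * u" using posI by simp
  then have "u dvd cs (e \<otimes> x)" by simp
  then have "u = 1" using u1 cop by (metis coprime_common_divisor_nat)
  then have "?I = C e" using u subgroup_finite[OF Ce] by (intro card_subset_eq) auto
  then show ?thesis by blast
qed

text \<open>The norm of \<open>d\<close> is centralized by \<open>C(e) \<inter> C(d)\<close>, hence
  by \<open>C(e)\<close>. As \<open>G = C(e) C(d)\<close>, every conjugate of \<open>d\<close> is a
  conjugate by some \<open>h\<close> in \<open>C(e)\<close>; this \<open>h\<close> carries the norm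
  of \<open>d\<close> to that of the conjugate and also fixes it. \<open>r = Suc n\<close> matches
  the \<open>n + 1\<close> factors of \<open>norm_A\<close>.\<close>

lemma norm_A_const:
  assumes r: "Factorial_Ring.prime r" "r dvd cs d" "r = Suc n" and e: "primary G r e" "e \<notin> center G" "e [^] r \<in> center G"
    and x: "x \<in> D"
  shows "norm_A n e x = norm_A n e d"
proof -
  note ne = noncentral_primary_noncoprime[OF r(1,2) e(1,2)]
  have ec: "e \<in> carrier G" using e primaryD by auto
  have dD: "d \<in> D" using d by (auto simp: D_def conj_class_def intro!: exI[of _ \<one>])
  then have dA: "d \<in> A" using D_le_A by blast
  let ?N = "norm_A n e d"
  have NA: "?N \<in> A" using norm_A_closed[OF dA ec] .
  have Nc: "?N \<in> carrier G" using subgroup_mem[OF subgroup_A NA] .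
  have "C e \<subseteq> C ?N"
  proof (rule centralizer_le_if_Int_le[OF r(1,2) e(1,2) primary_A[OF NA]])
    show "?N \<in> C e" using norm_A_in_centralizer[OF dA ec] e(3) r(3) by simp
    show "C e \<inter> C d \<subseteq> C ?N"
    proof
      fix h assume h: "h \<in> C e \<inter> C d"
      then have hc: "h \<in> carrier G" by (auto dest: centralizerD)
      have eh: "e \<in> C h" "d \<in> C h" using h ec d centralizer_sym by auto
      have "conj_pow e d i \<in> C h" for i
        unfolding conj_pow_def using eh hc by (intro centralizer_mult centralizer_inv centralizer_pow)
      then have "?N \<in> C h" unfolding norm_A_def
        using conj_pow_in_A[OF dA ec] hc by (intro prod_A_in_centralizer)
      then show "h \<in> C ?N" using hc centralizer_sym by blast
    qed
  qed
  obtain g where g: "g \<in> carrier G" "x = g \<otimes> d \<otimes> inv g" using x by (auto simp: D_def conj_class_def)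
  obtain h k where hk: "h \<in> C e" "k \<in> C d" "g = h \<otimes> k"
    using factorize_coprime_class_sizes[OF ec d ne(3) g(1)] .
  have c: "h \<in> carrier G" "k \<in> carrier G" using hk by (auto dest: centralizerD)
  have kd: "k \<otimes> d = d \<otimes> k" using hk by (auto dest: centralizerD)
  have "x = h \<otimes> (k \<otimes> d) \<otimes> inv k \<otimes> inv h" unfolding g(2) hk(3) using c d by (simp add: m_assoc inv_mult_group)
  also have "\<dots> = h \<otimes> d \<otimes> inv h" unfolding kd using c d by (simp add: m_assoc)
  finally have xh: "x = h \<otimes> d \<otimes> inv h" .
  have "conj_pow e x i = h \<otimes> conj_pow e d i \<otimes> inv h" for i
  proof -
    have ei: "e [^] i \<in> C h" using hk(1) ec c centralizer_sym centralizer_pow by blast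
    have eh: "e [^] i \<otimes> h = h \<otimes> e [^] i" using ei by (auto dest: centralizerD)
    have "inv (e [^] i) \<in> C h" using centralizer_inv[OF c(1) ei] .
    then have "inv h \<in> C (inv (e [^] i))" using c ec centralizer_sym centralizer_inv by (metis inv_closed nat_pow_closed)
    then have ih: "inv h \<otimes> inv (e [^] i) = inv (e [^] i) \<otimes> inv h" by (auto dest: centralizerD)
    have "conj_pow e x i = (e [^] i \<otimes> h) \<otimes> d \<otimes> (inv h \<otimes> inv (e [^] i))"
      unfolding conj_pow_def xh using ec c d by (simp add: m_assoc)
    also have "\<dots> = h \<otimes> conj_pow e d i \<otimes> inv h"
      unfolding conj_pow_def eh ih using ec c d by (simp add: m_assoc)
    finally show ?thesis .
  qed
  then have "conj_pow e x = (\<lambda>i. h \<otimes> conj_pow e d i \<otimes> inv h)" by blast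
  then have "norm_A n e x = prod_A (\<lambda>i. h \<otimes> conj_pow e d i \<otimes> inv h) n"
    unfolding norm_A_def by (rule arg_cong)
  also have "\<dots> = h \<otimes> ?N \<otimes> inv h"
    unfolding norm_A_def using conj_prod_A[OF conj_pow_in_A[OF dA ec] c(1), symmetric] .
  also have "\<dots> = ?N"
  proof -
    have "h \<otimes> ?N = ?N \<otimes> h" using hk(1) \<open>C e \<subseteq> C ?N\<close> by (auto dest: centralizerD)
    then show ?thesis using Nc c by (simp add: m_assoc)
  qed
  finally show ?thesis .
qed

lemma pow_noncentral:
  assumes r: "Factorial_Ring.prime r" and e: "e \<in> carrier G" "e \<notin> center G" "e [^] r \<in> center G" and i: "\<not> r dvd (i::nat)"
  shows "e [^] i \<notin> center G"
proof
  assume "e [^] i \<in> center G"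
  then have "e [^] gcd r i \<in> center G"
    using pow_mem_subgroup_if_coprime[OF subgroup_center e(1) e(3)] by blast
  moreover have "gcd r i = 1" using r i by (simp add: prime_imp_coprime flip: coprime_iff_gcd_eq_1)
  ultimately show False using e by simp
qed

text \<open>If no \<open>e f\<^sup>j\<close> is central, then multiplying the norms with respect to \<open>e f\<^sup>j\<close> over all \<open>j < r\<close>
  gives \<open>x\<^sup>r\<close> times norms with respect to the \<open>f\<^sup>i\<close>; so \<open>x\<^sup>r\<close> is constant on the class of \<open>d\<close>.\<close>

lemma exists_central_mult:
  assumes r: "Factorial_Ring.prime r" "r dvd cs d" and e: "primary G r e" "e [^] r \<in> center G"
    and f: "primary G r f" "f \<notin> center G" "f [^] r \<in> center G" and comm: "f \<in> C e"
  shows "\<exists>j. e \<otimes> f [^] (j::nat) \<in> center G"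
proof (rule ccontr)
  assume "\<not> ?thesis"
  then have nc: "e \<otimes> f [^] j \<notin> center G" for j :: nat by blast
  note rr = prime_dvd_d[OF r]
  \<comment> \<open>With \<open>r = n + 2\<close>, products over \<open>{..Suc n}\<close> have
    \<open>r\<close> factors, and \<open>{..n}\<close> indexes the exponents
    \<open>1, ..., r - 1\<close> shifted by one.\<close>
  obtain n where n: "r = Suc (Suc n)" using prime_ge_2_nat[OF r(1)] by (metis Suc_1 Suc_le_D add_2_eq_Suc le_Suc_ex)
  have c: "e \<in> carrier G" "f \<in> carrier G" using e f primaryD by auto
  have fe: "f [^] j \<in> C e" for j :: nat using comm c centralizer_pow by blast
  have fj: "primary G r (f [^] j)" for j :: nat using primary_pow[OF r(1) f(1)] .
  have efp: "primary G r (e \<otimes> f [^] j)" for j :: nat using primary_mult[OF r(1) e(1) fj fe] .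
  have efi: "(e \<otimes> f [^] j) [^] (i::nat) = e [^] i \<otimes> f [^] (j * i)" for i j :: nat
  proof -
    have "e \<otimes> f [^] j = f [^] j \<otimes> e" using centralizerD(2)[OF fe[of j]] by simp
    from pow_mult_distrib[OF this c(1) nat_pow_closed[OF c(2)], of i] show ?thesis using c by (simp add: nat_pow_pow)
  qed
  have central_pow: "(f [^] j) [^] r \<in> center G" for j :: nat
  proof -
    have "(f [^] j) [^] r = (f [^] r) [^] j" using c by (simp add: nat_pow_pow mult.commute)
    then show ?thesis using subgroup_pow[OF subgroup_center f(3)] by simp
  qed
  have efr: "(e \<otimes> f [^] j) [^] r \<in> center G" for j :: nat
    using efi[of j r] subgroup_mult[OF subgroup_center e(2) central_pow[of j]] c by (simp add: nat_pow_pow)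
  let ?AG = "G\<lparr>carrier := A\<rparr>"
  have step: "x [^] r = d [^] r" if x: "x \<in> D" for x
  proof -
    have dD: "d \<in> D" using d by (auto simp: D_def conj_class_def intro!: exI[of _ \<one>])
    \<comment> \<open>\<open>P\<close> and \<open>R\<close> are formed from \<open>d\<close> alone,
      so \<open>P = R z^r\<close> for all conjugates \<open>z\<close> makes \<open>z^r\<close>
      constant.\<close>
    define P where "P = prod_A (\<lambda>j. norm_A (Suc n) (e \<otimes> f [^] j) d) (Suc n)"
    define R where "R = prod_A (\<lambda>i. e [^] Suc i \<otimes> norm_A (Suc n) (f [^] Suc i) d \<otimes> inv (e [^] Suc i)) n"
    have *: "P = R \<otimes> z [^] r" if z: "z \<in> D" for z
    proof -
      have zA: "z \<in> A" using z D_le_A by blast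
      have zc: "z \<in> carrier G" using z D_carrier by blast
      define F where "F j i = conj_pow (e \<otimes> f [^] j) z i" for i j :: nat
      have FA: "F j i \<in> A" for i j unfolding F_def using zA c by (intro conj_pow_in_A) auto
      have "P = prod_A (\<lambda>j. norm_A (Suc n) (e \<otimes> f [^] j) z) (Suc n)"
        unfolding P_def using norm_A_const[OF r n efp nc efr z] by simp
      also have "\<dots> = prod_A (\<lambda>j. prod_A (F j) (Suc n)) (Suc n)"
        unfolding norm_A_def F_def ..
      also have "\<dots> = prod_A (\<lambda>i. prod_A (\<lambda>j. F j i) (Suc n)) (Suc n)"
        using comm_group.finprod_atMost_swap[OF comm_group_A, of F "Suc n" "Suc n"] FA by simp
      also have "\<dots> = prod_A (\<lambda>i. prod_A (\<lambda>j. F j (Suc i)) (Suc n)) n \<otimes> prod_A (\<lambda>j. F j 0) (Suc n)"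
        using FA by (intro prod_A_Suc2 prod_A_closed)
      also have "prod_A (\<lambda>j. F j 0) (Suc n) = z [^] r"
      proof -
        have "F j 0 = z" for j unfolding F_def conj_pow_def using zc c by simp
        moreover have "z [^]\<^bsub>?AG\<^esub> r = z [^] r" by (simp add: nat_pow_consistent[symmetric])
        ultimately show ?thesis
          using comm_monoid.finprod_const[of ?AG z "{..Suc n}"] comm_group_A zA n by (simp add: comm_group_def)
      qed
      also have "prod_A (\<lambda>i. prod_A (\<lambda>j. F j (Suc i)) (Suc n)) n = R"
        unfolding R_def
      proof (rule comm_monoid.finprod_cong')
        show "Group.comm_monoid ?AG" using comm_group_A by (simp add: comm_group_def)
        have "norm_A (Suc n) (f [^] Suc i) d \<in> A" for i
          using norm_A_closed[of d "f [^] Suc i"] dD D_le_A c by blast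
        then show "(\<lambda>i. e [^] Suc i \<otimes> norm_A (Suc n) (f [^] Suc i) d \<otimes> inv (e [^] Suc i)) \<in> {..n} \<rightarrow> carrier ?AG"
          using c by (auto intro!: conj_A)
        fix i assume i: "i \<in> {..n}"
        have "\<not> r dvd Suc i" using i n by (auto dest: dvd_imp_le)
        then have nci: "f [^] Suc i \<notin> center G" using pow_noncentral[OF r(1) c(2) f(2,3)] by blast
        \<comment> \<open>\<open>(e f^j)^(i+1) = e^(i+1) (f^(i+1))^j\<close>, so for fixed
          \<open>i\<close> the product over \<open>j\<close> is a conjugate of a norm with respect
          to \<open>f^(i+1)\<close>.\<close>
        have "F j (Suc i) = e [^] Suc i \<otimes> conj_pow (f [^] Suc i) z j \<otimes> inv (e [^] Suc i)" for j
        proof -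
          have "(e \<otimes> f [^] j) [^] Suc i = e [^] Suc i \<otimes> (f [^] Suc i) [^] j"
            unfolding efi nat_pow_pow[OF c(2)] by (simp only: mult.commute)
          then show ?thesis unfolding F_def conj_pow_def
            using c zc by (simp add: inv_mult_group m_assoc del: nat_pow_Suc)
        qed
        then have "prod_A (\<lambda>j. F j (Suc i)) (Suc n)
            = prod_A (\<lambda>j. e [^] Suc i \<otimes> conj_pow (f [^] Suc i) z j \<otimes> inv (e [^] Suc i)) (Suc n)" by presburger
        also have "\<dots> = e [^] Suc i \<otimes> norm_A (Suc n) (f [^] Suc i) z \<otimes> inv (e [^] Suc i)"
          unfolding norm_A_def using conj_pow_in_A[OF zA] c by (intro conj_prod_A[symmetric]) auto
        also have "norm_A (Suc n) (f [^] Suc i) z = norm_A (Suc n) (f [^] Suc i) d"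
          using norm_A_const[OF r n fj nci central_pow z] .
        finally show "prod_A (\<lambda>j. F j (Suc i)) (Suc n)
            = e [^] Suc i \<otimes> norm_A (Suc n) (f [^] Suc i) d \<otimes> inv (e [^] Suc i)" .
      qed simp
      finally show ?thesis .
    qed
    have "R \<in> A" unfolding R_def
      using norm_A_closed[of d] dD D_le_A c by (intro prod_A_closed conj_A) auto
    then have "R \<in> carrier G" using subgroup_mem[OF subgroup_A] by blast
    moreover have "R \<otimes> x [^] r = R \<otimes> d [^] r" using *[OF x] *[OF dD] by simp
    ultimately show ?thesis using x D_carrier d by (simp add: subset_iff)
  qed
  obtain g where g: "g \<in> carrier G" "g \<otimes> d \<otimes> inv g \<noteq> d" using noncentralE[OF d d_noncentral] .
  let ?x = "g \<otimes> d \<otimes> inv g"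
  have dD: "d \<in> D" using d by (auto simp: D_def conj_class_def intro!: exI[of _ \<one>])
  have xD: "?x \<in> D" using conj_D[OF dD g(1)] .
  have xc: "?x \<in> carrier G" using g d by simp
  \<comment> \<open>\<open>t\<close> lies in the \<open>q\<close>-group \<open>A\<close> and
    satisfies \<open>t^r = 1\<close> with \<open>r \<noteq> q\<close>, so \<open>t = 1\<close>,
    against the choice of \<open>g\<close>.\<close>
  let ?t = "?x \<otimes> inv d"
  have tA: "?t \<in> A" using xD dD D_le_A subgroup_mult[OF subgroup_A] subgroup_inv[OF subgroup_A] by blast
  have tc: "?t \<in> carrier G" using xc d by simp
  have "?x \<otimes> inv d = inv d \<otimes> ?x"
    using A_commute xD dD D_le_A subgroup_inv[OF subgroup_A] by blast
  then have "?t [^] r = ?x [^] r \<otimes> (inv d) [^] r" using xc d by (intro pow_mult_distrib) auto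
  also have "\<dots> = \<one>" using step[OF xD] d by (simp add: nat_pow_inv)
  finally have "?t [^] r = \<one>" .
  moreover obtain k where k: "ord ?t = q ^ k" using primary_A[OF tA] by (auto simp: primary_def)
  then have "?t [^] (q ^ k) = \<one>" using tc by (metis pow_ord_eq_1)
  moreover have "coprime r (q ^ k)" using r(1) q rr(2) by (simp add: primes_coprime)
  ultimately have "?t = \<one>" using eq_one_if_coprime_pows[OF tc] by blast
  then have "?x = d" using xc d by (metis inv_equality inv_inv inv_closed)
  then show False using g by simp
qed

text \<open>\<open>r^\<alpha>\<close> is the order of \<open>u\<close> modulo the centre; the
  induction lowers the exponent of \<open>z\<close>. In \<open>z^r = u^i t\<close> an
  \<open>i\<close> prime to \<open>r\<close> would make \<open>u^(r^\<beta>)\<close> central with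
  \<open>\<beta> < \<alpha>\<close>. So \<open>i = r i'\<close>, and some product of
  \<open>z u^(-i')\<close> with a power of \<open>u^(r^(\<alpha>-1))\<close> is central by
  \<open>exists_central_mult\<close>.\<close>

lemma pow_mult_central_if_order_le:
  assumes r: "Factorial_Ring.prime r" "r dvd cs d" and u: "primary G r u" "u [^] (r ^ \<alpha>) \<in> center G"
    "\<And>n. n < \<alpha> \<Longrightarrow> u [^] (r ^ n) \<notin> center G"
  shows "primary G r z \<Longrightarrow> z \<in> C u \<Longrightarrow> \<beta> \<le> \<alpha> \<Longrightarrow> z [^] (r ^ \<beta>) \<in> center G \<Longrightarrow>
    \<exists>(i::nat) t. t \<in> center G \<and> z = u [^] i \<otimes> t"
proof (induction \<beta> arbitrary: z)
  case 0
  have "z \<in> carrier G" using 0 primaryD by blast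
  then show ?case using 0 primaryD[OF u(1)] by (intro exI[of _ 0] exI[of _ z]) simp
next
  case (Suc \<beta>)
  have c: "u \<in> carrier G" "z \<in> carrier G" using u Suc primaryD by auto
  have "(z [^] r) [^] (r ^ \<beta>) \<in> center G" using Suc.prems c by (simp add: nat_pow_pow)
  moreover have "z [^] r \<in> C u" using Suc.prems c centralizer_pow by blast
  ultimately obtain i :: nat and t where it: "t \<in> center G" "z [^] r = u [^] i \<otimes> t"
    using Suc.IH[of "z [^] r"] Suc.prems primary_pow[OF r(1)] by auto
  have tc: "t \<in> carrier G" "\<And>g. g \<in> carrier G \<Longrightarrow> g \<otimes> t = t \<otimes> g" using it(1) by (auto simp: center_def)
  have "r dvd i"
  proof (rule ccontr)
    assume ri: "\<not> r dvd i"
    have ut: "u [^] i \<otimes> t = t \<otimes> u [^] i" using tc c by blast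
    then have "(z [^] r) [^] (r ^ \<beta>) = u [^] (i * r ^ \<beta>) \<otimes> t [^] (r ^ \<beta>)"
      unfolding it(2) using c pow_mult_distrib[OF ut nat_pow_closed[OF c(1)] tc(1)] by (simp add: nat_pow_pow)
    then have "u [^] (i * r ^ \<beta>) = (z [^] r) [^] (r ^ \<beta>) \<otimes> inv (t [^] (r ^ \<beta>))"
      using c tc(1) by (simp add: m_assoc)
    then have 1: "u [^] (i * r ^ \<beta>) \<in> center G"
      using \<open>(z [^] r) [^] (r ^ \<beta>) \<in> center G\<close> subgroup_mult[OF subgroup_center]
        subgroup_inv[OF subgroup_center] subgroup_pow[OF subgroup_center it(1)] by simp
    have "gcd (i * r ^ \<beta>) (r ^ \<alpha>) = r ^ \<beta>"
    proof -
      have "r ^ \<alpha> = r ^ (\<alpha> - \<beta>) * r ^ \<beta>" using Suc.prems(3) by (simp flip: power_add)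
      moreover have "gcd i (r ^ (\<alpha> - \<beta>)) = 1"
        using ri r(1) by (metis coprime_commute coprime_iff_gcd_eq_1 coprime_power_right_iff prime_imp_coprime)
      ultimately show ?thesis by (simp add: gcd_mult_distrib_nat[symmetric] mult.commute[of _ "r ^ \<beta>"])
    qed
    then have "u [^] (r ^ \<beta>) \<in> center G"
      using pow_mem_subgroup_if_coprime[OF subgroup_center c(1) 1 u(2)] by simp
    then show False using u(3)[of \<beta>] Suc.prems(3) by simp
  qed
  then obtain i' where i': "i = r * i'" by (auto elim: dvdE)
  define e where "e = z \<otimes> inv (u [^] i')"
  define f where "f = u [^] (r ^ (\<alpha> - 1))"
  have zu: "u \<in> C z" using Suc.prems(2) c centralizer_sym by blast
  have ui: "inv (u [^] i') = u [^] ((ord (u [^] i') - 1) * i')"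
    using inv_eq_pow[of "u [^] i'"] c by (simp add: nat_pow_pow mult.commute)
  have uiz: "inv (u [^] i') \<in> C z" unfolding ui using zu c centralizer_pow by blast
  have ep: "primary G r e"
    unfolding e_def using primary_mult[OF r(1) Suc.prems(1) _ uiz] primary_pow[OF r(1) u(1)] ui by metis
  have "z \<otimes> inv (u [^] i') = inv (u [^] i') \<otimes> z" using uiz by (auto dest: centralizerD)
  then have "e [^] r = z [^] r \<otimes> inv (u [^] i') [^] r" unfolding e_def using c by (intro pow_mult_distrib) auto
  also have "inv (u [^] i') [^] r = inv (u [^] i)" using c i' by (simp add: nat_pow_inv nat_pow_pow mult.commute)
  also have "z [^] r \<otimes> inv (u [^] i) = t" unfolding it(2) using tc c by (simp add: m_assoc)
  finally have er: "e [^] r \<in> center G" using it(1) by simp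
  have fp: "primary G r f" unfolding f_def using primary_pow[OF r(1) u(1)] .
  have f: "f \<notin> center G" unfolding f_def using u(3)[of "\<alpha> - 1"] Suc.prems(3) by simp
  have "r ^ (\<alpha> - 1) * r = r ^ \<alpha>" using Suc.prems(3) by (simp flip: power_Suc2)
  then have fr: "f [^] r \<in> center G" unfolding f_def using u(2) c by (simp add: nat_pow_pow)
  have "e \<in> C u" unfolding e_def
    using Suc.prems(2) c centralizer_mult centralizer_inv centralizer_pow centralizer_self by (metis nat_pow_closed)
  then have "u \<in> C e" using c centralizer_sym by blast
  then have fe: "f \<in> C e" unfolding f_def using primaryD[OF ep] centralizer_pow by blast
  obtain j :: nat where j: "e \<otimes> f [^] j \<in> center G" using exists_central_mult[OF r ep er fp f fr fe] by blast
  define t' where "t' = e \<otimes> f [^] j"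
  have fc: "f \<in> carrier G" "e \<in> carrier G" using fp ep primaryD by auto
  have t'c: "t' \<in> carrier G" unfolding t'_def using fc by simp
  have comm_t': "g \<otimes> t' = t' \<otimes> g" if "g \<in> carrier G" for g using j that by (auto simp: t'_def center_def)
  \<comment> \<open>The inverse is written as a natural power of \<open>u\<close>, since the
    conclusion asks for a natural exponent.\<close>
  have fj: "inv (f [^] j) = u [^] (r ^ (\<alpha> - 1) * (j * (ord (f [^] j) - 1)))"
  proof -
    have "inv (f [^] j) = (f [^] j) [^] (ord (f [^] j) - 1)" using fc by (intro inv_eq_pow) simp
    also have "\<dots> = f [^] (j * (ord (f [^] j) - 1))" using fc by (simp add: nat_pow_pow)
    also have "\<dots> = u [^] (r ^ (\<alpha> - 1) * (j * (ord (f [^] j) - 1)))"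
      by (subst f_def) (use c in \<open>simp add: nat_pow_pow\<close>)
    finally show ?thesis .
  qed
  have "z = e \<otimes> u [^] i'" unfolding e_def using c by (simp add: m_assoc)
  also have "e = t' \<otimes> inv (f [^] j)" unfolding t'_def using fc by (simp add: m_assoc)
  also have "t' \<otimes> inv (f [^] j) \<otimes> u [^] i' = t' \<otimes> u [^] (r ^ (\<alpha> - 1) * (j * (ord (f [^] j) - 1)) + i')"
    unfolding fj using c t'c by (simp add: m_assoc nat_pow_mult)
  also have "\<dots> = u [^] (r ^ (\<alpha> - 1) * (j * (ord (f [^] j) - 1)) + i') \<otimes> t'"
    using comm_t' c by simp
  finally show ?case using j unfolding t'_def by blast
qed

text \<open>\<open>r ^ o_Z x\<close> is the order of \<open>x\<close> modulo the centre. Of the two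
  elements the one of smaller such order is a power of the other times a central element, so its
  centralizer is the larger.\<close>

lemma centralizer_comparable:
  assumes r: "Factorial_Ring.prime r" "r dvd cs d" and u: "primary G r u" and z: "primary G r z" and comm: "z \<in> C u"
  shows "C u \<subseteq> C z \<or> C z \<subseteq> C u"
proof -
  have c: "u \<in> carrier G" "z \<in> carrier G" using u z primaryD by auto
  define o_Z where "o_Z x = (LEAST n. x [^] (r ^ n) \<in> center G)" for x
  have oZ: "x [^] (r ^ o_Z x) \<in> center G" "\<And>n. n < o_Z x \<Longrightarrow> x [^] (r ^ n) \<notin> center G" if x: "primary G r x" for x
  proof -
    obtain k where "ord x = r ^ k" using x by (auto simp: primary_def)
    then have "x [^] (r ^ k) \<in> center G" using primaryD[OF x] one_central by (metis pow_ord_eq_1)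
    then show "x [^] (r ^ o_Z x) \<in> center G" unfolding o_Z_def by (rule LeastI)
    show "\<And>n. n < o_Z x \<Longrightarrow> x [^] (r ^ n) \<notin> center G" unfolding o_Z_def by (rule not_less_Least)
  qed
  have *: "C x \<subseteq> C y" if x: "primary G r x" and y: "primary G r y" and xy: "y \<in> C x" and le: "o_Z y \<le> o_Z x" for x y
  proof -
    have xc: "x \<in> carrier G" using x primaryD by auto
    obtain i :: nat and t where it: "t \<in> center G" "y = x [^] i \<otimes> t"
      using pow_mult_central_if_order_le[OF r x oZ[OF x] y xy le oZ(1)[OF y]] by blast
    then show ?thesis using centralizer_center_mult[OF it(1), of "x [^] i"] xc centralizer_le_pow[OF xc] by simp
  qed
  have "u \<in> C z" using comm c centralizer_sym by blast
  then show ?thesis using *[OF u z comm] *[OF z u] by linarith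
qed

text \<open>Induction over the primes in \<open>L\<close>, modifying \<open>x\<close> at each prime
  \<open>r\<close>. If \<open>r\<close> does not divide \<open>cs d\<close>, the
  \<open>r\<close>-part \<open>v\<close> of \<open>b\<close> is central. Otherwise \<open>r\<close>
  does not divide \<open>cs x\<close>, so a conjugate \<open>u\<close> of \<open>v\<close> commutes
  with \<open>x\<close>; the centralizers of \<open>u\<close> and of the \<open>r\<close>-part of
  \<open>x\<close> are comparable, and if necessary that part is replaced by \<open>u\<close>.
  Shrinking \<open>C(x)\<close> only enlarges \<open>cs x\<close> to a multiple, so \<open>p\<close>
  and the common factor with \<open>cs b\<close> survive.\<close>

lemma dvd_class_size_extend:
  assumes b1: "reg b1" "p dvd cs b1" "\<not> coprime (cs b1) (cs b)" and L: "finite L" "\<And>l. l \<in> L \<Longrightarrow> Factorial_Ring.prime l"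
  shows "\<exists>x. reg x \<and> p dvd cs x \<and> \<not> coprime (cs x) (cs b) \<and> (\<forall>l \<in> L. C x \<subseteq> C (part l b))"
  using L
proof (induction L)
  case empty
  then show ?case using b1 by auto
next
  case (insert r L)
  obtain x where x: "reg x" "p dvd cs x" "\<not> coprime (cs x) (cs b)" "\<And>l. l \<in> L \<Longrightarrow> C x \<subseteq> C (part l b)"
    using insert by auto
  have xc: "x \<in> carrier G" using x(1) by blast
  have r: "Factorial_Ring.prime r" using insert by simp
  let ?v = "part r b"
  have vc: "?v \<in> carrier G" using b by simp
  show ?case
  proof (cases "r dvd cs d")
    case False
    have "?v \<in> center G"
    proof (cases "r = q")
      case True then show ?thesis using q_part_central by simp
    next
      case False then show ?thesis using part_central[OF r] \<open>\<not> r dvd cs d\<close> by blast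
    qed
    then have "C x \<subseteq> C ?v" by (simp add: center_iff)
    then show ?thesis using x by blast
  next
    case True
    note rr = prime_dvd_d[OF r True]
    have "coprime (cs x) (cs d)" using dichotomy[of x] x by blast
    then have rx: "\<not> r dvd cs x" using True r by (meson coprime_common_divisor not_prime_unit)
    \<comment> \<open>Conjugation by elements of \<open>Y\<close> preserves the inclusions already
      achieved for \<open>L\<close>. Intersecting with \<open>carrier G\<close> covers
      \<open>L = {}\<close>.\<close>
    define Y where "Y = carrier G \<inter> (\<Inter>l\<in>L. C (part l b))"
    have Y: "subgroup Y G"
    proof (cases "L = {}")
      case True then show ?thesis using subgroup_self by (simp add: Y_def)
    next
      case False
      have "Y = \<Inter>((\<lambda>l. C (part l b)) ` L)" using False by (auto simp: Y_def dest: centralizerD)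
      then show ?thesis using False b by (auto intro!: subgroups_Inter subgroup_centralizer)
    qed
    have CxY: "C x \<subseteq> Y" using x(4) by (auto simp: Y_def dest: centralizerD)
    have vY: "?v \<in> Y"
    proof -
      have "?v \<in> C b" unfolding part_def using b centralizer_pow by simp
      then show ?thesis using vc centralizer_le_part[OF b] by (auto simp: Y_def)
    qed
    \<comment> \<open>Since \<open>C(x) \<subseteq> Y\<close>, the \<open>Y\<close>-orbit of
      \<open>x\<close> has size \<open>|Y : C(x)|\<close>, a divisor of \<open>cs x\<close>, so the
      conjugating element can be found in \<open>Y\<close>.\<close>
    have "Y \<inter> C x = C x" using CxY by blast
    then have "card ((\<lambda>h. h \<otimes> x \<otimes> inv h) ` Y) * card (C x) = card Y"
      using card_orbit_times_stabilizer[OF Y xc] by simp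
    moreover obtain w where w: "order G = card Y * w"
      using card_subgroup_dvd[OF Y subgroup_self subgroup.subset[OF Y]] by (auto simp: order_def elim: dvdE)
    ultimately have "cs x * card (C x) = (card ((\<lambda>h. h \<otimes> x \<otimes> inv h) ` Y) * card (C x)) * w"
      unfolding class_size_times_centralizer[OF xc] by simp
    then have "card (C x) * cs x = card (C x) * (card ((\<lambda>h. h \<otimes> x \<otimes> inv h) ` Y) * w)"
      by (simp only: mult_ac)
    then have "cs x = card ((\<lambda>h. h \<otimes> x \<otimes> inv h) ` Y) * w"
      using card_subgroup_pos[OF subgroup_centralizer[OF xc]] by simp
    then have "\<not> r dvd card ((\<lambda>h. h \<otimes> x \<otimes> inv h) ` Y)" using rx by auto
    then obtain h where h: "h \<in> Y" "inv h \<otimes> ?v \<otimes> h \<in> C x"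
      using orbit_fixed_by_primary[OF r primary_part[OF b] Y vY xc] by blast
    have hc: "h \<in> carrier G" using subgroup_mem[OF Y h(1)] .
    let ?u = "inv h \<otimes> ?v \<otimes> h"
    have u: "primary G r ?u" using primary_conj'[OF primary_part[OF b] hc] .
    have uc: "?u \<in> carrier G" using u by (rule primaryD)
    have xr: "primary G r (part r x)" "part r x \<in> carrier G" using primary_part xc by auto
    have ux: "part r x \<in> C ?u"
      using h(2) centralizer_le_part[OF xc] centralizer_sym xr(2) by blast
    obtain y where y: "reg y" "p dvd cs y" "\<not> coprime (cs y) (cs b)" "C y \<subseteq> C x" "C y \<subseteq> C ?u"
    proof (cases "C (part r x) \<subseteq> C ?u")
      case True
      then have "C x \<subseteq> C ?u" using centralizer_le_part[OF xc] by blast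
      then show ?thesis using that[of x] x by blast
    next
      case False
      then have sub: "C ?u \<subseteq> C (part r x)" using centralizer_comparable[OF r \<open>r dvd cs d\<close> u xr(1) ux] by blast
      \<comment> \<open>\<open>C(u)\<close> is the smaller centralizer here: the
        \<open>r\<close>-part of \<open>x\<close> is exchanged for \<open>u\<close> and the
        \<open>r'\<close>-part kept.\<close>
      let ?x' = "copart r x"
      have x'c: "?x' \<in> carrier G" using xc by simp
      have "?u \<in> C ?x'" using h(2) centralizer_le_copart[OF xc] by blast
      then have x'u: "?x' \<in> C ?u" using x'c centralizer_sym by blast
      obtain k where k: "ord ?u = r ^ k" using u by (auto simp: primary_def)
      have "coprime (ord ?u) (ord ?x')"
        unfolding k using not_dvd_ord_copart[OF xc r] r by (metis coprime_commute coprime_power_right_iff prime_imp_coprime)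
      then have y: "reg (?u \<otimes> ?x')" "C (?u \<otimes> ?x') = C ?u \<inter> C ?x'"
        using coprime_mult[OF reg_primary[OF r rr(1) u] reg_copart[OF x(1)] x'u] by blast+
      then have "C (?u \<otimes> ?x') \<subseteq> C x" using sub centralizer_part_copart[OF xc r] by blast
      moreover from this have "cs x dvd cs (?u \<otimes> ?x')" using class_size_dvd[OF xc] y(1) by blast
      moreover from this have "p dvd cs (?u \<otimes> ?x')" "\<not> coprime (cs (?u \<otimes> ?x')) (cs b)"
        using x(2,3) by (meson dvd_trans, meson coprime_divisors dvd_refl)
      ultimately show ?thesis using that[OF y(1)] y(2) by blast
    qed
    have yc: "y \<in> carrier G" using y(1) by blast
    \<comment> \<open>Conjugation by \<open>h\<close> turns \<open>u\<close> back into
      \<open>v\<close>, while \<open>h \<in> Y\<close> protects the primes in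
      \<open>L\<close>.\<close>
    let ?z = "h \<otimes> y \<otimes> inv h"
    have csz: "cs ?z = cs y" using class_size_conj[OF yc hc] .
    have "C ?z \<subseteq> C (part l b)" if l: "l \<in> insert r L" for l
    proof
      fix g assume g: "g \<in> C ?z"
      have gc: "g \<in> carrier G" using g by (auto dest: centralizerD)
      have g': "inv h \<otimes> g \<otimes> h \<in> C y" using g centralizer_conj[OF yc hc gc] by simp
      have lc: "part l b \<in> carrier G" using b by simp
      have geq: "g = h \<otimes> (inv h \<otimes> g \<otimes> h) \<otimes> inv h" using hc gc by (simp add: m_assoc)
      show "g \<in> C (part l b)"
      proof (cases "l \<in> L")
        case True
        then have "h \<in> C (part l b)" using h(1) by (auto simp: Y_def)
        moreover have "inv h \<otimes> g \<otimes> h \<in> C (part l b)" using g' y(4) x(4)[OF True] by blast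
        ultimately have "h \<otimes> (inv h \<otimes> g \<otimes> h) \<otimes> inv h \<in> C (part l b)"
          using lc centralizer_mult centralizer_inv by blast
        then show ?thesis using geq by simp
      next
        case False
        then have "l = r" using l by simp
        have "inv h \<otimes> g \<otimes> h \<in> C ?u" using g' y(5) by blast
        then have "g \<in> C (h \<otimes> ?u \<otimes> inv h)" using centralizer_conj[OF uc hc gc] by simp
        moreover have "h \<otimes> ?u \<otimes> inv h = ?v" using hc vc by (simp add: m_assoc)
        ultimately show ?thesis using \<open>l = r\<close> by simp
      qed
    qed
    then show ?thesis using reg_conj[OF y(1) hc] y(2,3) csz by (intro exI[of _ ?z]) simp
  qed
qed

lemma no_class_divisible_by_p:
  assumes b1: "reg b1" "p dvd cs b1" "\<not> coprime (cs b1) (cs b)" shows False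
proof -
  let ?L = "{l. Factorial_Ring.prime l \<and> l dvd ord b}"
  have "finite ?L" using ord_pos[OF b] finite_prime_divisors[of "ord b"] by simp
  then obtain x where x: "reg x" "p dvd cs x" "\<forall>l \<in> ?L. C x \<subseteq> C (part l b)"
    using dvd_class_size_extend[OF b1] by blast
  have "C x \<subseteq> C b"
  proof
    fix g assume g: "g \<in> C x"
    show "g \<in> C b" using centralizer_eq_Int_parts[OF b centralizerD(1)[OF g]] x(3) g by blast
  qed
  then have "C x = C b" using max_eq x(1) by blast
  then have "cs x dvd cs b" using class_size_dvd[of x b] x(1) b by blast
  then show False using x(2) p_b by (meson dvd_trans)
qed

end

text \<open>A prime \<open>s \<noteq> p\<close> dividing neither \<open>cs b\<close> nor
  \<open>cs d\<close> divides no class size at all; so \<open>s = p\<close>, the case just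
  refuted.\<close>

lemma (in maximal_class) no_path:
  assumes b1: "reg b1" "s dvd cs b1" "\<not> coprime (cs b1) (cs b)"
    and s: "Factorial_Ring.prime s" "\<not> s dvd cs b" "\<not> s dvd cs d"
  shows False
proof -
  have "s = p" using not_dvd_class_size[OF s(1) _ s(2,3)] b1(1,2) by blast
  then interpret maximal_class_p G p q b d using s by unfold_locales auto
  show False using no_class_divisible_by_p b1 \<open>s = p\<close> by blast
qed

section \<open>Distance at most two in the common divisor graph\<close>

context finite_group begin

text \<open>As \<open>Y = B\<close> and \<open>Y = E\<close> are allowed, this means distance at most two between \<open>B\<close> and \<open>E\<close>.\<close>

definition near :: "nat \<Rightarrow> 'a set \<Rightarrow> 'a set \<Rightarrow> bool" where
  "near p B E \<longleftrightarrow> (\<exists>Y \<in> noncentral_p_regular_classes p G. \<not> coprime (card Y) (card B) \<and> \<not> coprime (card Y) (card E))"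

text \<open>Let \<open>Y\<close> witness \<open>near p B E\<close> and let the prime
  \<open>s\<close> divide \<open>card Y\<close> and \<open>card E\<close>. If \<open>F\<close> is
  not near, \<open>s\<close> does not divide \<open>card B\<close>, as otherwise \<open>E\<close>
  would be a witness for \<open>F\<close>, nor the class size of \<open>d\<close>, as otherwise
  \<open>Y\<close> would be one. Then \<open>no_path\<close> applies to \<open>Y\<close>.\<close>

lemma near_step:
  assumes p: "Factorial_Ring.prime p" and sep: "p_separable p G"
    and B: "B \<in> noncentral_p_regular_classes p G"
    and max: "\<forall>Y \<in> p_regular_classes p G. card Y \<le> card B"
    and E: "E \<in> noncentral_p_regular_classes p G" "near p B E"
    and F: "F \<in> noncentral_p_regular_classes p G" "\<not> coprime (card E) (card F)"
  shows "near p B F"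
proof (rule ccontr)
  assume nn: "\<not> near p B F"
  have cls: "\<exists>x. x \<in> carrier G \<and> \<not> p dvd ord x \<and> x \<notin> center G \<and> Y = conj_class G x \<and> card Y = class_size G x"
    if "Y \<in> noncentral_p_regular_classes p G" for Y
    using that by (auto simp: noncentral_p_regular_classes_def p_regular_def class_size_def)
  obtain b where hb: "b \<in> carrier G" "\<not> p dvd ord b" "card B = class_size G b" using cls[OF B] by blast
  obtain x where x: "x \<in> carrier G" "\<not> p dvd ord x" "x \<notin> center G" "card F = class_size G x" using cls[OF F(1)] by blast
  obtain Y where Y: "Y \<in> noncentral_p_regular_classes p G" "\<not> coprime (card Y) (card B)" "\<not> coprime (card Y) (card E)"
    using E(2) unfolding near_def by blast
  obtain y where y: "y \<in> carrier G" "\<not> p dvd ord y" "card Y = class_size G y" using cls[OF Y(1)] by blast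
  have "gcd (card Y) (card E) \<noteq> 1" using Y(3) by (simp add: coprime_iff_gcd_eq_1)
  then obtain s where s: "Factorial_Ring.prime s" "s dvd gcd (card Y) (card E)" using prime_factor_nat by blast
  then have sY: "s dvd card Y" and sE: "s dvd card E" by auto
  have ncop: "\<not> coprime m n" if "s dvd m" "s dvd n" for m n
    using that s(1) by (meson coprime_common_divisor not_prime_unit)
  \<comment> \<open>Some primary part of the representative of \<open>F\<close> is noncentral; its
    class size divides \<open>card F\<close>, so a factor shared with it is shared with
    \<open>card F\<close>.\<close>
  obtain q where q: "Factorial_Ring.prime q" "part q x \<notin> center G" using center_if_parts[OF x(1)] x(3) by blast
  let ?d = "part q x"
  have d: "?d \<in> carrier G" using x(1) by simp
  have dx: "class_size G ?d dvd class_size G x" using class_size_dvd[OF d x(1) centralizer_le_part[OF x(1)]] .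
  have ncopd: "\<not> coprime m (card F)" if "\<not> coprime m (class_size G ?d)" for m
    using that dx x(4) by (metis coprime_divisors dvd_refl)
  interpret maximal_class G p q b ?d
  proof unfold_locales
    show "class_size G z \<le> class_size G b" if "z \<in> carrier G" "\<not> p dvd ord z" for z
      using max that hb(3) by (auto simp: p_regular_classes_def p_regular_def class_size_def)
    show "\<not> p dvd ord ?d" using ord_part_dvd[OF x(1)] x(2) by (meson dvd_trans)
    show "coprime (class_size G z) (class_size G b) \<or> coprime (class_size G z) (class_size G ?d)"
      if z: "z \<in> carrier G" "\<not> p dvd ord z" for z
    proof (rule ccontr)
      assume c: "\<not> ?thesis"
      have "class_size G z \<noteq> 1" using c by auto
      then have "z \<notin> center G" using center_iff_class_size[OF z(1)] by simp
      then have "conj_class G z \<in> noncentral_p_regular_classes p G"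
        using z by (auto simp: noncentral_p_regular_classes_def p_regular_def)
      moreover have "\<not> coprime (card (conj_class G z)) (card B)" "\<not> coprime (card (conj_class G z)) (card F)"
        using c hb(3) ncopd[of "class_size G z"] by (auto simp: class_size_def)
      ultimately show False using nn unfolding near_def by blast
    qed
  qed (use p q sep hb x primary_part in auto)
  show False
  proof (rule no_path[of y s])
    show "reg y" using y by (simp add: reg_def)
    show "s dvd class_size G y" using sY y by simp
    show "\<not> coprime (class_size G y) (class_size G b)" using Y(2) y(3) hb(3) by simp
    show "Factorial_Ring.prime s" by (rule s(1))
    show "\<not> s dvd class_size G b"
    proof
      assume "s dvd class_size G b"
      then have "near p B F" unfolding near_def using E(1) F(2) ncop[OF sE] hb(3) by auto
      then show False using nn by simp
    qed
    show "\<not> s dvd class_size G ?d"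
    proof
      assume "s dvd class_size G ?d"
      then have "\<not> coprime (card Y) (card F)" using ncop[OF sY] ncopd by blast
      then have "near p B F" unfolding near_def using Y(1,2) by blast
      then show False using nn by simp
    qed
  qed
qed

end

theorem theoremA:
  fixes G :: "('a, 'b) monoid_scheme" and p :: nat and B\<^sub>0 :: "'a set"
  assumes "Factorial_Ring.prime p"
    and "group G" and "finite (carrier G)"
    and "p_separable p G"
    and "Digraph_Component.connected (common_divisor_graph p G)"
    and "B\<^sub>0 \<in> noncentral_p_regular_classes p G"
    and "\<forall>C \<in> p_regular_classes p G. card C \<le> card B\<^sub>0"
  shows "\<forall>D \<in> noncentral_p_regular_classes p G.
           graph_dist (common_divisor_graph p G) B\<^sub>0 D \<le> 2"
proof
  interpret finite_group G using assms(2,3) by (simp add: finite_group_def finite_group_axioms_def)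
  let ?\<Gamma> = "common_divisor_graph p G"
  let ?V = "noncentral_p_regular_classes p G"
  interpret \<Gamma>: graph ?\<Gamma> using assms(3) by (rule graph_common_divisor_graph)
  have gt: "gcd m n > 1 \<longleftrightarrow> \<not> coprime m n" if "n > 0" for m n :: nat
  proof -
    have "gcd m n > 0" using that by simp
    then show ?thesis unfolding coprime_iff_gcd_eq_1 by linarith
  qed
  have pos: "card Y > 1" if "Y \<in> ?V" for Y
    using that card_conj_class_gt_1_iff[OF assms(3)] by (auto simp: noncentral_p_regular_classes_def p_regular_def)
  have arc: "(Y, Z) \<in> arcs ?\<Gamma> \<longleftrightarrow> Y \<in> ?V \<and> Z \<in> ?V \<and> Y \<noteq> Z \<and> \<not> coprime (card Y) (card Z)" for Y Z
    unfolding common_divisor_graph_def using gt pos by (auto simp del: One_nat_def) (metis gt pos less_trans zero_less_one)+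
  have verts: "verts ?\<Gamma> = ?V" by (simp add: common_divisor_graph_def)
  have th: "tail ?\<Gamma> = fst" "head ?\<Gamma> = snd" by (simp_all add: common_divisor_graph_def)
  fix D assume D: "D \<in> ?V"
  \<comment> \<open>Connectedness refers to the symmetric closure; the arcs are symmetric already,
    so reachability along arcs follows.\<close>
  have "B\<^sub>0 \<rightarrow>\<^sup>*\<^bsub>?\<Gamma>\<^esub> D"
    using assms(5) D assms(6) \<Gamma>.reachable_mk_symmetric_eq[OF \<Gamma>.sym_arcs]
    unfolding connected_def strongly_connected_def by (simp add: verts)
  then have "near p B\<^sub>0 D \<and> D \<in> ?V"
  proof (induction rule: \<Gamma>.reachable_induct)
    case base
    have "\<not> coprime (card B\<^sub>0) (card B\<^sub>0)" using pos[OF assms(6)] by simp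
    then show ?case using assms(6) unfolding near_def by blast
  next
    case (step E F)
    then have "(E, F) \<in> arcs ?\<Gamma>" by (auto simp: arcs_ends_def arc_to_ends_def th)
    then show ?case using near_step[OF assms(1,4,6,7), of E F] step arc by auto
  qed
  then obtain Y where Y: "Y \<in> ?V" "\<not> coprime (card Y) (card B\<^sub>0)" "\<not> coprime (card Y) (card D)"
    by (auto simp: near_def)
  have "\<exists>es. \<Gamma>.awalk B\<^sub>0 es D \<and> length es \<le> 2"
  proof -
    have awalk_edge: "\<Gamma>.awalk u [(u, v)] v" if "(u, v) \<in> arcs ?\<Gamma>" for u v
      using that arc by (auto simp: \<Gamma>.awalk_Cons_iff \<Gamma>.awalk_Nil_iff th verts)
    have sym: "\<not> coprime (card B\<^sub>0) (card Y)" using Y(2) by (simp add: coprime_commute)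
    \<comment> \<open>\<open>Y\<close> may coincide with an end; distinct ends are then joined by an
      arc.\<close>
    consider "B\<^sub>0 = D" | "B\<^sub>0 \<noteq> D" "Y = B\<^sub>0 \<or> Y = D" | "Y \<noteq> B\<^sub>0" "Y \<noteq> D" by blast
    then show ?thesis
    proof cases
      case 1
      then show ?thesis using D by (intro exI[of _ "[]"]) (simp add: \<Gamma>.awalk_Nil_iff verts)
    next
      case 2
      then have "(B\<^sub>0, D) \<in> arcs ?\<Gamma>" using Y(3) sym D assms(6) arc by auto
      then show ?thesis using awalk_edge by (intro exI[of _ "[(B\<^sub>0, D)]"]) simp
    next
      case 3
      then have "(B\<^sub>0, Y) \<in> arcs ?\<Gamma>" "(Y, D) \<in> arcs ?\<Gamma>" using Y sym D assms(6) arc by auto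
      then have "\<Gamma>.awalk B\<^sub>0 [(B\<^sub>0, Y), (Y, D)] D"
        using awalk_edge[of Y D] by (simp add: \<Gamma>.awalk_Cons_iff th)
      then show ?thesis by (intro exI[of _ "[(B\<^sub>0, Y), (Y, D)]"]) simp
    qed
  qed
  then obtain es where es: "\<Gamma>.awalk B\<^sub>0 es D" "length es \<le> 2" by blast
  have "graph_dist ?\<Gamma> B\<^sub>0 D \<le> ereal (\<Gamma>.awalk_cost (\<lambda>_. 1) es)"
    unfolding graph_dist_def using \<Gamma>.min_cost_le_walk_cost[OF es(1)] .
  also have "\<Gamma>.awalk_cost (\<lambda>_. 1) es = real (length es)"
    by (simp add: \<Gamma>.awalk_cost_def sum_list_triv)
  also have "ereal (real (length es)) \<le> 2" using es(2) by simp
  finally show "graph_dist ?\<Gamma> B\<^sub>0 D \<le> 2" .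
qed

end
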